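(* Let $e\ge1$ and let $\{f_\iota\}_{\iota\in I}$ be a size- and translation-stable family, with limiting sizes $\sigma_1,\ldots,\sigma_e>0$ and limiting translations $\tau_1,\ldots,\tau_e\in\mathbb{R}$, of $e$-variable quadratic multiplicative character polynomials over fields $\{\mathbb{F}_{q_\iota}\}_{\iota\in I}$. (i) As $q_\iota\to\infty$, $\|f_\iota\|_4^4/\|f_\iota\|_2^4\to -\frac{2^{e+1}}{3^e}\prod_{j=1}^e\sigma_j+2\prod_{j=1}^e\Omega\!\left(\frac{1}{\sigma_j},0\right)+\prod_{j=1}^e\Omega\!\left(\frac{1}{\sigma_j},1+\frac{2\tau_j}{\sigma_j}\right)$. (ii) This limit, as a function of $(\sigma_1,\ldots,\sigma_e)\in(0,\infty)^e$ and $(\tau_1,\ldots,\tau_e)\in\mathbb{R}^e$, is globally minimized if and only if $\sigma_1,\ldots,\sigma_e$ all equal the unique root in $(1,1+\frac{3^{e+1}}{2^{2e+3}})$ of $x^{3e}-\frac{3^e}{2^{e-2}}(x-1)(3x^2-4x+2)^{e-1}-\frac{3^e}{2^{2e}}(2x-1)^{2e-1}$, and $\tau_j\in\{\frac{1-2\sigma_j}{4}+\frac{n}{2}:n\in\mathbb{Z}\}$ for each $j\in\{1,\ldots,e\}$.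
   Context: Let $p$ be prime and $q=p^e$. An $e$-variable multiplicative character polynomial over $\mathbb{F}_q$ is $f(z_1,\ldots,z_e)=\sum_{j=(j_1,\ldots,j_e)\in S}\chi(\alpha(j+t))z_1^{j_1}\cdots z_e^{j_e}$, where $\chi$ is a nontrivial multiplicative character of $\mathbb{F}_q^*$ extended by $\chi(0)=0$, the support $S=S_1\times\cdots\times S_e$ with each $S_k=\{0,1,\ldots,s_k-1\}$ ($s_k\ge1$), the translation $t=(t_1,\ldots,t_e)\in\mathbb{Z}^e$, and the arrangement $\alpha$ is a group epimorphism from $\mathbb{Z}^e$ onto the additive group of $\mathbb{F}_q$. The family is quadratic if every $\chi$ is the quadratic character. A family $\{f_\iota\}$ with $f_\iota$ over $\mathbb{F}_{p_\iota^e}$, support $S_\iota=S_{\iota,1}\times\cdots\times S_{\iota,e}$ and translation $t_\iota=(t_{\iota,1},\ldots,t_{\iota,e})$ is size-stable (resp. translation-stable) with limiting sizes $\sigma_k>0$ (resp. limiting translations $\tau_k\in\mathbb{R}$) if the set of primes $\{p_\iota\}$ is infinite and for each $k$, $|S_{\iota,k}|/p_\iota\to\sigma_k$ (resp. $t_{\iota,k}/p_\iota\to\tau_k$) as $q_\iota\to\infty$. Norms: $\|f\|_r=\left(\frac{1}{(2\pi)^e}\int_{[0,2\pi]^e}|f(e^{i\theta_1},\ldots,e^{i\theta_e})|^r d\theta\right)^{1/r}$. For real $x\ne0$, $y$: $\Omega(x,y)=\sum_{n\in\mathbb{Z}}\max(0,1-|xn-y|)^2$. *)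

theory Defs
  imports
    "HOL-Analysis.Analysis"
    "HOL-Computational_Algebra.Primes"
    "HOL-Algebra.Product_Groups"
    "HOL-Algebra.Multiplicative_Group"
begin

(* Variables are indexed by {1..e}; elements of Z^e are the functions nat => int that are
   undefined outside {1..e}. *)

abbreviation int_vectors :: "nat \<Rightarrow> (nat \<Rightarrow> int) monoid" where
  "int_vectors e \<equiv> product_group {1..e} (\<lambda>_. integer_group)"

definition complex_units :: "complex monoid" where
  "complex_units = \<lparr>carrier = UNIV - {0}, monoid.mult = (*), one = 1\<rparr>"

definition nontrivial_mult_character :: "'a ring \<Rightarrow> ('a \<Rightarrow> complex) \<Rightarrow> bool" where
  "nontrivial_mult_character F \<psi> \<longleftrightarrow>
     \<psi> \<in> hom (mult_of F) complex_units \<and>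
     (\<exists>x\<in>carrier (mult_of F). \<psi> x \<noteq> 1) \<and>
     \<psi> \<zero>\<^bsub>F\<^esub> = 0"

(* The quadratic character is the multiplicative character of order two. It exists, and is then
   unique, exactly when the finite field has odd characteristic. *)

definition quadratic_character :: "'a ring \<Rightarrow> ('a \<Rightarrow> complex) \<Rightarrow> bool" where
  "quadratic_character F \<psi> \<longleftrightarrow>
     nontrivial_mult_character F \<psi> \<and> (\<forall>x\<in>carrier (mult_of F). \<psi> x ^ 2 = 1)"

(* The data of a character polynomial: field F of order p^e, the prime p, character psi,
   arrangement alpha, sizes s_k of the factors S_k of the support, translation t. *)

record 'a char_poly =
  base_field :: "'a ring"
  base_prime :: nat
  mult_char :: "'a \<Rightarrow> complex"
  arrangement :: "(nat \<Rightarrow> int) \<Rightarrow> 'a"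
  support_size :: "nat \<Rightarrow> nat"
  translation :: "nat \<Rightarrow> int"

definition mult_char_poly :: "nat \<Rightarrow> 'a char_poly \<Rightarrow> bool" where
  "mult_char_poly e f \<longleftrightarrow>
     prime (base_prime f) \<and>
     field (base_field f) \<and>
     card (carrier (base_field f)) = base_prime f ^ e \<and>
     nontrivial_mult_character (base_field f) (mult_char f) \<and>
     arrangement f \<in> epi (int_vectors e) (add_monoid (base_field f)) \<and>
     (\<forall>k\<in>{1..e}. support_size f k \<ge> 1)"

definition quadratic_char_poly :: "nat \<Rightarrow> 'a char_poly \<Rightarrow> bool" where
  "quadratic_char_poly e f \<longleftrightarrow>
     mult_char_poly e f \<and> quadratic_character (base_field f) (mult_char f)"

definition support :: "nat \<Rightarrow> 'a char_poly \<Rightarrow> (nat \<Rightarrow> nat) set" where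
  "support e f = (\<Pi>\<^sub>E k\<in>{1..e}. {0..<support_size f k})"

definition poly_value :: "nat \<Rightarrow> 'a char_poly \<Rightarrow> (nat \<Rightarrow> complex) \<Rightarrow> complex" where
  "poly_value e f z =
     (\<Sum>j\<in>support e f.
        mult_char f (arrangement f (\<lambda>k\<in>{1..e}. int (j k) + translation f k)) *
        (\<Prod>k\<in>{1..e}. z k ^ j k))"

definition torus_norm :: "nat \<Rightarrow> real \<Rightarrow> ((nat \<Rightarrow> complex) \<Rightarrow> complex) \<Rightarrow> real" where
  "torus_norm e r g =
     (1 / (2 * pi) ^ e *
       (LINT \<theta>:(\<Pi>\<^sub>E k\<in>{1..e}. {0..2 * pi})|(\<Pi>\<^sub>M k\<in>{1..e}. lborel).
          cmod (g (\<lambda>k. exp (\<i> * complex_of_real (\<theta> k)))) powr r)) powr (1 / r)"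

(* The filter on the index set along which the field order p^e tends to infinity. *)

definition field_order_at_top :: "nat \<Rightarrow> 'i set \<Rightarrow> ('i \<Rightarrow> 'a char_poly) \<Rightarrow> 'i filter" where
  "field_order_at_top e I f =
     inf (filtercomap (\<lambda>\<iota>. base_prime (f \<iota>) ^ e) at_top) (principal I)"

definition size_stable :: "nat \<Rightarrow> 'i set \<Rightarrow> ('i \<Rightarrow> 'a char_poly) \<Rightarrow> (nat \<Rightarrow> real) \<Rightarrow> bool" where
  "size_stable e I f \<sigma> \<longleftrightarrow>
     infinite ((\<lambda>\<iota>. base_prime (f \<iota>)) ` I) \<and>
     (\<forall>k\<in>{1..e}. \<sigma> k > 0 \<and>
        ((\<lambda>\<iota>. real (support_size (f \<iota>) k) / real (base_prime (f \<iota>))) \<longlongrightarrow> \<sigma> k)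
          (field_order_at_top e I f))"

definition translation_stable ::
    "nat \<Rightarrow> 'i set \<Rightarrow> ('i \<Rightarrow> 'a char_poly) \<Rightarrow> (nat \<Rightarrow> real) \<Rightarrow> bool" where
  "translation_stable e I f \<tau> \<longleftrightarrow>
     infinite ((\<lambda>\<iota>. base_prime (f \<iota>)) ` I) \<and>
     (\<forall>k\<in>{1..e}.
        ((\<lambda>\<iota>. real_of_int (translation (f \<iota>) k) / real (base_prime (f \<iota>))) \<longlongrightarrow> \<tau> k)
          (field_order_at_top e I f))"

definition \<Omega> :: "real \<Rightarrow> real \<Rightarrow> real" where
  "\<Omega> x y = (\<Sum>\<^sub>\<infinity>n\<in>(UNIV::int set). (max 0 (1 - \<bar>x * of_int n - y\<bar>))\<^sup>2)"

definition limit_ratio :: "nat \<Rightarrow> (nat \<Rightarrow> real) \<Rightarrow> (nat \<Rightarrow> real) \<Rightarrow> real" where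
  "limit_ratio e \<sigma> \<tau> =
     - (2 ^ (e + 1) / 3 ^ e) * (\<Prod>j\<in>{1..e}. \<sigma> j)
     + 2 * (\<Prod>j\<in>{1..e}. \<Omega> (1 / \<sigma> j) 0)
     + (\<Prod>j\<in>{1..e}. \<Omega> (1 / \<sigma> j) (1 + 2 * \<tau> j / \<sigma> j))"

(* The exponent e - 2 is negative for e = 1, hence an integer power. *)

definition size_poly :: "nat \<Rightarrow> real \<Rightarrow> real" where
  "size_poly e x =
     x ^ (3 * e)
     - 3 ^ e / 2 powi (int e - 2) * (x - 1) * (3 * x\<^sup>2 - 4 * x + 2) ^ (e - 1)
     - 3 ^ e / 2 ^ (2 * e) * (2 * x - 1) ^ (2 * e - 1)"

definition optimal_size :: "nat \<Rightarrow> real \<Rightarrow> bool" where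
  "optimal_size e x \<longleftrightarrow>
     x \<in> {1<..<1 + 3 ^ (e + 1) / 2 ^ (2 * e + 3)} \<and> size_poly e x = 0"

end

theory Submission
  imports Defs "HOL-Real_Asymp.Real_Asymp"
begin

text \<open>Expand each value of the quadratic character \<open>\<eta>\<close> by Gauss sums. In \<open>\<parallel>f\<parallel>\<^sub>4\<^sup>4\<close> the four
  exponents are balanced, so the exponential factor does not change when the four frequencies are
  shifted together; averaging over the shifts replaces \<open>\<eta> k * \<eta> l * \<eta> m * \<eta> n\<close> by the correlation
  \<open>\<Sum>x. \<eta> (x + k) * \<eta> (x + l) * \<eta> (x + m) * \<eta> (x + n)\<close>. Frequencies that agree in pairs give the
  products of values of \<open>\<Omega>\<close>, which count lattice points. For the other frequencies Weil's bound is not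
  needed, since the weaker \<open>O(q powr (3 / 4))\<close> suffices: the substitution \<open>x \<mapsto> 1 / x\<close> turns the
  correlation into a sum over a cubic with distinct roots, which takes the same absolute value on
  the \<open>q\<^sup>3\<close> or so cubics obtained by affine substitutions and scalar multiples, while the fourth
  moment over all cubics is \<open>O(q\<^sup>6)\<close>.

  For the minimum, \<open>\<Omega> (1 / \<sigma>)\<close> is smallest at the half period, which determines \<open>\<tau>\<close>. Replacing a size
  outside \<open>[1, 4 / 3]\<close> by \<open>1\<close> decreases the value. Inside this range, moving two sizes closer
  together with their product fixed decreases it too, so all sizes are equal, and a function of
  one variable remains.\<close>

section \<open>The function \<open>\<Omega>\<close>\<close>

text \<open>The main term of the fourth moment has order q^2. The error is at most
  \<open>beta\<close> times the l1 norm of the phase sums, divided by q^3. That norm is O((p log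
  p)^(4e)): only the balance a + b = c + d couples the four support points, and roots of unity
  modulo \<open>period\<close> detect it, after which everything factors into Dirichlet kernels, one
  per coordinate. So the error is q^(7/4) up to logarithms. The negative term of the limit comes
  from four equal frequencies, which three pairings count three times instead of once. In the
  minimization the obstacle is a difference of products, which cannot be minimized one coordinate at
  a time. The values of \<Omega> at 0 and at the half period are trapezoidal and midpoint sums of
  one function with integral 2/3. This puts the triples of mean, peak and trough into a cone that is
  closed under products and has three generators, so that replacing one size need only be tested on
  these generators. The box [1, 4/3] lies in the range where peak and trough are polynomials in 1 /
  \<sigma>, and it contains the interval in which the root is sought.\<close>

definition hat :: "real \<Rightarrow> real" where
  "hat t = (max 0 (1 - \<bar>t\<bar>))\<^sup>2"

lemma hat_nonneg [simp]: "hat t \<ge> 0"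
  by (simp add: hat_def)

lemma hat_minus [simp]: "hat (- t) = hat t"
  by (simp add: hat_def)

lemma hat_eq_0: "\<bar>t\<bar> \<ge> 1 \<Longrightarrow> hat t = 0"
  by (simp add: hat_def)

lemma \<Omega>_hat: "\<Omega> x y = (\<Sum>\<^sub>\<infinity>n\<in>(UNIV::int set). hat (x * of_int n - y))"
  by (simp add: \<Omega>_def hat_def)

lemma \<Omega>_eq_sum:
  assumes "finite A" "\<And>n. n \<notin> A \<Longrightarrow> \<bar>x * of_int n - y\<bar> \<ge> 1"
  shows "\<Omega> x y = (\<Sum>n\<in>A. hat (x * of_int n - y))"
proof -
  have "\<Omega> x y = (\<Sum>\<^sub>\<infinity>n\<in>A. hat (x * of_int n - y))"
    unfolding \<Omega>_hat
    by (rule infsum_cong_neutral) (use assms(2) in \<open>auto intro: hat_eq_0\<close>)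
  then show ?thesis using assms(1) by simp
qed

lemma \<Omega>_eq_sum_symmetric:
  assumes "x * real N \<ge> 1 + \<bar>y\<bar>" "x > 0"
  shows "\<Omega> x y = (\<Sum>n\<in>{- int N..int N}. hat (x * of_int n - y))"
proof (rule \<Omega>_eq_sum)
  fix n assume "n \<notin> {- int N..int N}"
  then have "real N \<le> \<bar>real_of_int n\<bar>" by auto
  then have "x * real N \<le> \<bar>x * real_of_int n\<bar>"
    using assms(2) by (simp add: abs_mult)
  then show "1 \<le> \<bar>x * real_of_int n - y\<bar>" using assms by linarith
qed auto

lemma exists_large_multiple:
  fixes x c :: real assumes "x > 0" obtains N :: nat where "x * real N \<ge> c"
proof -
  obtain N :: nat where "real N \<ge> c / x" using real_arch_simple by blast
  then show thesis using that[of N] assms by (simp add: field_simps)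
qed

lemma \<Omega>_ge_sum:
  assumes "x > 0" "finite A"
  shows "\<Omega> x y \<ge> (\<Sum>n\<in>A. hat (x * of_int n - y))"
proof -
  obtain N where N: "x * real N \<ge> 1 + \<bar>y\<bar>" using exists_large_multiple[OF assms(1)] .
  have "\<Omega> x y = (\<Sum>n\<in>A \<union> {- int N..int N}. hat (x * of_int n - y))"
    unfolding \<Omega>_eq_sum_symmetric[OF N assms(1)]
  proof (rule sum.mono_neutral_left)
    show "\<forall>n\<in>(A \<union> {- int N..int N}) - {- int N..int N}. hat (x * of_int n - y) = 0"
    proof
      fix n assume "n \<in> (A \<union> {- int N..int N}) - {- int N..int N}"
      then have "real N \<le> \<bar>real_of_int n\<bar>" by auto
      then have "x * real N \<le> \<bar>x * real_of_int n\<bar>"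
        using assms(1) by (simp add: abs_mult)
      then show "hat (x * of_int n - y) = 0" using N by (intro hat_eq_0) linarith
    qed
  qed (use assms in auto)
  also have "\<dots> \<ge> (\<Sum>n\<in>A. hat (x * of_int n - y))"
    by (rule sum_mono2) (use assms in auto)
  finally show ?thesis .
qed

lemma \<Omega>_nonneg: "x > 0 \<Longrightarrow> \<Omega> x y \<ge> 0"
  using \<Omega>_ge_sum[of x "{}" y] by simp

lemma \<Omega>_periodic: "\<Omega> x (y + x * of_int k) = \<Omega> x y"
proof -
  have "\<Omega> x y = (\<Sum>\<^sub>\<infinity>n\<in>(UNIV::int set). hat (x * of_int (n - k) - y))"
    unfolding \<Omega>_hat
    by (rule infsum_reindex_bij_witness[of _ "\<lambda>n. n - k" "\<lambda>n. n + k"]) auto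
  also have "\<dots> = \<Omega> x (y + x * of_int k)"
    unfolding \<Omega>_hat by (rule infsum_cong) (simp add: algebra_simps)
  finally show ?thesis by simp
qed

text \<open>Index -m is paired with m + 1: as \<open>hat\<close> is even, these are the points x m +
  y and x (m + 1) - y, both nonnegative, and their midpoint x (m + 1/2) does not depend on y. This
  lets convexity compare different y pair by pair.\<close>

lemma \<Omega>_pairs:
  assumes "x > 0" "0 \<le> y" "y \<le> x" "x * real N \<ge> 1"
  shows "\<Omega> x y = (\<Sum>m<N. hat (x * real m + y) + hat (x * real (Suc m) - y))"
proof -
  let ?A = "(\<lambda>m. - int m) ` {..<N}" and ?B = "(\<lambda>m. int (Suc m)) ` {..<N}"
  have "\<Omega> x y = (\<Sum>n\<in>?A \<union> ?B. hat (x * of_int n - y))"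
  proof (rule \<Omega>_eq_sum)
    fix n assume n: "n \<notin> ?A \<union> ?B"
    have "n \<le> - int N \<or> n \<ge> int N + 1"
    proof (rule ccontr)
      assume "\<not> ?thesis"
      then have "n = - int (nat (- n)) \<and> nat (- n) < N \<or> n = int (Suc (nat (n - 1))) \<and> nat (n - 1) < N"
        by auto
      then show False using n by blast
    qed
    then show "1 \<le> \<bar>x * real_of_int n - y\<bar>"
    proof
      assume "n \<le> - int N"
      then have "real_of_int n \<le> - real N" by linarith
      then have "x * real_of_int n \<le> x * - real N" using assms(1) by (intro mult_left_mono) auto
      then show ?thesis using assms by auto
    next
      assume "n \<ge> int N + 1"
      then have "real_of_int n \<ge> real N + 1" by linarith
      then have "x * real_of_int n \<ge> x * (real N + 1)" using assms(1) by (intro mult_left_mono) auto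
      then show ?thesis using assms by (auto simp: algebra_simps)
    qed
  qed auto
  also have "\<dots> = (\<Sum>n\<in>?A. hat (x * of_int n - y)) + (\<Sum>n\<in>?B. hat (x * of_int n - y))"
    by (rule sum.union_disjoint) auto
  also have "(\<Sum>n\<in>?A. hat (x * of_int n - y)) = (\<Sum>m<N. hat (x * real m + y))"
    by (subst sum.reindex) (auto simp: inj_on_def intro!: sum.cong,
        metis hat_minus minus_add_distrib uminus_add_conv_diff add.commute)
  also have "(\<Sum>n\<in>?B. hat (x * of_int n - y)) = (\<Sum>m<N. hat (x * real (Suc m) - y))"
    by (subst sum.reindex) (auto simp: inj_on_def intro!: sum.cong)
  finally show ?thesis by (simp add: sum.distrib)
qed

text \<open>On the nonnegative axis \<open>hat\<close> is the square of the convex function max 0 (1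
  - a). Squaring leaves the surplus (u - v)^2 / 2, which is positive once the two values
  differ.\<close>

lemma hat_midpoint_convex:
  assumes "0 \<le> a" "0 \<le> b"
  shows "2 * hat ((a + b) / 2) \<le> hat a + hat b"
    and "a < 1 \<Longrightarrow> b < 1 \<or> a + b < 2 \<Longrightarrow> a \<noteq> b \<Longrightarrow> 2 * hat ((a + b) / 2) < hat a + hat b"
proof -
  define u v where "u = max 0 (1 - a)" and "v = max 0 (1 - b)"
  define m where "m = max 0 (1 - (a + b) / 2)"
  have h: "hat a = u\<^sup>2" "hat b = v\<^sup>2" "hat ((a + b) / 2) = m\<^sup>2"
    using assms by (auto simp: hat_def u_def v_def m_def)
  have "m \<le> (u + v) / 2"
    unfolding m_def u_def v_def max_def by (simp split: if_splits) argo+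
  then have m: "0 \<le> m" "m \<le> (u + v) / 2" by (auto simp: m_def)
  have "m\<^sup>2 \<le> ((u + v) / 2)\<^sup>2" using m by (intro power_mono) auto
  moreover have *: "2 * ((u + v) / 2)\<^sup>2 = u\<^sup>2 + v\<^sup>2 - (u - v)\<^sup>2 / 2"
    by (simp add: power2_eq_square field_simps)
  ultimately show "2 * hat ((a + b) / 2) \<le> hat a + hat b"
    unfolding h using zero_le_power2[of "u - v"] by linarith
  assume "a < 1" "b < 1 \<or> a + b < 2" "a \<noteq> b"
  then have "u \<noteq> v" by (auto simp: u_def v_def max_def)
  then have "(u - v)\<^sup>2 > 0" by simp
  then show "2 * hat ((a + b) / 2) < hat a + hat b"
    unfolding h using \<open>m\<^sup>2 \<le> ((u + v) / 2)\<^sup>2\<close> * by linarith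
qed

lemma \<Omega>_half_pairs:
  assumes "x > 0" "x * real N \<ge> 1"
  shows "\<Omega> x (x / 2) = (\<Sum>m<N. 2 * hat (x * (real m + 1 / 2)))"
  using \<Omega>_pairs[of x "x / 2" N] assms
  by (simp add: algebra_simps)

lemma mod_period:
  fixes x y :: real assumes "x > 0"
  obtains k :: int and y' where "y = y' + x * of_int k" "0 \<le> y'" "y' < x"
proof
  show "y = (y - x * of_int \<lfloor>y / x\<rfloor>) + x * of_int \<lfloor>y / x\<rfloor>" by simp
  have "of_int \<lfloor>y / x\<rfloor> \<le> y / x" "y / x < of_int \<lfloor>y / x\<rfloor> + 1" by (rule of_int_floor_le) linarith
  then show "0 \<le> y - x * of_int \<lfloor>y / x\<rfloor>" "y - x * of_int \<lfloor>y / x\<rfloor> < x"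
    using assms by (simp_all only: pos_le_divide_eq pos_divide_less_eq, simp_all add: algebra_simps)
qed

lemma \<Omega>_half_le:
  assumes "x > 0"
  shows "\<Omega> x (x / 2) \<le> \<Omega> x y"
proof -
  obtain k y' where y: "y = y' + x * of_int k" "0 \<le> y'" "y' < x" using mod_period[OF assms] .
  obtain N where N: "x * real N \<ge> 1" using exists_large_multiple[OF assms] .
  have "2 * hat (x * (real m + 1 / 2)) \<le> hat (x * real m + y') + hat (x * real (Suc m) - y')" for m
  proof -
    have "x * (real m + 1 / 2) = ((x * real m + y') + (x * real (Suc m) - y')) / 2"
      by (simp add: field_simps)
    moreover have "0 \<le> x * real m" using assms by simp
    moreover have "x * real (Suc m) = x * real m + x" by (simp add: algebra_simps)
    moreover have "0 \<le> x * real m + y'" "0 \<le> x * real (Suc m) - y'"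
      using y calculation by linarith+
    ultimately show ?thesis using hat_midpoint_convex(1) by presburger
  qed
  then have "\<Omega> x (x / 2) \<le> \<Omega> x y'"
    using \<Omega>_pairs[of x y' N] \<Omega>_half_pairs[OF assms N] y N assms by (simp add: sum_mono)
  then show ?thesis using y by (simp add: \<Omega>_periodic)
qed

text \<open>For x \<le> 1 the pair m = 0 begins at a point y' < 1, where midpoint convexity is
  strict. For x > 2 the minimum is 0 and is attained on a whole interval of y.\<close>

lemma \<Omega>_eq_half_iff:
  assumes "x > 0" "x \<le> 1"
  shows "\<Omega> x y = \<Omega> x (x / 2) \<longleftrightarrow> (\<exists>k::int. y = x / 2 + x * of_int k)"
proof
  assume eq: "\<Omega> x y = \<Omega> x (x / 2)"
  obtain k y' where y: "y = y' + x * of_int k" "0 \<le> y'" "y' < x" using mod_period[OF assms(1)] .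
  obtain N where N: "x * real N \<ge> 1" using exists_large_multiple[OF assms(1)] .
  have "y' = x / 2"
  proof (rule ccontr)
    assume ne: "y' \<noteq> x / 2"
    have mid: "x * (real m + 1 / 2) = ((x * real m + y') + (x * real (Suc m) - y')) / 2" for m
      by (simp add: field_simps)
    have "(\<Sum>m<N. 2 * hat (x * (real m + 1 / 2))) < (\<Sum>m<N. hat (x * real m + y') + hat (x * real (Suc m) - y'))"
    proof (rule sum_strict_mono_ex1)
      show "\<forall>m\<in>{..<N}. 2 * hat (x * (real m + 1 / 2)) \<le> hat (x * real m + y') + hat (x * real (Suc m) - y')"
      proof
        fix m
        have "0 \<le> x * real m" using assms by simp
        moreover have "x * real (Suc m) = x * real m + x" by (simp add: algebra_simps)
        ultimately show "2 * hat (x * (real m + 1 / 2)) \<le> hat (x * real m + y') + hat (x * real (Suc m) - y')"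
          unfolding mid using y by (intro hat_midpoint_convex(1)) linarith+
      qed
      have "2 * hat (x * (real 0 + 1 / 2)) < hat (x * real 0 + y') + hat (x * real (Suc 0) - y')"
        unfolding mid by (rule hat_midpoint_convex(2)) (use y assms ne in \<open>auto\<close>)
      moreover have "N > 0" using N by (cases N) auto
      ultimately show "\<exists>m\<in>{..<N}. 2 * hat (x * (real m + 1 / 2)) < hat (x * real m + y') + hat (x * real (Suc m) - y')"
        by blast
    qed auto
    then have "\<Omega> x (x / 2) < \<Omega> x y'"
      using \<Omega>_pairs[of x y' N] \<Omega>_half_pairs[OF assms(1) N] y N assms by simp
    then show False using eq y by (simp add: \<Omega>_periodic)
  qed
  then show "\<exists>k::int. y = x / 2 + x * of_int k" using y by auto
qed (auto simp: \<Omega>_periodic)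

text \<open>An antiderivative of \<open>hat\<close> on t \<ge> 0 is -(max 0 (1 - t))^3 / 3, so the
  bound on the right is the integral over [a, b]. The left sides are its trapezoidal and midpoint
  rules, and \<open>hat\<close> is convex there.\<close>

lemma hat_integral_bounds:
  fixes a b :: real
  assumes "0 \<le> a" "a \<le> b"
  shows "(b - a) * (hat a + hat b) / 2 \<ge> ((max 0 (1 - a)) ^ 3 - (max 0 (1 - b)) ^ 3) / 3"
    and "(b - a) * hat ((a + b) / 2) \<le> ((max 0 (1 - a)) ^ 3 - (max 0 (1 - b)) ^ 3) / 3"
proof -
  define u v where "u = 1 - a" and "v = 1 - b"
  have uv: "v \<le> u" "b - a = u - v" using assms by (auto simp: u_def v_def)
  have h: "hat a = (max 0 u)\<^sup>2" "hat b = (max 0 v)\<^sup>2" "hat ((a + b) / 2) = (max 0 ((u + v) / 2))\<^sup>2"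
    using assms by (auto simp: hat_def u_def v_def field_simps)
  \<comment> \<open>The cases locate the kink t = 1: left of a, between a and the midpoint, between
    the midpoint and b, right of b.\<close>
  consider "u \<le> 0" | "v \<le> 0" "0 \<le> u" "u + v \<le> 0" | "v \<le> 0" "0 \<le> u" "u + v \<ge> 0" | "v \<ge> 0" by linarith
  then have "(u - v) * ((max 0 u)\<^sup>2 + (max 0 v)\<^sup>2) / 2 \<ge> ((max 0 u) ^ 3 - (max 0 v) ^ 3) / 3
     \<and> (u - v) * (max 0 ((u + v) / 2))\<^sup>2 \<le> ((max 0 u) ^ 3 - (max 0 v) ^ 3) / 3"
  proof cases
    case 1
    then show ?thesis using uv by (simp add: max_absorb1)
  next
    case 2
    have "u * u\<^sup>2 \<le> (u - v) * u\<^sup>2" using 2 by (intro mult_right_mono) auto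
    moreover have "u ^ 3 \<ge> 0" using 2 by simp
    moreover have "u * u\<^sup>2 = u ^ 3" by (simp add: power2_eq_square power3_eq_cube)
    ultimately have "2 * u ^ 3 \<le> 3 * ((u - v) * u\<^sup>2)" by linarith
    then show ?thesis using 2 \<open>u ^ 3 \<ge> 0\<close> by (simp add: max_absorb1 max_absorb2 mult.commute)
  next
    case 3
    have "u * u\<^sup>2 \<le> (u - v) * u\<^sup>2" using 3 by (intro mult_right_mono) auto
    moreover have p: "u ^ 3 \<ge> 0" using 3 by simp
    moreover have e: "u * u\<^sup>2 = u ^ 3" by (simp add: power2_eq_square power3_eq_cube)
    moreover have "(u - v) * ((u + v) / 2)\<^sup>2 \<le> u ^ 3 / 3"
    proof -
      have "(u - v) * ((u + v) / 2)\<^sup>2 = (u\<^sup>2 - v\<^sup>2) * (u + v) / 4"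
        by (simp add: power2_eq_square field_simps)
      also have "\<dots> \<le> u\<^sup>2 * u / 4"
        using 3 by (intro divide_right_mono mult_mono) auto
      also have "\<dots> = u ^ 3 / 4" using e by (simp add: mult.commute)
      finally show ?thesis using p by linarith
    qed
    moreover have "2 * u ^ 3 \<le> 3 * ((u - v) * u\<^sup>2)" using calculation by linarith
    ultimately show ?thesis using 3 by (simp add: max_absorb1 max_absorb2 mult.commute)
  next
    case 4
    have "(u - v) ^ 3 \<ge> 0" using uv by simp
    moreover have "(u - v) * (u\<^sup>2 + v\<^sup>2) / 2 - (u ^ 3 - v ^ 3) / 3 = (u - v) ^ 3 / 6"
      by (simp add: power2_eq_square power3_eq_cube field_simps)
    moreover have "(u ^ 3 - v ^ 3) / 3 - (u - v) * ((u + v) / 2)\<^sup>2 = (u - v) ^ 3 / 12"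
      by (simp add: power2_eq_square power3_eq_cube field_simps)
    ultimately have "(u - v) * (u\<^sup>2 + v\<^sup>2) / 2 \<ge> (u ^ 3 - v ^ 3) / 3
      \<and> (u - v) * ((u + v) / 2)\<^sup>2 \<le> (u ^ 3 - v ^ 3) / 3" by linarith
    moreover have "max 0 u = u" "max 0 v = v" "max 0 ((u + v) / 2) = (u + v) / 2" using 4 uv by auto
    ultimately show ?thesis by simp
  qed
  then show "(b - a) * (hat a + hat b) / 2 \<ge> ((max 0 (1 - a)) ^ 3 - (max 0 (1 - b)) ^ 3) / 3"
    and "(b - a) * hat ((a + b) / 2) \<le> ((max 0 (1 - a)) ^ 3 - (max 0 (1 - b)) ^ 3) / 3"
    unfolding h uv(2) by (simp_all add: u_def v_def)
qed

text \<open>N cells of length x cover the support, so the integrals add up to the integral over the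
  half-line, 1/3.\<close>

lemma hat_primitive_telescope:
  fixes x :: real
  assumes "x * real N \<ge> 1"
  shows "(\<Sum>m<N. ((max 0 (1 - x * real m)) ^ 3 - (max 0 (1 - x * real (Suc m))) ^ 3) / 3) = 1 / 3"
proof -
  have "(\<Sum>m<N. ((max 0 (1 - x * real m)) ^ 3 - (max 0 (1 - x * real (Suc m))) ^ 3)) = 1"
    using sum_lessThan_telescope'[of "\<lambda>m. (max 0 (1 - x * real m)) ^ 3" N] assms
    by (simp add: max_absorb1)
  then show ?thesis by (simp add: sum_divide_distrib[symmetric])
qed

text \<open>Trapezoidal rule with step x on both half-lines; the full integral of \<open>hat\<close>
  is 2/3.\<close>

lemma \<Omega>_0_ge:
  assumes "x > 0"
  shows "2 / (3 * x) \<le> \<Omega> x 0"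
proof -
  obtain N where N: "x * real N \<ge> 1" using exists_large_multiple[OF assms] .
  have "(\<Sum>m<N. ((max 0 (1 - x * real m)) ^ 3 - (max 0 (1 - x * real (Suc m))) ^ 3) / 3)
     \<le> (\<Sum>m<N. x / 2 * (hat (x * real m + 0) + hat (x * real (Suc m) - 0)))"
  proof (rule sum_mono)
    fix m
    have "x * real (Suc m) - x * real m = x" by (simp add: algebra_simps)
    then show "((max 0 (1 - x * real m)) ^ 3 - (max 0 (1 - x * real (Suc m))) ^ 3) / 3
       \<le> x / 2 * (hat (x * real m + 0) + hat (x * real (Suc m) - 0))"
      using hat_integral_bounds(1)[of "x * real m" "x * real (Suc m)"] assms by simp
  qed
  also have "\<dots> = x / 2 * \<Omega> x 0"
    by (subst \<Omega>_pairs[of x 0 N]) (use assms N in \<open>auto simp: sum_distrib_left\<close>)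
  finally show ?thesis using hat_primitive_telescope[OF N] assms by (simp add: field_simps)
qed

text \<open>Midpoint rule on the same cells, hence the opposite inequality.\<close>

lemma \<Omega>_half_upper:
  assumes "x > 0"
  shows "\<Omega> x (x / 2) \<le> 2 / (3 * x)"
proof -
  obtain N where N: "x * real N \<ge> 1" using exists_large_multiple[OF assms] .
  have "x / 2 * \<Omega> x (x / 2) = (\<Sum>m<N. x * hat (x * (real m + 1 / 2)))"
    unfolding \<Omega>_half_pairs[OF assms N] by (simp add: sum_distrib_left mult.assoc)
  also have "\<dots> \<le> (\<Sum>m<N. ((max 0 (1 - x * real m)) ^ 3 - (max 0 (1 - x * real (Suc m))) ^ 3) / 3)"
  proof (rule sum_mono)
    fix m
    have "x * real (Suc m) - x * real m = x" "(x * real m + x * real (Suc m)) / 2 = x * (real m + 1 / 2)"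
      by (simp_all add: field_simps)
    then show "x * hat (x * (real m + 1 / 2)) \<le> ((max 0 (1 - x * real m)) ^ 3 - (max 0 (1 - x * real (Suc m))) ^ 3) / 3"
      using hat_integral_bounds(2)[of "x * real m" "x * real (Suc m)"] assms by simp
  qed
  finally show ?thesis using hat_primitive_telescope[OF N] assms by (simp add: field_simps)
qed

lemma sum_lessThan_double:
  fixes g :: "nat \<Rightarrow> real" shows "(\<Sum>m<2 * N. g m) = (\<Sum>m<N. g (2 * m) + g (Suc (2 * m)))"
  by (induction N) auto

text \<open>The multiples of x/2 split into the multiples of x and their translates by x/2.\<close>

lemma \<Omega>_double:
  assumes "x > 0"
  shows "\<Omega> x 0 + \<Omega> x (x / 2) = \<Omega> (x / 2) 0"
proof -
  obtain N where N: "x * real N \<ge> 1" using exists_large_multiple[OF assms] .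
  have "\<Omega> (x / 2) 0 = (\<Sum>m<2 * N. hat (x / 2 * real m + 0) + hat (x / 2 * real (Suc m) - 0))"
    by (rule \<Omega>_pairs) (use assms N in auto)
  also have "\<dots> = (\<Sum>m<N. (hat (x * real m + 0) + hat (x * real (Suc m) - 0)) + 2 * hat (x * (real m + 1 / 2)))"
    unfolding sum_lessThan_double
  proof (rule sum.cong)
    fix m
    have "x / 2 * real (2 * m) = x * real m" "x / 2 * real (Suc (2 * m)) = x * (real m + 1 / 2)"
      "x / 2 * real (Suc (Suc (2 * m))) = x * real (Suc m)"
      by (simp_all add: distrib_left add_divide_distrib)
    then show "hat (x / 2 * real (2 * m) + 0) + hat (x / 2 * real (Suc (2 * m)) - 0) +
        (hat (x / 2 * real (Suc (2 * m)) + 0) + hat (x / 2 * real (Suc (Suc (2 * m))) - 0)) =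
        hat (x * real m + 0) + hat (x * real (Suc m) - 0) + 2 * hat (x * (real m + 1 / 2))"
      unfolding add_0_right diff_0_right by (simp only:)
  qed simp
  also have "\<dots> = \<Omega> x 0 + \<Omega> x (x / 2)"
    using \<Omega>_half_pairs[OF assms N] \<Omega>_pairs[of x 0 N] assms N by (simp add: sum.distrib)
  finally show ?thesis by simp
qed

text \<open>The trapezoidal bound for step x/2, split by \<open>\<Omega>_double\<close>; it supplies
  the last inequality of \<open>functional_cone\<close>.\<close>

lemma \<Omega>_sum_ge:
  assumes "x > 0"
  shows "\<Omega> x 0 + \<Omega> x (x / 2) \<ge> 4 / (3 * x)"
  using \<Omega>_0_ge[of "x / 2"] assms \<Omega>_double[OF assms] by simp

section \<open>Central terms of \<Omega> and exact values for x near 1\<close>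

lemma \<Omega>_0_ge_1: "x > 0 \<Longrightarrow> \<Omega> x 0 \<ge> 1"
  using \<Omega>_ge_sum[of x "{0}" 0] by (simp add: hat_def)

lemma \<Omega>_0_lower:
  assumes "x > 0" "x \<le> 1"
  shows "\<Omega> x 0 \<ge> 1 + 2 * (1 - x)\<^sup>2"
  using \<Omega>_ge_sum[of x "{-1, 0, 1}" 0] assms by (simp add: hat_def)

lemma \<Omega>_half_lower:
  assumes "x > 0" "x \<le> 2"
  shows "\<Omega> x (x / 2) \<ge> 2 * (1 - x / 2)\<^sup>2"
  using \<Omega>_ge_sum[of x "{0, 1}" "x / 2"] assms by (simp add: hat_def)

lemma int_cases_near_0: "n \<notin> {-1, 0, 1} \<Longrightarrow> (n::int) \<le> -2 \<or> n \<ge> 2" by auto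

text \<open>Beyond -1, 0, 1 the nearest points are +-2x, outside the support once x \<ge> 1/2. In
  \<open>\<Omega>_half_eq\<close> the corresponding points are +-3x/2, whence the bound 2/3. Both
  ranges contain 1/s for every s in [1, 4/3].\<close>

lemma \<Omega>_0_eq:
  assumes "1 / 2 \<le> x" "x \<le> 1"
  shows "\<Omega> x 0 = 1 + 2 * (1 - x)\<^sup>2"
proof -
  have "\<Omega> x 0 = (\<Sum>n\<in>{-1, 0, 1}. hat (x * of_int n - 0))"
  proof (rule \<Omega>_eq_sum)
    fix n :: int assume "n \<notin> {-1, 0, 1}"
    then have "\<bar>real_of_int n\<bar> \<ge> 2" using int_cases_near_0[of n] by linarith
    then have "1 / 2 * 2 \<le> x * \<bar>real_of_int n\<bar>" using assms by (intro mult_mono) auto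
    then show "1 \<le> \<bar>x * real_of_int n - 0\<bar>" using assms by (simp add: abs_mult)
  qed auto
  then show ?thesis using assms by (simp add: hat_def)
qed

lemma \<Omega>_half_eq:
  assumes "2 / 3 \<le> x" "x \<le> 1"
  shows "\<Omega> x (x / 2) = 2 * (1 - x / 2)\<^sup>2"
proof -
  have "\<Omega> x (x / 2) = (\<Sum>n\<in>{0, 1}. hat (x * of_int n - x / 2))"
  proof (rule \<Omega>_eq_sum)
    fix n :: int assume "n \<notin> {0, 1}"
    then have "n \<le> -1 \<or> n \<ge> 2" by auto
    then have "\<bar>real_of_int n - 1 / 2\<bar> \<ge> 3 / 2" by linarith
    then have "2 / 3 * (3 / 2) \<le> x * \<bar>real_of_int n - 1 / 2\<bar>" using assms by (intro mult_mono) auto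
    also have "\<dots> = \<bar>x * real_of_int n - x / 2\<bar>" using assms by (simp add: abs_mult_pos' algebra_simps)
    finally show "1 \<le> \<bar>x * real_of_int n - x / 2\<bar>" by simp
  qed auto
  then show ?thesis using assms by (simp add: hat_def)
qed

section \<open>Reduction of the minimization to equal sizes\<close>

text \<open>The average of \<Omega> (1/s) over one period. Since 2^(e+1) / 3^e = 2 (2/3)^e, the
  negative term of the limit is minus twice the product of these averages.\<close>

definition mean_value :: "real \<Rightarrow> real" where "mean_value s = 2 * s / 3"
definition peak :: "real \<Rightarrow> real" where "peak s = \<Omega> (1 / s) 0"
definition trough :: "real \<Rightarrow> real" where "trough s = \<Omega> (1 / s) (1 / s / 2)"

text \<open>To be read with w, F, P a mean, peak and trough, or products of such. It is the cone
  generated by (1,1,1), (1,2,0), (0,1,0), with coordinates P, w - P and F + P - 2w. The bound P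
  \<le> w is the midpoint rule, the last one the trapezoidal rule with half step.\<close>

definition functional_cone :: "real \<Rightarrow> real \<Rightarrow> real \<Rightarrow> bool" where
  "functional_cone w F P \<longleftrightarrow> 0 \<le> P \<and> P \<le> w \<and> 2 * w \<le> F + P"

lemma functional_cone_values: "s > 0 \<Longrightarrow> functional_cone (mean_value s) (peak s) (trough s)"
  unfolding functional_cone_def mean_value_def peak_def trough_def
  using \<Omega>_half_upper[of "1 / s"] \<Omega>_sum_ge[of "1 / s"] \<Omega>_nonneg[of "1 / s"] by simp

text \<open>Stability of the cone under products lets one size be changed while the others are kept
  as a single triple.\<close>

lemma functional_cone_mult:
  assumes "functional_cone w F P" "functional_cone w' F' P'"
  shows "functional_cone (w * w') (F * F') (P * P')"
proof -
  have "(2 * w - P) * (2 * w' - P') \<le> F * F'"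
    using assms by (intro mult_mono) (auto simp: functional_cone_def)
  moreover have "0 \<le> (w - P) * (w' - P')" using assms by (auto simp: functional_cone_def)
  moreover have "(2 * w - P) * (2 * w' - P') + P * P' - 2 * (w * w') = 2 * ((w - P) * (w' - P'))"
    by (simp add: algebra_simps)
  ultimately have "2 * (w * w') \<le> F * F' + P * P'" by linarith
  moreover have "P * P' \<le> w * w'" "0 \<le> P * P'"
    using assms by (auto simp: functional_cone_def intro!: mult_mono)
  ultimately show ?thesis by (simp add: functional_cone_def)
qed

lemma functional_cone_prod:
  assumes "finite J" "\<And>j. j \<in> J \<Longrightarrow> \<sigma> j > 0"
  shows "functional_cone (\<Prod>j\<in>J. mean_value (\<sigma> j)) (\<Prod>j\<in>J. peak (\<sigma> j)) (\<Prod>j\<in>J. trough (\<sigma> j))"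
  using assms
  by (induction J) (auto simp: functional_cone_values intro!: functional_cone_mult, simp add: functional_cone_def)

text \<open>The limit at given sizes when every translation is at a half period, where each factor
  of the last product takes its least value.\<close>

definition best_ratio :: "'j set \<Rightarrow> ('j \<Rightarrow> real) \<Rightarrow> real" where
  "best_ratio J \<sigma> = 2 * (\<Prod>j\<in>J. peak (\<sigma> j)) - 2 * (\<Prod>j\<in>J. mean_value (\<sigma> j)) + (\<Prod>j\<in>J. trough (\<sigma> j))"

lemma peak_1 [simp]: "peak 1 = 1"
  using \<Omega>_0_eq[of 1] by (simp add: peak_def)

lemma trough_1 [simp]: "trough 1 = 1 / 2"
  using \<Omega>_half_eq[of 1] by (simp add: trough_def power2_eq_square)

lemma peak_ge_1: "s > 0 \<Longrightarrow> peak s \<ge> 1"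
  using \<Omega>_0_ge_1[of "1 / s"] by (simp add: peak_def)

text \<open>The two functionals are the objective on generators of the cone, (1,2,0) up to a factor
  2 and (1,1,1). For (0,1,0) the bound \<open>peak_ge_1\<close> is enough.\<close>

lemma outside_box:
  assumes "s > 0" "s < 1 \<or> s > 4 / 3"
  shows "2 * peak s - mean_value s > 2 * peak 1 - mean_value 1"
    and "2 * peak s - 2 * mean_value s + trough s > 2 * peak 1 - 2 * mean_value 1 + trough 1"
proof -
  have F1: "peak s \<ge> 1" using peak_ge_1 assms by simp
  have Fw: "peak s \<ge> 2 * s / 3" using \<Omega>_0_ge[of "1 / s"] assms by (simp add: peak_def)
  have P0: "trough s \<ge> 0" using \<Omega>_nonneg[of "1 / s"] assms by (simp add: trough_def)
  have FP: "peak s + trough s \<ge> 4 * s / 3"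
    using \<Omega>_sum_ge[of "1 / s"] assms by (simp add: peak_def trough_def)
  have F2: "peak s \<ge> 1 + 2 * (1 - 1 / s)\<^sup>2" if "s \<ge> 1"
    using \<Omega>_0_lower[of "1 / s"] that by (simp add: peak_def)
  have P2: "trough s \<ge> 2 * (1 - 1 / s / 2)\<^sup>2" if "s \<ge> 1 / 2"
    using \<Omega>_half_lower[of "1 / s"] that by (simp add: trough_def field_simps)
  have e1: "s\<^sup>2 * (1 - 1 / s)\<^sup>2 = (s - 1)\<^sup>2" and e2: "s\<^sup>2 * (1 - 1 / s / 2)\<^sup>2 = (s - 1 / 2)\<^sup>2"
    using assms by (simp_all add: power_mult_distrib[symmetric] algebra_simps)
  show "2 * peak s - mean_value s > 2 * peak 1 - mean_value 1"
  proof (cases "s < 1 \<or> s > 2")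
    case True
    then show ?thesis using F1 Fw assms by (auto simp: mean_value_def)
  next
    case False
    then have s: "4 / 3 < s" "s \<le> 2" using assms by auto
    have p: "(s - 1) * (6 * (s - 1) - s\<^sup>2) > 0"
    proof (rule mult_pos_pos)
      have "10 / 3 * s - 8 / 3 - s\<^sup>2 = (s - 4 / 3) * (2 - s)"
        by (simp add: power2_eq_square field_simps)
      also have "\<dots> \<ge> 0" using s by (intro mult_nonneg_nonneg) auto
      finally show "6 * (s - 1) - s\<^sup>2 > 0" using s by argo
    qed (use s in auto)
    have "s\<^sup>2 * (2 + 4 * (1 - 1 / s)\<^sup>2 - 2 * s / 3 - 4 / 3) = 2 / 3 * ((s - 1) * (6 * (s - 1) - s\<^sup>2))"
    proof -
      have "s\<^sup>2 * (2 + 4 * (1 - 1 / s)\<^sup>2 - 2 * s / 3 - 4 / 3) = s\<^sup>2 * (2 - 2 * s / 3 - 4 / 3) + 4 * (s\<^sup>2 * (1 - 1 / s)\<^sup>2)"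
        by (simp add: ring_distribs)
      also have "\<dots> = 2 / 3 * ((s - 1) * (6 * (s - 1) - s\<^sup>2))"
        unfolding e1 by (simp add: field_simps power2_eq_square)
      finally show ?thesis .
    qed
    then have "s\<^sup>2 * (2 + 4 * (1 - 1 / s)\<^sup>2 - 2 * s / 3 - 4 / 3) > 0"
      using p by (simp only: mult_pos_pos zero_less_divide_iff zero_less_numeral simp_thms)
    then have "2 + 4 * (1 - 1 / s)\<^sup>2 - 2 * s / 3 - 4 / 3 > 0"
      by (rule zero_less_mult_pos) (use assms(1) in simp)
    then show ?thesis using F2 s by (simp add: mean_value_def)
  qed
  \<comment> \<open>Here c = 0 uses only peak s \<ge> 1 and c = 1 the three-term lower bound. The
    number 7/6 is the value at s = 1, and multiplication by s^2 leaves a polynomial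
    inequality.\<close>
  have poly: "2 + 4 * c * (1 - 1 / s)\<^sup>2 - 4 * s / 3 + 2 * (1 - 1 / s / 2)\<^sup>2 > 7 / 6"
    if "s\<^sup>2 * (2 - 4 * s / 3 - 7 / 6) + 4 * c * (s - 1)\<^sup>2 + 2 * (s - 1 / 2)\<^sup>2 > 0" for c
  proof -
    have "s\<^sup>2 * (2 + 4 * c * (1 - 1 / s)\<^sup>2 - 4 * s / 3 + 2 * (1 - 1 / s / 2)\<^sup>2 - 7 / 6)
       = s\<^sup>2 * (2 - 4 * s / 3 - 7 / 6) + 4 * c * (s - 1)\<^sup>2 + 2 * (s - 1 / 2)\<^sup>2"
      unfolding e1[symmetric] e2[symmetric] by (simp add: ring_distribs)
    then have "s\<^sup>2 * (2 + 4 * c * (1 - 1 / s)\<^sup>2 - 4 * s / 3 + 2 * (1 - 1 / s / 2)\<^sup>2 - 7 / 6) > 0"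
      using that by (simp only:)
    then have "2 + 4 * c * (1 - 1 / s)\<^sup>2 - 4 * s / 3 + 2 * (1 - 1 / s / 2)\<^sup>2 - 7 / 6 > 0"
      by (rule zero_less_mult_pos) (use assms(1) in simp)
    then show ?thesis by simp
  qed
  show "2 * peak s - 2 * mean_value s + trough s > 2 * peak 1 - 2 * mean_value 1 + trough 1"
  proof -
    consider "s \<le> 1 / 2" | "1 / 2 < s" "s < 1" | "4 / 3 < s" "s \<le> 3 / 2" | "s > 3 / 2"
      using assms(2) by linarith
    then show ?thesis
    proof cases
      case 1
      then show ?thesis using F1 P0 by (simp add: mean_value_def)
    next
      case 2
      have "8 * s\<^sup>2 - 9 * s + 3 = 8 * (s - 9 / 16)\<^sup>2 + 15 / 32"
        by (simp add: power2_eq_square algebra_simps)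
      then have "(1 - s) * (8 * s\<^sup>2 - 9 * s + 3) > 0"
        using 2 by (intro mult_pos_pos) (auto intro: add_nonneg_pos)
      then have "2 + 4 * 0 * (1 - 1 / s)\<^sup>2 - 4 * s / 3 + 2 * (1 - 1 / s / 2)\<^sup>2 > 7 / 6"
        by (intro poly) (simp add: power2_eq_square algebra_simps)
      then show ?thesis using F1 P2 2 by (simp add: mean_value_def)
    next
      case 3
      have "(s - 4 / 3) * (3 / 2 - s) \<ge> 0" using 3 by (intro mult_nonneg_nonneg) auto
      then have "(s - 1) * (- 8 * s\<^sup>2 + 33 * s - 27) > 0"
        using 3 by (intro mult_pos_pos) (auto simp: power2_eq_square algebra_simps)
      then have "2 + 4 * 1 * (1 - 1 / s)\<^sup>2 - 4 * s / 3 + 2 * (1 - 1 / s / 2)\<^sup>2 > 7 / 6"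
        by (intro poly) (simp add: power2_eq_square algebra_simps)
      then show ?thesis using F2 P2 3 by (simp add: mean_value_def)
    next
      case 4
      \<comment> \<open>By \<open>FP\<close> the linear term is absorbed by one peak and the trough.
        What remains is the other peak, and it exceeds 1 + 2/9 > 7/6.\<close>
      have "1 / s < 2 / 3" using 4 by (simp add: field_simps)
      then have "(1 - 1 / s)\<^sup>2 > (1 / 3)\<^sup>2" by (intro power_strict_mono) auto
      then show ?thesis using F2 FP 4 by (simp add: mean_value_def power2_eq_square)
    qed
  qed
qed

lemma best_ratio_upd_1:
  assumes "finite J" "\<And>j. j \<in> J \<Longrightarrow> \<sigma> j > 0" "i \<in> J" "\<sigma> i < 1 \<or> \<sigma> i > 4 / 3"
  shows "best_ratio J (\<sigma>(i := 1)) < best_ratio J \<sigma>"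
proof -
  define W Fr Pr where "W = (\<Prod>j\<in>J-{i}. mean_value (\<sigma> j))"
    and "Fr = (\<Prod>j\<in>J-{i}. peak (\<sigma> j))" and "Pr = (\<Prod>j\<in>J-{i}. trough (\<sigma> j))"
  have K: "functional_cone W Fr Pr"
    unfolding W_def Fr_def Pr_def by (rule functional_cone_prod) (use assms in auto)
  have W: "W > 0" unfolding W_def by (intro prod_pos) (use assms in \<open>auto simp: mean_value_def\<close>)
  \<comment> \<open>The triple of the other sizes is written in the generators of the cone; the
    objective becomes a combination, with nonnegative coefficients, of three functionals of \<sigma>
    i alone.\<close>
  have expand: "best_ratio J \<sigma>' = Pr * (2 * peak (\<sigma>' i) - 2 * mean_value (\<sigma>' i) + trough (\<sigma>' i))
     + (W - Pr) * (2 * (2 * peak (\<sigma>' i) - mean_value (\<sigma>' i))) + (Fr + Pr - 2 * W) * (2 * peak (\<sigma>' i))"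
    if "\<And>j. j \<noteq> i \<Longrightarrow> \<sigma>' j = \<sigma> j" for \<sigma>'
  proof -
    have "(\<Prod>j\<in>J. g (\<sigma>' j)) = g (\<sigma>' i) * (\<Prod>j\<in>J-{i}. g (\<sigma> j))" for g :: "real \<Rightarrow> real"
      using assms(1,3) that by (simp add: prod.remove[of J i])
    then show ?thesis unfolding best_ratio_def W_def[symmetric] Fr_def[symmetric] Pr_def[symmetric]
      by (simp add: W_def[symmetric] Fr_def[symmetric] Pr_def[symmetric] algebra_simps)
  qed
  note ob = outside_box[OF assms(2)[OF assms(3)] assms(4)]
  have "Pr \<ge> 0" "W - Pr \<ge> 0" "Fr + Pr - 2 * W \<ge> 0" using K by (auto simp: functional_cone_def)
  moreover have "peak (\<sigma> i) \<ge> peak 1" using peak_ge_1 assms by simp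
  ultimately have "(Fr + Pr - 2 * W) * (2 * peak 1) \<le> (Fr + Pr - 2 * W) * (2 * peak (\<sigma> i))"
    by (intro mult_left_mono) auto
  moreover have "Pr * (2 * peak 1 - 2 * mean_value 1 + trough 1)
     + (W - Pr) * (2 * (2 * peak 1 - mean_value 1))
    < Pr * (2 * peak (\<sigma> i) - 2 * mean_value (\<sigma> i) + trough (\<sigma> i))
     + (W - Pr) * (2 * (2 * peak (\<sigma> i) - mean_value (\<sigma> i)))"
  \<comment> \<open>Strictness has to come from a generator with positive coefficient: Pr if it is
    positive, otherwise W - Pr = W.\<close>
  proof (cases "Pr > 0")
    case True
    have "Pr * (2 * peak 1 - 2 * mean_value 1 + trough 1)
       < Pr * (2 * peak (\<sigma> i) - 2 * mean_value (\<sigma> i) + trough (\<sigma> i))"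
      using True ob(2) by (rule mult_strict_left_mono[rotated])
    moreover have "(W - Pr) * (2 * (2 * peak 1 - mean_value 1))
       \<le> (W - Pr) * (2 * (2 * peak (\<sigma> i) - mean_value (\<sigma> i)))"
      using \<open>W - Pr \<ge> 0\<close> ob(1) by (intro mult_left_mono) linarith+
    ultimately show ?thesis by linarith
  next
    case False
    then have "Pr = 0" using \<open>Pr \<ge> 0\<close> by simp
    then show ?thesis using ob W by simp
  qed
  ultimately show ?thesis using expand[of \<sigma>] expand[of "\<sigma>(i := 1)"] by simp
qed

text \<open>Sizes outside the box are replaced by 1 one at a time. The strict clause later shows
  that a minimizer lies in the box already.\<close>

lemma best_ratio_box:
  assumes "finite J" "\<And>j. j \<in> J \<Longrightarrow> \<sigma> j > 0"
  shows "\<exists>\<sigma>'. (\<forall>j\<in>J. 1 \<le> \<sigma>' j \<and> \<sigma>' j \<le> 4 / 3) \<and> best_ratio J \<sigma>' \<le> best_ratio J \<sigma> \<and>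
    ((\<exists>j\<in>J. \<sigma> j < 1 \<or> \<sigma> j > 4 / 3) \<longrightarrow> best_ratio J \<sigma>' < best_ratio J \<sigma>) \<and>
    ((\<forall>j\<in>J. 1 \<le> \<sigma> j \<and> \<sigma> j \<le> 4 / 3) \<longrightarrow> \<sigma>' = \<sigma>)"
  using assms(2)
proof (induction "card {j \<in> J. \<sigma> j < 1 \<or> \<sigma> j > 4 / 3}" arbitrary: \<sigma> rule: less_induct)
  case less
  show ?case
  proof (cases "\<exists>i\<in>J. \<sigma> i < 1 \<or> \<sigma> i > 4 / 3")
    case True
    then obtain i where i: "i \<in> J" "\<sigma> i < 1 \<or> \<sigma> i > 4 / 3" by blast
    let ?\<sigma> = "\<sigma>(i := 1)"
    have "{j \<in> J. ?\<sigma> j < 1 \<or> ?\<sigma> j > 4 / 3} \<subset> {j \<in> J. \<sigma> j < 1 \<or> \<sigma> j > 4 / 3}"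
      using i by (auto split: if_splits)
    then have "card {j \<in> J. ?\<sigma> j < 1 \<or> ?\<sigma> j > 4 / 3} < card {j \<in> J. \<sigma> j < 1 \<or> \<sigma> j > 4 / 3}"
      using assms(1) by (intro psubset_card_mono) auto
    moreover have "?\<sigma> j > 0" if "j \<in> J" for j using less(2)[OF that] by simp
    ultimately obtain \<sigma>' where "\<forall>j\<in>J. 1 \<le> \<sigma>' j \<and> \<sigma>' j \<le> 4 / 3" "best_ratio J \<sigma>' \<le> best_ratio J ?\<sigma>"
      using less(1)[of ?\<sigma>] by blast
    moreover have "best_ratio J ?\<sigma> < best_ratio J \<sigma>"
      using best_ratio_upd_1[of J \<sigma> i] assms(1) less(2) i by blast
    ultimately have "best_ratio J \<sigma>' < best_ratio J \<sigma>" "\<forall>j\<in>J. 1 \<le> \<sigma>' j \<and> \<sigma>' j \<le> 4 / 3" by auto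
    moreover have "\<not> (\<forall>j\<in>J. 1 \<le> \<sigma> j \<and> \<sigma> j \<le> 4 / 3)" using i by force
    ultimately show ?thesis by (intro exI[of _ \<sigma>'] conjI impI) (auto simp: less_imp_le)
  next
    case False
    then show ?thesis by (intro exI[of _ \<sigma>]) (simp add: not_less)
  qed
qed

lemma peak_box: "1 \<le> s \<Longrightarrow> s \<le> 4 / 3 \<Longrightarrow> peak s = 3 - 4 * (1 / s) + 2 * (1 / s)\<^sup>2"
  using \<Omega>_0_eq[of "1 / s"] by (simp add: peak_def field_simps power2_eq_square)

lemma trough_box: "1 \<le> s \<Longrightarrow> s \<le> 4 / 3 \<Longrightarrow> trough s = (2 - 1 / s)\<^sup>2 / 2"
  using \<Omega>_half_eq[of "1 / s"] by (simp add: trough_def field_simps power2_eq_square)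

lemma trough_box_bounds:
  assumes "1 \<le> s" "s \<le> 4 / 3" shows "0 < trough s" "trough s \<le> 1"
proof -
  have x: "3 / 4 \<le> 1 / s" "1 / s \<le> 1" using assms by (simp_all add: field_simps)
  have "(2 - 1 / s)\<^sup>2 \<le> (5 / 4)\<^sup>2" "(2 - 1 / s)\<^sup>2 > 0" using x by (intro power_mono zero_less_power; linarith)+
  then show "0 < trough s" "trough s \<le> 1" using trough_box[OF assms] by (auto simp: power2_eq_square)
qed

text \<open>In X = 1 / \<sigma> and with q = X Y fixed, both products depend on S = X + Y alone: the
  peaks through a quadratic, the troughs through (4 - 2 S + q)^2 / 4. The first rises with slope
  above 3, while the second falls with slope at most 25/16. B and C stand for the products over the
  other sizes.\<close>

lemma smoothing_inequality:
  fixes X Y X' Y' B C :: real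
  assumes "3 / 4 \<le> X'" "X' \<le> 1" "3 / 4 \<le> Y'" "Y' \<le> 1"
    and "X * Y = X' * Y'" "X' + Y' < X + Y" "1 \<le> B" "0 \<le> C" "C \<le> 1"
  shows "2 * B * ((3 - 4 * X' + 2 * X'\<^sup>2) * (3 - 4 * Y' + 2 * Y'\<^sup>2)) + C * ((2 - X')\<^sup>2 / 2 * ((2 - Y')\<^sup>2 / 2))
       < 2 * B * ((3 - 4 * X + 2 * X\<^sup>2) * (3 - 4 * Y + 2 * Y\<^sup>2)) + C * ((2 - X)\<^sup>2 / 2 * ((2 - Y)\<^sup>2 / 2))"
proof -
  define q where "q = X' * Y'"
  define S S' where "S = X + Y" and "S' = X' + Y'"
  have F: "(3 - 4 * a + 2 * a\<^sup>2) * (3 - 4 * b + 2 * b\<^sup>2) =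
     6 * (a + b)\<^sup>2 - (12 + 8 * (a * b)) * (a + b) + 9 + 4 * (a * b) + 4 * (a * b)\<^sup>2" for a b :: real
    by (simp add: power2_eq_square algebra_simps)
  have P: "(2 - a)\<^sup>2 / 2 * ((2 - b)\<^sup>2 / 2) = (4 - 2 * (a + b) + a * b)\<^sup>2 / 4" for a b :: real
    by (simp add: power2_eq_square algebra_simps)
  \<comment> \<open>The identity below gives 8 q \<le> 7 S' - 6, so the left side is at least 5 S' -
    6, and S' \<ge> 3/2.\<close>
  have bq: "12 * S' - 12 - 8 * q \<ge> 3 / 2"
  proof -
    have "(1 - X') * (Y' - 3 / 4) \<ge> 0" "(X' - 3 / 4) * (1 - Y') \<ge> 0"
      using assms by (auto intro!: mult_nonneg_nonneg)
    moreover have "(1 - X') * (Y' - 3 / 4) + (X' - 3 / 4) * (1 - Y') = 7 / 4 * S' - 3 / 2 - 2 * q"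
      unfolding S'_def q_def by (simp add: field_simps)
    ultimately show ?thesis using assms S'_def by linarith
  qed
  have cq: "4 - 2 * S' + q \<le> 25 / 16"
  proof -
    have "(2 - X') * (2 - Y') \<le> 5 / 4 * (5 / 4)" using assms by (intro mult_mono) auto
    then show ?thesis unfolding S'_def q_def by (simp add: algebra_simps)
  qed
  have SS: "S > S'" using assms by (simp add: S_def S'_def)
  define E where "E = 6 * (S + S') - 12 - 8 * q"
  have E: "E > 3 / 2" using bq SS by (simp add: E_def)
  then have "3 / 2 < 1 * E" by simp
  also have "\<dots> \<le> B * E"
    using assms(7) E by (intro mult_right_mono) auto
  finally have "3 / 2 < B * E" .
  then have "2 * (3 / 2) < 2 * (B * E)" by (rule mult_strict_left_mono) simp
  then have "2 * B * E > 2 * (3 / 2)" by (simp only: mult.assoc)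
  then have "2 * B * (6 * (S + S') - 12 - 8 * q) > 2 * (3 / 2)" by (simp only: E_def)
  moreover have "C * (4 - S - S' + q) \<le> 1 * (25 / 16)"
  proof -
    have "C * (4 - S - S' + q) \<le> C * (25 / 16)"
      using assms(8) SS cq by (intro mult_left_mono) auto
    also have "\<dots> \<le> 1 * (25 / 16)" using assms(9) by (intro mult_right_mono) auto
    finally show ?thesis .
  qed
  ultimately have "(S - S') * (2 * B * (6 * (S + S') - 12 - 8 * q) - C * (4 - S - S' + q)) > 0"
    using SS by (intro mult_pos_pos) auto
  moreover have "(S - S') * (2 * B * (6 * (S + S') - 12 - 8 * q) - C * (4 - S - S' + q)) =
     (2 * B * (6 * S\<^sup>2 - (12 + 8 * q) * S + 9 + 4 * q + 4 * q\<^sup>2) + C * ((4 - 2 * S + q)\<^sup>2 / 4)) -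
     (2 * B * (6 * S'\<^sup>2 - (12 + 8 * q) * S' + 9 + 4 * q + 4 * q\<^sup>2) + C * ((4 - 2 * S' + q)\<^sup>2 / 4))"
    by (simp add: power2_eq_square field_simps)
  ultimately show ?thesis
    unfolding F P assms(5) S_def[symmetric] S'_def[symmetric] q_def[symmetric] by linarith
qed

text \<open>One size lands exactly on g, which makes the induction in
  \<open>best_ratio_equalize\<close> end, and the other stays between the old two. Since the product
  is kept, the means do not change, and (g - \<sigma> i) (\<sigma> k - g) > 0 makes the sum of the
  reciprocals drop.\<close>

lemma best_ratio_smoothing:
  assumes "finite J" "\<And>j. j \<in> J \<Longrightarrow> 1 \<le> \<sigma> j \<and> \<sigma> j \<le> 4 / 3" "i \<in> J" "k \<in> J" "\<sigma> i < g" "g < \<sigma> k"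
  shows "best_ratio J (\<sigma>(i := g, k := \<sigma> i * \<sigma> k / g)) < best_ratio J \<sigma>"
    and "\<sigma> i \<le> \<sigma> i * \<sigma> k / g" "\<sigma> i * \<sigma> k / g \<le> \<sigma> k"
proof -
  define h where "h = \<sigma> i * \<sigma> k / g"
  have si: "1 \<le> \<sigma> i" "\<sigma> i \<le> 4 / 3" "1 \<le> \<sigma> k" "\<sigma> k \<le> 4 / 3" using assms(2-4) by auto
  have g: "g > 0" "1 \<le> g" "g \<le> 4 / 3" using si assms(5,6) by auto
  have "\<sigma> i * g \<le> \<sigma> i * \<sigma> k" "\<sigma> i * \<sigma> k \<le> g * \<sigma> k"
    using si assms(5,6) by (auto intro!: mult_left_mono mult_right_mono)
  then have h: "\<sigma> i \<le> h" "h \<le> \<sigma> k" using g by (simp_all add: h_def field_simps)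
  then show "\<sigma> i \<le> \<sigma> i * \<sigma> k / g" "\<sigma> i * \<sigma> k / g \<le> \<sigma> k" by (simp_all add: h_def)
  have hb: "1 \<le> h" "h \<le> 4 / 3" using h si by auto
  have ik: "i \<noteq> k" using assms by auto
  define R where "R = J - {i} - {k}"
  have split: "(\<Prod>j\<in>J. f (\<sigma>' j)) = f (\<sigma>' i) * f (\<sigma>' k) * (\<Prod>j\<in>R. f (\<sigma> j))"
    if "\<And>j. j \<noteq> i \<Longrightarrow> j \<noteq> k \<Longrightarrow> \<sigma>' j = \<sigma> j" for f :: "real \<Rightarrow> real" and \<sigma>'
  proof -
    have "(\<Prod>j\<in>J. f (\<sigma>' j)) = f (\<sigma>' i) * (f (\<sigma>' k) * (\<Prod>j\<in>R. f (\<sigma>' j)))"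
      unfolding R_def using assms(1,3,4) ik by (simp add: prod.remove[of J i] prod.remove[of "J - {i}" k])
    also have "(\<Prod>j\<in>R. f (\<sigma>' j)) = (\<Prod>j\<in>R. f (\<sigma> j))"
      using that by (intro prod.cong) (auto simp: R_def)
    finally show ?thesis by simp
  qed
  define B C where "B = (\<Prod>j\<in>R. peak (\<sigma> j))" and "C = (\<Prod>j\<in>R. trough (\<sigma> j))"
  have R: "1 \<le> \<sigma> j" "\<sigma> j \<le> 4 / 3" if "j \<in> R" for j using assms(2)[of j] that by (auto simp: R_def)
  have B: "1 \<le> B" unfolding B_def
    by (rule prod_ge_1) (use R peak_ge_1 in force)
  have C: "0 \<le> C" "C \<le> 1" unfolding C_def
    using R trough_box_bounds by (auto intro!: prod_nonneg prod_le_1 simp: less_imp_le)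
  have gh: "g * h = \<sigma> i * \<sigma> k" using g by (simp add: h_def)
  let ?W = "\<Prod>j\<in>R. mean_value (\<sigma> j)"
  have "mean_value g * mean_value h = mean_value (\<sigma> i) * mean_value (\<sigma> k)"
    using gh by (simp add: mean_value_def)
  moreover have "2 * B * (peak g * peak h) + C * (trough g * trough h)
    < 2 * B * (peak (\<sigma> i) * peak (\<sigma> k)) + C * (trough (\<sigma> i) * trough (\<sigma> k))"
    unfolding peak_box[OF g(2,3)] peak_box[OF hb] peak_box[OF si(1,2)] peak_box[OF si(3,4)]
      trough_box[OF g(2,3)] trough_box[OF hb] trough_box[OF si(1,2)] trough_box[OF si(3,4)]
  proof (rule smoothing_inequality)
    show "1 / \<sigma> i * (1 / \<sigma> k) = 1 / g * (1 / h)" using gh by simp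
    have "(g - \<sigma> i) * (\<sigma> k - g) > 0" using assms(5,6) by simp
    then have "(g + h) * g < (\<sigma> i + \<sigma> k) * g"
      using gh by (simp add: algebra_simps)
    then have "g + h < \<sigma> i + \<sigma> k" using g by simp
    then have "(g + h) / (g * h) < (\<sigma> i + \<sigma> k) / (\<sigma> i * \<sigma> k)"
      unfolding gh using si by (intro divide_strict_right_mono) auto
    then show "1 / g + 1 / h < 1 / \<sigma> i + 1 / \<sigma> k" using g si hb by (simp add: field_simps)
  qed (use g hb B C in \<open>auto simp: field_simps\<close>)
  ultimately show "best_ratio J (\<sigma>(i := g, k := \<sigma> i * \<sigma> k / g)) < best_ratio J \<sigma>"
    unfolding best_ratio_def h_def[symmetric]
    using split[of "\<sigma>(i := g, k := h)" peak] split[of "\<sigma>(i := g, k := h)" trough]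
      split[of "\<sigma>(i := g, k := h)" mean_value] split[of \<sigma> peak] split[of \<sigma> trough] split[of \<sigma> mean_value] ik
    by (simp add: B_def[symmetric] C_def[symmetric] algebra_simps)
qed

lemma prod_eq_power_imp_above:
  fixes \<sigma> :: "'j \<Rightarrow> real"
  assumes "finite J" "\<And>j. j \<in> J \<Longrightarrow> \<sigma> j > 0" "g > 0" "(\<Prod>j\<in>J. \<sigma> j) = g ^ card J" "i \<in> J" "\<sigma> i < g"
  shows "\<exists>k\<in>J. g < \<sigma> k"
proof (rule ccontr)
  assume "\<not> ?thesis"
  then have le: "\<And>j. j \<in> J \<Longrightarrow> \<sigma> j \<le> g" by force
  have "(\<Prod>j\<in>J. \<sigma> j) = \<sigma> i * (\<Prod>j\<in>J-{i}. \<sigma> j)" using assms by (simp add: prod.remove)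
  also have "\<dots> < g * g ^ (card J - 1)"
  proof (rule mult_less_le_imp_less)
    show "(\<Prod>j\<in>J-{i}. \<sigma> j) \<le> g ^ (card J - 1)"
      using prod_mono[of "J - {i}" \<sigma> "\<lambda>_. g"] le assms by (simp add: less_imp_le)
    show "0 < (\<Prod>j\<in>J-{i}. \<sigma> j)" using assms by (intro prod_pos) auto
  qed (use assms(2)[OF assms(5)] assms(6) in auto)
  also have "\<dots> = g ^ card J"
    using assms(1,5) by (metis card_gt_0_iff empty_iff power_eq_if not_gr_zero)
  finally show False using assms by simp
qed

lemma prod_eq_power_imp_below:
  fixes \<sigma> :: "'j \<Rightarrow> real"
  assumes "finite J" "\<And>j. j \<in> J \<Longrightarrow> \<sigma> j > 0" "g > 0" "(\<Prod>j\<in>J. \<sigma> j) = g ^ card J" "i \<in> J" "g < \<sigma> i"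
  shows "\<exists>k\<in>J. \<sigma> k < g"
proof -
  have "\<exists>k\<in>J. inverse g < inverse (\<sigma> k)"
  proof (rule prod_eq_power_imp_above[of J "\<lambda>j. inverse (\<sigma> j)" "inverse g" i])
    show "(\<Prod>j\<in>J. inverse (\<sigma> j)) = inverse g ^ card J"
      using assms(4) by (simp add: prod_inversef[unfolded o_def] power_inverse)
  qed (use assms in auto)
  then show ?thesis using assms(2,3) by (metis inverse_less_iff_less)
qed

text \<open>As g is the geometric mean, a size different from g has a partner on the other side of
  g. Smoothing such a pair sets one more size to g, so the number of the others decreases.\<close>

lemma best_ratio_equalize:
  assumes "finite J" "\<And>j. j \<in> J \<Longrightarrow> 1 \<le> \<sigma> j \<and> \<sigma> j \<le> 4 / 3" "g > 0" "(\<Prod>j\<in>J. \<sigma> j) = g ^ card J"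
  shows "best_ratio J (\<lambda>_. g) \<le> best_ratio J \<sigma> \<and>
     ((\<exists>j\<in>J. \<sigma> j \<noteq> g) \<longrightarrow> best_ratio J (\<lambda>_. g) < best_ratio J \<sigma>)"
  using assms(2,4)
proof (induction "card {j \<in> J. \<sigma> j \<noteq> g}" arbitrary: \<sigma> rule: less_induct)
  case less
  show ?case
  proof (cases "\<exists>j\<in>J. \<sigma> j \<noteq> g")
    case False
    then have "best_ratio J (\<lambda>_. g) = best_ratio J \<sigma>" by (simp add: best_ratio_def)
    then show ?thesis using False by simp
  next
    case True
    have pos: "\<sigma> j > 0" if "j \<in> J" for j using less(2)[OF that] by simp
    from True obtain j where j: "j \<in> J" "\<sigma> j \<noteq> g" by blast
    have "\<exists>i\<in>J. \<exists>k\<in>J. \<sigma> i < g \<and> g < \<sigma> k"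
    proof (cases "\<sigma> j < g")
      case True
      then show ?thesis using prod_eq_power_imp_above[OF assms(1) pos assms(3) less(3) j(1)] j(1) by blast
    next
      case False
      then have "g < \<sigma> j" using j(2) by simp
      then show ?thesis using prod_eq_power_imp_below[OF assms(1) pos assms(3) less(3) j(1)] j(1) by blast
    qed
    then obtain i k where ik: "i \<in> J" "\<sigma> i < g" "k \<in> J" "g < \<sigma> k" by blast
    define \<sigma>' where "\<sigma>' = \<sigma>(i := g, k := \<sigma> i * \<sigma> k / g)"
    have ne: "i \<noteq> k" using ik by auto
    have \<sigma>': "\<sigma>' i = g" "\<sigma>' k = \<sigma> i * \<sigma> k / g" "\<And>j. j \<noteq> i \<Longrightarrow> j \<noteq> k \<Longrightarrow> \<sigma>' j = \<sigma> j"
      using ne by (simp_all add: \<sigma>'_def)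
    note sm = best_ratio_smoothing[OF assms(1) less(2) ik(1,3,2,4), folded \<sigma>'_def]
    have "{j \<in> J. \<sigma>' j \<noteq> g} \<subset> {j \<in> J. \<sigma> j \<noteq> g}"
    proof
      show "{j \<in> J. \<sigma>' j \<noteq> g} \<subseteq> {j \<in> J. \<sigma> j \<noteq> g}"
      proof
        fix j assume j: "j \<in> {j \<in> J. \<sigma>' j \<noteq> g}"
        then have "j \<noteq> i" using \<sigma>'(1) by auto
        then show "j \<in> {j \<in> J. \<sigma> j \<noteq> g}" using j \<sigma>'(3) ik(4) by (cases "j = k") auto
      qed
      have "i \<in> {j \<in> J. \<sigma> j \<noteq> g}" "i \<notin> {j \<in> J. \<sigma>' j \<noteq> g}" using ik(1,2) \<sigma>'(1) by auto
      then show "{j \<in> J. \<sigma>' j \<noteq> g} \<noteq> {j \<in> J. \<sigma> j \<noteq> g}" by blast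
    qed
    then have c: "card {j \<in> J. \<sigma>' j \<noteq> g} < card {j \<in> J. \<sigma> j \<noteq> g}"
      using assms(1) by (intro psubset_card_mono) auto
    have pr: "(\<Prod>j\<in>J. \<sigma>' j) = g ^ card J"
    proof -
      have *: "(\<Prod>j\<in>J. f j) = f i * (f k * (\<Prod>j\<in>J-{i}-{k}. f j))" for f :: "_ \<Rightarrow> real"
        using assms(1) ik ne by (simp add: prod.remove[of J i] prod.remove[of "J - {i}" k])
      have "(\<Prod>j\<in>J-{i}-{k}. \<sigma>' j) = (\<Prod>j\<in>J-{i}-{k}. \<sigma> j)" using \<sigma>'(3) by (intro prod.cong) auto
      then have "(\<Prod>j\<in>J. \<sigma>' j) = (\<Prod>j\<in>J. \<sigma> j)"
        unfolding *[of \<sigma>'] *[of \<sigma>] \<sigma>'(1,2) using assms(3) by simp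
      then show ?thesis using less(3) by simp
    qed
    have box: "1 \<le> \<sigma>' j \<and> \<sigma>' j \<le> 4 / 3" if "j \<in> J" for j
    proof -
      consider "j = i" | "j = k" | "j \<noteq> i" "j \<noteq> k" by blast
      then show ?thesis
      proof cases
        case 1
        show ?thesis unfolding 1 \<sigma>'(1) using less(2)[OF ik(1)] less(2)[OF ik(3)] ik(2,4) by linarith
      next
        case 2
        show ?thesis unfolding 2 using sm(2,3) less(2)[OF ik(1)] less(2)[OF ik(3)] \<sigma>'(2)
          by linarith
      next
        case 3
        then show ?thesis using \<sigma>'(3) less(2)[OF that] by simp
      qed
    qed
    have "best_ratio J (\<lambda>_. g) \<le> best_ratio J \<sigma>'"
      using less(1)[OF c box pr] by (rule conjunct1)
    then have "best_ratio J (\<lambda>_. g) < best_ratio J \<sigma>" using sm(1) by (rule le_less_trans)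
    then show ?thesis by simp
  qed
qed

lemma best_ratio_const_le:
  assumes "finite J" "J \<noteq> {}" "\<And>j. j \<in> J \<Longrightarrow> 1 \<le> \<sigma> j \<and> \<sigma> j \<le> 4 / 3"
  obtains g where "1 \<le> g" "g \<le> 4 / 3" "best_ratio J (\<lambda>_. g) \<le> best_ratio J \<sigma>"
    "best_ratio J (\<lambda>_. g) = best_ratio J \<sigma> \<longrightarrow> (\<forall>j\<in>J. \<sigma> j = g)"
proof -
  define n where "n = card J"
  have n: "n > 0" using assms by (simp add: n_def card_gt_0_iff)
  define g where "g = root n (\<Prod>j\<in>J. \<sigma> j)"
  have pos: "\<sigma> j > 0" if "j \<in> J" for j using assms(3)[OF that] by simp
  have p: "(\<Prod>j\<in>J. \<sigma> j) > 0" using pos by (simp add: prod_pos)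
  have g: "g > 0" "g ^ n = (\<Prod>j\<in>J. \<sigma> j)" using p n by (auto simp: g_def)
  have "1 ^ n \<le> g ^ n" unfolding g using assms by (simp add: prod_ge_1)
  then have g1: "1 \<le> g" using g n by (meson less_imp_le power_le_imp_le_base power_mono_iff zero_le_one)
  have "g ^ n \<le> (4 / 3) ^ n" unfolding g using prod_mono[of J \<sigma> "\<lambda>_. 4 / 3"] assms pos
    by (simp add: n_def less_imp_le)
  then have g2: "g \<le> 4 / 3" using power_mono_iff[of g "4 / 3" n] g n by auto
  show ?thesis
    by (rule that[OF g1 g2]) (use best_ratio_equalize[OF assms(1,3) g(1)] g n_def in force)+
qed

section \<open>Equal sizes\<close>

text \<open>In the variable \<open>X = 1 / \<sigma>\<close> the diagonal restriction of the limit has derivative a positive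
  multiple of \<open>slope_poly\<close>, which in turn is \<open>size_poly\<close> up to a power of \<open>X\<close>.\<close>

definition slope_poly :: "nat \<Rightarrow> real \<Rightarrow> real" where
  "slope_poly n X = inverse (X ^ (n + 2)) - 4 * (3 / 2) ^ Suc n * ((1 - X) * (3 - 4 * X + 2 * X\<^sup>2) ^ n)
     - (3 / 4) ^ Suc n * (2 - X) ^ (2 * n + 1)"

text \<open>The factor x^(2n+1) clears all denominators: one x goes to the linear factor 1 - X, and
  x^2 to each of the n quadratic factors.\<close>

lemma size_poly_eq:
  assumes "x > 0"
  shows "size_poly (Suc n) x = slope_poly n (1 / x) * x ^ (2 * n + 1)"
proof -
  have scale: "(i - b * (u * f ^ n) - c * w ^ (2 * n + 1)) * x ^ (2 * n + 1) =
      i * x ^ (2 * n + 1) - b * ((u * x) * (f * x\<^sup>2) ^ n) - c * (w * x) ^ (2 * n + 1)"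
    for i b u f c w :: real
    by (simp add: left_diff_distrib power_mult_distrib power_mult[symmetric])
  have "slope_poly n (1 / x) * x ^ (2 * n + 1) =
     x ^ (n + 2) * x ^ (2 * n + 1)
     - 4 * (3 / 2) ^ Suc n * (((1 - 1 / x) * x) * ((3 - 4 * (1 / x) + 2 * (1 / x)\<^sup>2) * x\<^sup>2) ^ n)
     - (3 / 4) ^ Suc n * ((2 - 1 / x) * x) ^ (2 * n + 1)"
    unfolding slope_poly_def scale by (simp add: power_one_over)
  also have "x ^ (n + 2) * x ^ (2 * n + 1) = x ^ (3 * Suc n)"
  proof -
    have "(n + 2) + (2 * n + 1) = 3 * Suc n" by simp
    then show ?thesis by (simp only: power_add[symmetric])
  qed
  also have "(1 - 1 / x) * x = x - 1" using assms by (simp add: field_simps)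
  also have "(3 - 4 * (1 / x) + 2 * (1 / x)\<^sup>2) * x\<^sup>2 = 3 * x\<^sup>2 - 4 * x + 2"
    using assms by (simp add: field_simps power2_eq_square)
  also have "(2 - 1 / x) * x = 2 * x - 1" using assms by (simp add: field_simps)
  also have "4 * (3 / 2 :: real) ^ Suc n = 3 ^ Suc n / 2 powi (int (Suc n) - 2)"
  proof -
    have "(2::real) powi (int (Suc n) - 2) = 2 powi (int n - 1)" by simp
    also have "\<dots> = 2 ^ n / 2" by (simp add: power_int_diff)
    finally show ?thesis by (simp only:) (simp add: power_divide)
  qed
  also have "(3 / 4 :: real) ^ Suc n = 3 ^ Suc n / 2 ^ (2 * Suc n)"
    by (simp add: power_divide power_mult)
  finally show ?thesis by (simp add: size_poly_def)
qed

text \<open>64/81 = (2/3) (32/27), where 27/32 is the least value of X F in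
  \<open>slope_key_inequality\<close>. At n = 2 the left side is about 1.97, so there is little
  room; from n = 3 on it decreases, and the smaller cases are checked one by one.\<close>

lemma binomial_weight_bound: "(real n + 2) * (64 / 81) ^ Suc n < (2::real)"
proof -
  have "(real n + 5) * (64 / 81) ^ (n + 4) < (2::real)" for n
  proof (induction n)
    case (Suc n)
    have "(real (Suc n) + 5) * (64 / 81) \<le> real n + 5" by simp
    then have "(real (Suc n) + 5) * (64 / 81) * (64 / 81) ^ (n + 4) \<le> (real n + 5) * (64 / 81) ^ (n + 4)"
      by (rule mult_right_mono) simp
    moreover have "(real (Suc n) + 5) * (64 / 81) ^ (Suc n + 4) = (real (Suc n) + 5) * (64 / 81) * (64 / 81) ^ (n + 4)"
      by (simp only: add_Suc power_Suc mult.assoc)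
    ultimately show ?case using Suc by (simp only: order.strict_trans1)
  qed (simp add: power_divide)
  note big = this
  show ?thesis
  proof (cases "n \<ge> 3")
    case True
    then obtain k where "n = k + 3" using le_Suc_ex by (metis add.commute)
    then have "real n + 2 = real k + 5" "Suc n = k + 4" by simp_all
    then show ?thesis using big[of k] by (simp only:)
  next
    case False
    then have "n = 0 \<or> n = 1 \<or> n = 2" by auto
    then show ?thesis by (auto simp: power_divide)
  qed
qed

text \<open>After multiplication by X^(n+3) it suffices that X F \<ge> 27/32, its value at X = 3/4,
  and that F \<le> 9/8 \<le> 2 X^2. The growth in n is left to
  \<open>binomial_weight_bound\<close>.\<close>

lemma slope_key_inequality:
  assumes "3 / 4 \<le> X" "X \<le> 1"
  shows "(real n + 2) * inverse (X ^ (n + 3)) < 4 * (3 / 2) ^ Suc n * (3 - 4 * X + 2 * X\<^sup>2) ^ n"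
proof -
  define F where "F = 3 - 4 * X + 2 * X\<^sup>2"
  have F: "F = 1 + 2 * (1 - X)\<^sup>2" by (simp add: F_def power2_eq_square algebra_simps)
  then have F1: "F \<ge> 1" by simp
  have "(1 - X)\<^sup>2 \<le> (1 / 4)\<^sup>2" using assms by (intro power_mono) auto
  then have F2: "F \<le> 9 / 8" using F by (simp add: power2_eq_square)
  have XF: "X * F \<ge> 27 / 32"
  proof -
    have "X * F - 27 / 32 = (X - 3 / 4) * (2 * (X - 5 / 8)\<^sup>2 + 11 / 32)"
      by (simp add: F_def power2_eq_square field_simps)
    also have "\<dots> \<ge> 0" using assms by (intro mult_nonneg_nonneg) auto
    finally show ?thesis by simp
  qed
  have "2 * F \<le> 4 * X\<^sup>2"
  proof -
    have "(3 / 4)\<^sup>2 \<le> X\<^sup>2" using assms by (intro power_mono) auto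
    then show ?thesis using F2 by (simp add: power2_eq_square)
  qed
  have "(27 / 32) ^ Suc n \<le> (X * F) ^ Suc n" using XF by (intro power_mono) auto
  then have "(2 / 3) ^ Suc n * (32 / 27) ^ Suc n * (27 / 32) ^ Suc n \<le> (2 / 3) ^ Suc n * (32 / 27) ^ Suc n * (X * F) ^ Suc n"
    by (rule mult_left_mono) simp
  then have *: "(2 / 3) ^ Suc n \<le> (64 / 81) ^ Suc n * (X * F) ^ Suc n"
    unfolding power_mult_distrib[symmetric] by simp
  have "(real n + 2) * (2 / 3) ^ Suc n \<le> (real n + 2) * ((64 / 81) ^ Suc n * (X * F) ^ Suc n)"
    using * by (intro mult_left_mono) auto
  also have "\<dots> = ((real n + 2) * (64 / 81) ^ Suc n) * (X * F) ^ Suc n" by simp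
  also have "\<dots> < 2 * (X * F) ^ Suc n"
    using binomial_weight_bound[of n] assms F1 by (intro mult_strict_right_mono) auto
  also have "\<dots> = (2 * F) * (X ^ Suc n * F ^ n)" by (simp add: power_mult_distrib)
  also have "\<dots> \<le> (4 * X\<^sup>2) * (X ^ Suc n * F ^ n)"
    using \<open>2 * F \<le> 4 * X\<^sup>2\<close> assms F1 by (intro mult_right_mono) auto
  also have "\<dots> = 4 * F ^ n * X ^ (n + 3)" by (simp add: power2_eq_square power_add numeral_3_eq_3)
  finally have less: "(real n + 2) * (2 / 3) ^ Suc n < 4 * F ^ n * X ^ (n + 3)" .
  have inv: "(2 / 3 :: real) ^ Suc n * (3 / 2) ^ Suc n = 1"
    unfolding power_mult_distrib[symmetric] by simp
  have "real n + 2 = (real n + 2) * (2 / 3) ^ Suc n * (3 / 2) ^ Suc n"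
    by (simp only: mult.assoc inv mult_1_right)
  also have "\<dots> < 4 * F ^ n * X ^ (n + 3) * (3 / 2) ^ Suc n"
    using less by (rule mult_strict_right_mono) simp
  also have "\<dots> = 4 * (3 / 2) ^ Suc n * F ^ n * X ^ (n + 3)" by (simp only: mult_ac)
  finally have "(real n + 2) / X ^ (n + 3) < 4 * (3 / 2) ^ Suc n * F ^ n"
    using assms by (subst pos_divide_less_eq) auto
  then show ?thesis unfolding F_def by (simp only: divide_inverse)
qed

text \<open>In the derivative only the inverse power of X is negative, and the term with F^n alone
  outweighs it by \<open>slope_key_inequality\<close>.\<close>

lemma slope_poly_strict_mono:
  assumes "3 / 4 \<le> X" "X < Y" "Y \<le> 1"
  shows "slope_poly n X < slope_poly n Y"
proof (rule DERIV_pos_imp_increasing[OF assms(2)])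
  fix x assume x: "X \<le> x" "x \<le> Y"
  let ?F = "3 - 4 * x + 2 * x\<^sup>2"
  let ?D = "- (real n + 2) * inverse (x ^ (n + 3))
     - 4 * (3 / 2) ^ Suc n * (- (?F ^ n) + (1 - x) * (real n * ?F ^ (n - 1) * (4 * x - 4)))
     + (3 / 4) ^ Suc n * ((2 * real n + 1) * (2 - x) ^ (2 * n))"
  have x0: "x > 0" using x assms by simp
  have d1: "((\<lambda>x. inverse (x ^ (n + 2))) has_real_derivative - (real n + 2) * inverse (x ^ (n + 3))) (at x)"
  proof -
    have "((\<lambda>x. inverse (x ^ (n + 2))) has_real_derivative
        - (real (n + 2) * x ^ (n + 2 - Suc 0) * inverse ((x ^ (n + 2)) ^ Suc (Suc 0)))) (at x)"
      by (intro DERIV_inverse_fun DERIV_pow) (use x0 in simp)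
    moreover have "real (n + 2) * x ^ (n + 2 - Suc 0) * inverse ((x ^ (n + 2)) ^ Suc (Suc 0)) =
        (real n + 2) * inverse (x ^ (n + 3))"
    proof -
      define y where "y = x ^ (n + 1)"
      have y: "x ^ (n + 2) = y * x" "x ^ (n + 3) = y * x * x" "x ^ (n + 2 - Suc 0) = y" "y \<noteq> 0"
        using x0 by (simp_all add: y_def power_add power2_eq_square power3_eq_cube)
      then show ?thesis unfolding y using x0 by (simp add: field_simps)
    qed
    ultimately show ?thesis by (simp only: minus_mult_left)
  qed
  have "((slope_poly n) has_real_derivative ?D) (at x)"
    unfolding slope_poly_def[abs_def]
    by (rule derivative_eq_intros d1 refl | simp add: algebra_simps)+
  moreover have "?D > 0"
  proof -
    have F: "?F \<ge> 1"
      using zero_le_power2[of "1 - x"] by (simp add: power2_eq_square algebra_simps)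
    have "(1 - x) * (real n * ?F ^ (n - 1) * (4 * x - 4)) = - (4 * (1 - x)\<^sup>2 * (real n * ?F ^ (n - 1)))"
      by (simp add: power2_eq_square algebra_simps)
    also have "\<dots> \<le> 0" using F by simp
    finally have "4 * (3 / 2) ^ Suc n * (- (?F ^ n) + (1 - x) * (real n * ?F ^ (n - 1) * (4 * x - 4))) \<le>
       4 * (3 / 2) ^ Suc n * (- (?F ^ n))"
      by (intro mult_left_mono) auto
    moreover have "(3 / 4) ^ Suc n * ((2 * real n + 1) * (2 - x) ^ (2 * n)) \<ge> 0"
      using x assms by (intro mult_nonneg_nonneg) auto
    moreover have "(real n + 2) * inverse (x ^ (n + 3)) < 4 * (3 / 2) ^ Suc n * ?F ^ n"
      using slope_key_inequality[of x n] x assms by simp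
    ultimately show ?thesis
      unfolding mult_minus_right mult_minus_left by linarith
  qed
  ultimately show "\<exists>y. (slope_poly n has_real_derivative y) (at x) \<and> 0 < y" by blast
qed

lemma slope_poly_1: "slope_poly n 1 > 0"
  by (simp add: slope_poly_def power_Suc_less_one del: power_Suc)

section \<open>Location of the root of \<open>size_poly\<close>\<close>

definition delta :: "nat \<Rightarrow> real" where "delta e = 3 ^ (e + 1) / 2 ^ (2 * e + 3)"

lemma delta_eq: "delta e = 3 / 8 * (3 / 4) ^ e"
  by (simp add: delta_def power_add power_mult power_divide)

lemma delta_bounds: "e \<ge> 1 \<Longrightarrow> 0 < delta e \<and> delta e < 1 / 3"
proof -
  assume "e \<ge> 1"
  then have "(3 / 4 :: real) ^ e \<le> (3 / 4) ^ 1" by (intro power_decreasing) auto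
  then show ?thesis by (simp add: delta_eq)
qed

lemma size_poly_endpoint_small:
  assumes "1 \<le> e" "e \<le> 5" shows "size_poly e (1 + delta e) < 0"
proof -
  have "e = 1 \<or> e = 2 \<or> e = 3 \<or> e = 4 \<or> e = 5" using assms by auto
  then show ?thesis
    by (elim disjE) (simp_all add: size_poly_def delta_def power_divide power_int_def)
qed

text \<open>Used as (e + 2) t \<le> 9/16 for t = \<open>delta e\<close> and e = n + 6, the input to
  Bernoulli's inequality below. The left side decreases in n.\<close>

lemma delta_linear_bound: "(real n + 8) * (3 / 4) ^ (n + 6) \<le> (3 / 2 :: real)"
proof (induction n)
  case (Suc n)
  have "(real (Suc n) + 8) * (3 / 4) \<le> real n + 8" by simp
  then have "(real (Suc n) + 8) * (3 / 4) * (3 / 4) ^ (n + 6) \<le> (real n + 8) * (3 / 4) ^ (n + 6)"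
    by (rule mult_right_mono) simp
  moreover have "(real (Suc n) + 8) * (3 / 4) ^ (Suc n + 6) = (real (Suc n) + 8) * (3 / 4) * (3 / 4) ^ (n + 6)"
    by (simp only: add_Suc power_Suc mult.assoc)
  ultimately show ?case using Suc by (simp only: order.trans)
qed (simp add: power_divide)

text \<open>The middle term alone beats x^(3e): the quotient is at least 4 (3/2)^e t (1 - t)^(e+2) =
  (3/2) (9/8)^e (1 - t)^(e+2) \<ge> 3 (7/16) > 1. This uses (9/8)^e \<ge> 2, which begins to hold at
  e = 6.\<close>

lemma size_poly_endpoint_large:
  assumes "e \<ge> 6" shows "size_poly e (1 + delta e) < 0"
proof -
  obtain n where n: "e = n + 6" using assms le_Suc_ex by (metis add.commute)
  define t where "t = delta e"
  have t: "0 < t" "t < 1 / 3" using delta_bounds[of e] assms by (auto simp: t_def)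
  define x where "x = 1 + t"
  have x: "x > 1" using t by (simp add: x_def)
  have a1: "x ^ 3 * (1 - t) \<le> 3 * x\<^sup>2 - 4 * x + 2"
  proof -
    have "3 * x\<^sup>2 - 4 * x + 2 - x ^ 3 * (1 - t) = t\<^sup>2 * (3 + 2 * t + t\<^sup>2)"
      by (simp add: x_def power2_eq_square power3_eq_cube algebra_simps)
    moreover have "t\<^sup>2 * (3 + 2 * t + t\<^sup>2) \<ge> 0" using t by simp
    ultimately show ?thesis by linarith
  qed
  have a2: "x ^ 3 * (1 - t) ^ 3 \<le> 1"
  proof -
    have "x * (1 - t) = 1 - t\<^sup>2" by (simp add: x_def power2_eq_square algebra_simps)
    then have "x * (1 - t) \<le> 1" by simp
    then have "(x * (1 - t)) ^ 3 \<le> 1 ^ 3" using t x by (intro power_mono) auto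
    then show ?thesis by (simp add: power_mult_distrib)
  qed
  have b: "(1 - t) ^ (e + 2) \<ge> 7 / 16"
  proof -
    have "real (e + 2) * t = 3 / 8 * ((real n + 8) * (3 / 4) ^ (n + 6))"
      by (simp add: t_def delta_eq n)
    then have "real (e + 2) * t \<le> 9 / 16" using delta_linear_bound[of n] by simp
    moreover have "1 + real (e + 2) * (- t) \<le> (1 + (- t)) ^ (e + 2)"
      by (rule Bernoulli_inequality) (use t in auto)
    ultimately show ?thesis by simp
  qed
  have c: "(3 / 2) * (9 / 8) ^ e \<ge> (3 :: real)"
  proof -
    have "(9 / 8 :: real) ^ 6 \<le> (9 / 8) ^ e" using assms by (intro power_increasing) auto
    moreover have "(2 :: real) \<le> (9 / 8) ^ 6" by (simp add: power_divide)
    ultimately have "2 \<le> (9 / 8 :: real) ^ e" by (rule order.trans[rotated])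
    then show ?thesis by simp
  qed
  have d: "4 * (3 / 2) ^ e * t = (3 / 2) * (9 / 8) ^ e"
  proof -
    have "(3 / 2) ^ e * (3 / 4) ^ e = (9 / 8 :: real) ^ e" unfolding power_mult_distrib[symmetric] by simp
    then show ?thesis by (simp add: t_def delta_eq)
  qed
  have "4 * (3 / 2) ^ e * t * (1 - t) ^ (e + 2) \<ge> 3 * (7 / 16)"
    unfolding d using b c by (intro mult_mono) auto
  then have big: "1 < 4 * (3 / 2) ^ e * t * (1 - t) ^ (e + 2)" by simp
  have "x ^ (3 * e) = x ^ (3 * e) * 1" by simp
  also have "\<dots> < x ^ (3 * e) * (4 * (3 / 2) ^ e * t * (1 - t) ^ (e + 2))"
    using big x by (intro mult_strict_left_mono) auto
  also have "\<dots> = 4 * (3 / 2) ^ e * t * (x ^ 3 * (1 - t)) ^ (e - 1) * (x ^ 3 * (1 - t) ^ 3)"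
  proof -
    have e: "e = Suc (e - 1)" using assms by simp
    have "x ^ (3 * e) = (x ^ 3) ^ Suc (e - 1)" using e by (simp only: power_mult)
    then have "x ^ (3 * e) = (x ^ 3) ^ (e - 1) * x ^ 3" by (simp only: power_Suc2)
    moreover have "(1 - t) ^ (e + 2) = (1 - t) ^ (e - 1) * (1 - t) ^ 3"
      using assms by (simp add: power_add[symmetric])
    ultimately show ?thesis by (simp add: power_mult_distrib)
  qed
  also have "\<dots> \<le> 4 * (3 / 2) ^ e * t * (3 * x\<^sup>2 - 4 * x + 2) ^ (e - 1) * 1"
  proof (intro mult_mono power_mono a1 a2)
    have "0 \<le> x ^ 3 * (1 - t)" using t x by simp
    then have "0 \<le> 3 * x\<^sup>2 - 4 * x + 2" using a1 by linarith
    then show "0 \<le> 4 * (3 / 2) ^ e * t * (3 * x\<^sup>2 - 4 * x + 2) ^ (e - 1)" using t by simp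
  qed (use t x in auto)
  also have "4 * (3 / 2 :: real) ^ e = 3 ^ e / 2 powi (int e - 2)"
    by (simp add: power_int_diff power_divide)
  finally have "x ^ (3 * e) < 3 ^ e / 2 powi (int e - 2) * t * (3 * x\<^sup>2 - 4 * x + 2) ^ (e - 1)" by simp
  moreover have "3 ^ e / 2 ^ (2 * e) * (2 * x - 1) ^ (2 * e - 1) \<ge> 0" using x by simp
  ultimately have "size_poly e x < 0" by (simp add: size_poly_def x_def)
  then show ?thesis by (simp add: x_def t_def)
qed

lemma size_poly_endpoint: "e \<ge> 1 \<Longrightarrow> size_poly e (1 + delta e) < 0"
  using size_poly_endpoint_small[of e] size_poly_endpoint_large[of e] by (cases "e \<le> 5") auto

lemma delta_interval: "{1<..<1 + 3 ^ (e + 1) / 2 ^ (2 * e + 3)} = {1<..<1 + delta e}"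
  by (simp only: delta_def)

text \<open>Existence comes from the sign change over the interval in x, uniqueness from strict
  monotonicity in X = 1 / x on [3/4, 1]; the bound \<open>delta e < 1 / 3\<close> keeps 1 / x in
  that range.\<close>

lemma size_poly_sign:
  assumes "e \<ge> 1"
  obtains x0 where "1 < x0" "x0 < 1 + delta e" "size_poly e x0 = 0"
    "\<And>X. 3 / 4 \<le> X \<Longrightarrow> X < 1 / x0 \<Longrightarrow> slope_poly (e - 1) X < 0"
    "\<And>X. 1 / x0 < X \<Longrightarrow> X \<le> 1 \<Longrightarrow> slope_poly (e - 1) X > 0"
    "\<And>x. optimal_size e x \<longleftrightarrow> x = x0"
proof -
  define n where "n = e - 1"
  have e: "e = Suc n" using assms by (simp add: n_def)
  note delta = delta_bounds[OF assms]
  have cont: "continuous_on {1..1 + delta e} (size_poly e)"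
    unfolding size_poly_def[abs_def] by (intro continuous_intros)
  have s1: "size_poly e 1 > 0" using size_poly_eq[of 1 n] slope_poly_1[of n] by (simp add: e)
  have s2: "size_poly e (1 + delta e) < 0" using size_poly_endpoint[OF assms] .
  obtain x0 where x0: "1 \<le> x0" "x0 \<le> 1 + delta e" "size_poly e x0 = 0"
    using IVT2'[of "size_poly e" "1 + delta e" 0 1] s1 s2 delta cont by auto
  then have x0': "1 < x0" "x0 < 1 + delta e" using s1 s2 by (auto simp: less_le)
  have zero: "slope_poly n (1 / x) = 0 \<longleftrightarrow> size_poly e x = 0" if "x > 0" for x
    using size_poly_eq[OF that, of n] that by (simp add: e)
  have range: "3 / 4 \<le> 1 / x" "1 / x \<le> 1" if "1 < x" "x < 1 + delta e" for x
    using that delta by (simp_all add: field_simps)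
  have z: "slope_poly n (1 / x0) = 0" using zero[of x0] x0 by simp
  show ?thesis
  proof (rule that[OF x0' x0(3)])
    show "slope_poly (e - 1) X < 0" if "3 / 4 \<le> X" "X < 1 / x0" for X
      using slope_poly_strict_mono[OF that range(2)[OF x0'], of n] z unfolding n_def by linarith
    show "slope_poly (e - 1) X > 0" if "1 / x0 < X" "X \<le> 1" for X
      using slope_poly_strict_mono[OF range(1)[OF x0'] that, of n] z unfolding n_def by linarith
    show "optimal_size e x \<longleftrightarrow> x = x0" for x
    proof
      assume "optimal_size e x"
      then have x: "1 < x" "x < 1 + delta e" "size_poly e x = 0"
        unfolding optimal_size_def delta_interval by auto
      have "slope_poly n (1 / x) = slope_poly n (1 / x0)" using zero[of x] x z by simp
      then have "1 / x = 1 / x0"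
        using slope_poly_strict_mono[of "1 / x" "1 / x0" n] slope_poly_strict_mono[of "1 / x0" "1 / x" n]
          range[OF x(1,2)] range[OF x0'] by (metis less_irrefl linorder_neqE)
      then show "x = x0" by (simp add: divide_inverse)
    next
      assume "x = x0"
      then show "optimal_size e x" unfolding optimal_size_def delta_interval using x0' x0(3) by auto
    qed
  qed
qed

section \<open>The objective at equal sizes\<close>

definition diagonal :: "nat \<Rightarrow> real \<Rightarrow> real" where
  "diagonal e X = 2 * (3 - 4 * X + 2 * X\<^sup>2) ^ e - 2 * (2 / 3) ^ e * inverse (X ^ e) + ((2 - X)\<^sup>2 / 2) ^ e"

lemma best_ratio_diagonal:
  assumes "1 \<le> g" "g \<le> 4 / 3"
  shows "best_ratio J (\<lambda>_. g) = diagonal (card J) (1 / g)"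
proof -
  have "mean_value g = 2 / 3 * g" by (simp add: mean_value_def)
  then have "mean_value g ^ card J = (2 / 3) ^ card J * g ^ card J" by (simp only: power_mult_distrib)
  then show ?thesis
    unfolding best_ratio_def diagonal_def prod_constant peak_box[OF assms] trough_box[OF assms]
    by (simp add: power_one_over)
qed

lemma diagonal_deriv:
  assumes "X > 0"
  shows "(diagonal (Suc n) has_real_derivative
    2 * real (Suc n) * (2 / 3) ^ Suc n * slope_poly n X) (at X)"
proof -
  have d: "((\<lambda>X. inverse (X ^ Suc n)) has_real_derivative - (real (Suc n) * inverse (X ^ (n + 2)))) (at X)"
  proof -
    have "((\<lambda>X. inverse (X ^ Suc n)) has_real_derivative
        - (real (Suc n) * X ^ (Suc n - Suc 0) * inverse ((X ^ Suc n) ^ Suc (Suc 0)))) (at X)"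
      by (intro DERIV_inverse_fun DERIV_pow) (use assms in simp)
    moreover have "real (Suc n) * X ^ (Suc n - Suc 0) * inverse ((X ^ Suc n) ^ Suc (Suc 0)) =
        real (Suc n) * inverse (X ^ (n + 2))"
      using assms by (simp add: field_simps power2_eq_square)
    ultimately show ?thesis by (simp only:)
  qed
  let ?D = "2 * (real (Suc n) * ((4 * X - 4) * (3 - 4 * X + 2 * X\<^sup>2) ^ n))
      - 2 * (2 / 3) ^ Suc n * - (real (Suc n) * inverse (X ^ (n + 2)))
      + real (Suc n) * (((X - 2) * ((2 - X)\<^sup>2 / 2) ^ n))"
  have d1: "((\<lambda>X. (3 - 4 * X + 2 * X\<^sup>2) ^ Suc n) has_real_derivative
      real (Suc n) * ((4 * X - 4) * (3 - 4 * X + 2 * X\<^sup>2) ^ n)) (at X)"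
    by (rule DERIV_cong[OF DERIV_power]) (auto intro!: derivative_eq_intros simp: algebra_simps)
  have d2: "((\<lambda>X. ((2 - X)\<^sup>2 / 2) ^ Suc n) has_real_derivative
      real (Suc n) * ((X - 2) * ((2 - X)\<^sup>2 / 2) ^ n)) (at X)"
    by (rule DERIV_cong[OF DERIV_power[where D = "X - 2"]]) (auto intro!: derivative_eq_intros simp: field_simps)
  have "(diagonal (Suc n) has_real_derivative ?D) (at X)"
    unfolding diagonal_def[abs_def] by (intro DERIV_add DERIV_diff DERIV_cmult d d1 d2)
  moreover have "?D = 2 * real (Suc n) * (2 / 3) ^ Suc n * slope_poly n X"
  proof -
    have a: "(2 / 3 :: real) ^ Suc n * (3 / 2) ^ Suc n = 1"
      unfolding power_mult_distrib[symmetric] by simp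
    have b: "2 * ((2 / 3) ^ Suc n * (3 / 4) ^ Suc n) * (2 - X) ^ (2 * n + 1) = (2 - X) * ((2 - X)\<^sup>2 / 2) ^ n"
      unfolding power_mult_distrib[symmetric] by (simp add: power_divide power_mult[symmetric] field_simps)
    have "2 * real (Suc n) * (2 / 3) ^ Suc n * slope_poly n X =
      2 * real (Suc n) * (2 / 3) ^ Suc n * inverse (X ^ (n + 2))
      - 8 * real (Suc n) * ((2 / 3) ^ Suc n * (3 / 2) ^ Suc n) * ((1 - X) * (3 - 4 * X + 2 * X\<^sup>2) ^ n)
      - real (Suc n) * (2 * ((2 / 3) ^ Suc n * (3 / 4) ^ Suc n) * (2 - X) ^ (2 * n + 1))"
      unfolding slope_poly_def right_diff_distrib by (simp only: mult_ac)
    also have "\<dots> = ?D" unfolding a b by (simp add: algebra_simps)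
    finally show ?thesis by simp
  qed
  ultimately show ?thesis by (simp only:)
qed

lemma diagonal_min:
  assumes "e \<ge> 1" "1 < x0" "x0 < 1 + delta e"
    and neg: "\<And>X. 3 / 4 \<le> X \<Longrightarrow> X < 1 / x0 \<Longrightarrow> slope_poly (e - 1) X < 0"
    and pos: "\<And>X. 1 / x0 < X \<Longrightarrow> X \<le> 1 \<Longrightarrow> slope_poly (e - 1) X > 0"
    and X: "3 / 4 \<le> X" "X \<le> 1" "X \<noteq> 1 / x0"
  shows "diagonal e (1 / x0) < diagonal e X"
proof -
  define n where "n = e - 1"
  have e: "e = Suc n" using assms by (simp add: n_def)
  have r: "3 / 4 \<le> 1 / x0" "1 / x0 \<le> 1"
    using assms(2,3) delta_bounds[OF assms(1)] by (simp_all add: field_simps)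
  have cont: "continuous_on {a..b} (diagonal e)" if "a > 0" for a b
    using that diagonal_deriv[of _ n] unfolding e
    by (intro continuous_at_imp_continuous_on ballI) (meson DERIV_isCont atLeastAtMost_iff less_le_trans)
  show ?thesis
  proof (cases "X < 1 / x0")
    case True
    show ?thesis
    proof (rule DERIV_neg_imp_decreasing_open[OF True])
      fix x assume x: "X < x" "x < 1 / x0"
      have "2 * real (Suc n) * (2 / 3) ^ Suc n * slope_poly n x < 0"
        using neg[of x] x X by (intro mult_pos_neg) (auto simp: n_def)
      then show "\<exists>y. (diagonal e has_real_derivative y) (at x) \<and> y < 0"
        using diagonal_deriv[of x n] x X e by auto
    qed (use cont X in auto)
  next
    case False
    then have lt: "1 / x0 < X" using X by simp
    show ?thesis
    proof (rule DERIV_pos_imp_increasing_open[OF lt])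
      fix x assume x: "1 / x0 < x" "x < X"
      have "2 * real (Suc n) * (2 / 3) ^ Suc n * slope_poly n x > 0"
        using pos[of x] x X by (intro mult_pos_pos) (auto simp: n_def)
      then show "\<exists>y. (diagonal e has_real_derivative y) (at x) \<and> y > 0"
        using diagonal_deriv[of x n] x r e by auto
    next
      show "continuous_on {1 / x0..X} (diagonal e)" by (rule cont) (use r in linarith)
    qed
  qed
qed

section \<open>Global minimizers of the limit\<close>

lemma limit_ratio_ge:
  assumes "\<And>j. j \<in> {1..e} \<Longrightarrow> \<sigma> j > 0"
  shows "limit_ratio e \<sigma> \<tau> = best_ratio {1..e} \<sigma> +
     ((\<Prod>j\<in>{1..e}. \<Omega> (1 / \<sigma> j) (1 + 2 * \<tau> j / \<sigma> j)) - (\<Prod>j\<in>{1..e}. trough (\<sigma> j)))"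
    and "best_ratio {1..e} \<sigma> \<le> limit_ratio e \<sigma> \<tau>"
proof -
  have "(\<Prod>j\<in>{1..e}. mean_value (\<sigma> j)) = (\<Prod>j\<in>{1..e}. 2 / 3 * \<sigma> j)"
    by (simp add: mean_value_def)
  also have "\<dots> = (2 / 3) ^ e * (\<Prod>j\<in>{1..e}. \<sigma> j)" by (simp only: prod.distrib prod_constant) simp
  finally show eq: "limit_ratio e \<sigma> \<tau> = best_ratio {1..e} \<sigma> +
     ((\<Prod>j\<in>{1..e}. \<Omega> (1 / \<sigma> j) (1 + 2 * \<tau> j / \<sigma> j)) - (\<Prod>j\<in>{1..e}. trough (\<sigma> j)))"
    by (simp add: limit_ratio_def best_ratio_def peak_def power_divide)
  have "(\<Prod>j\<in>{1..e}. trough (\<sigma> j)) \<le> (\<Prod>j\<in>{1..e}. \<Omega> (1 / \<sigma> j) (1 + 2 * \<tau> j / \<sigma> j))"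
    unfolding trough_def using assms by (intro prod_mono conjI \<Omega>_half_le \<Omega>_nonneg) auto
  then show "best_ratio {1..e} \<sigma> \<le> limit_ratio e \<sigma> \<tau>" using eq by simp
qed

lemma prod_eq_imp_factors_eq:
  fixes a b :: "'j \<Rightarrow> real"
  assumes "finite J" "\<And>j. j \<in> J \<Longrightarrow> 0 < a j \<and> a j \<le> b j" "prod b J = prod a J" "i \<in> J"
  shows "a i = b i"
proof (rule ccontr)
  assume "a i \<noteq> b i"
  then have "a i < b i" using assms(2)[OF assms(4)] by simp
  moreover have "0 < prod a (J - {i})" "prod a (J - {i}) \<le> prod b (J - {i})"
    using assms(2) by (auto intro!: prod_pos prod_mono simp: less_imp_le)
  ultimately have "a i * prod a (J - {i}) < b i * prod b (J - {i})"
    using assms(2)[OF assms(4)] by (intro mult_less_le_imp_less) auto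
  then show False using assms by (simp add: prod.remove)
qed

text \<open>With the denominator s cleared, the half-period condition reads s + 2 t = 1/2 +
  k.\<close>

lemma trough_attained_iff:
  assumes "1 \<le> s" "s \<le> 4 / 3"
  shows "\<Omega> (1 / s) (1 + 2 * t / s) = trough s \<longleftrightarrow>
    t \<in> {(1 - 2 * s) / 4 + real_of_int n / 2 | n. n \<in> (UNIV :: int set)}"
proof -
  have "\<Omega> (1 / s) (1 + 2 * t / s) = trough s \<longleftrightarrow> (\<exists>k::int. 1 + 2 * t / s = 1 / s / 2 + 1 / s * of_int k)"
    unfolding trough_def by (rule \<Omega>_eq_half_iff) (use assms in auto)
  also have "\<dots> \<longleftrightarrow> (\<exists>k::int. t = (1 - 2 * s) / 4 + real_of_int k / 2)"
  proof (intro ex_cong1)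
    fix k :: int
    have "1 + 2 * t / s = (s + 2 * t) / s" "1 / s / 2 + 1 / s * of_int k = (1 / 2 + of_int k) / s"
      using assms by (simp_all add: field_simps)
    then have "1 + 2 * t / s = 1 / s / 2 + 1 / s * of_int k \<longleftrightarrow> s + 2 * t = 1 / 2 + of_int k"
      using assms by simp
    also have "\<dots> \<longleftrightarrow> t = (1 - 2 * s) / 4 + real_of_int k / 2" by (auto simp: field_simps)
    finally show "1 + 2 * t / s = 1 / s / 2 + 1 / s * of_int k \<longleftrightarrow> t = (1 - 2 * s) / 4 + real_of_int k / 2" .
  qed
  finally show ?thesis by auto
qed

text \<open>The limit is at least \<open>best_ratio\<close>, which is at least its value at some
  sizes in the box, then at their geometric mean, then at x0. Each comparison of sizes is strict
  unless the sizes already have the required form, so equality with the attained bound m can be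
  traced back; the translations come last.\<close>

lemma limit_ratio_minimizers:
  assumes e: "e \<ge> 1" and \<sigma>: "\<forall>j\<in>{1..e}. \<sigma> j > 0"
  shows "(\<forall>\<sigma>' \<tau>'. (\<forall>j\<in>{1..e}. \<sigma>' j > 0) \<longrightarrow> limit_ratio e \<sigma> \<tau> \<le> limit_ratio e \<sigma>' \<tau>') \<longleftrightarrow>
    (\<forall>j\<in>{1..e}. optimal_size e (\<sigma> j) \<and>
       \<tau> j \<in> {(1 - 2 * \<sigma> j) / 4 + real_of_int n / 2 | n. n \<in> (UNIV :: int set)})"
proof -
  let ?J = "{1..e}"
  obtain x0 where x0: "1 < x0" "x0 < 1 + delta e" "size_poly e x0 = 0"
    "\<And>X. 3 / 4 \<le> X \<Longrightarrow> X < 1 / x0 \<Longrightarrow> slope_poly (e - 1) X < 0"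
    "\<And>X. 1 / x0 < X \<Longrightarrow> X \<le> 1 \<Longrightarrow> slope_poly (e - 1) X > 0"
    and opt: "\<And>x. optimal_size e x \<longleftrightarrow> x = x0"
    by (rule size_poly_sign[OF e]) blast
  have b0: "1 \<le> x0" "x0 \<le> 4 / 3" using x0 delta_bounds[OF e] by auto
  define m where "m = best_ratio ?J (\<lambda>_. x0)"
  have diag: "m \<le> best_ratio ?J (\<lambda>_. g) \<and> (g \<noteq> x0 \<longrightarrow> m < best_ratio ?J (\<lambda>_. g))"
    if "1 \<le> g" "g \<le> 4 / 3" for g
  proof (cases "g = x0")
    case False
    then have "1 / g \<noteq> 1 / x0" by simp
    moreover have "3 / 4 \<le> 1 / g" "1 / g \<le> 1" using that by (simp_all add: field_simps)
    ultimately have "diagonal e (1 / x0) < diagonal e (1 / g)"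
      using diagonal_min[OF e x0(1,2,4,5)] by blast
    then show ?thesis using that b0 by (simp add: m_def best_ratio_diagonal)
  qed (simp add: m_def)
  have lower: "m \<le> best_ratio ?J \<sigma>' \<and> (best_ratio ?J \<sigma>' = m \<longrightarrow> (\<forall>j\<in>?J. \<sigma>' j = x0))"
    if pos: "\<forall>j\<in>?J. \<sigma>' j > 0" for \<sigma>'
  proof -
    obtain \<sigma>'' where s2: "\<forall>j\<in>?J. 1 \<le> \<sigma>'' j \<and> \<sigma>'' j \<le> 4 / 3" "best_ratio ?J \<sigma>'' \<le> best_ratio ?J \<sigma>'"
      "(\<exists>j\<in>?J. \<sigma>' j < 1 \<or> \<sigma>' j > 4 / 3) \<longrightarrow> best_ratio ?J \<sigma>'' < best_ratio ?J \<sigma>'"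
      "(\<forall>j\<in>?J. 1 \<le> \<sigma>' j \<and> \<sigma>' j \<le> 4 / 3) \<longrightarrow> \<sigma>'' = \<sigma>'"
      using best_ratio_box[of ?J \<sigma>', OF finite_atLeastAtMost bspec[OF pos]] by blast
    have ne: "?J \<noteq> {}" using e by simp
    obtain g where g: "1 \<le> g" "g \<le> 4 / 3" "best_ratio ?J (\<lambda>_. g) \<le> best_ratio ?J \<sigma>''"
      "best_ratio ?J (\<lambda>_. g) = best_ratio ?J \<sigma>'' \<longrightarrow> (\<forall>j\<in>?J. \<sigma>'' j = g)"
      by (rule best_ratio_const_le[of ?J \<sigma>'', OF finite_atLeastAtMost ne bspec[OF s2(1)]])
    have dg: "m \<le> best_ratio ?J (\<lambda>_. g)" "g \<noteq> x0 \<Longrightarrow> m < best_ratio ?J (\<lambda>_. g)"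
      using diag[OF g(1,2)] by simp_all
    have ge: "m \<le> best_ratio ?J \<sigma>'" using dg(1) g(3) s2(2) by linarith
    moreover have "\<forall>j\<in>?J. \<sigma>' j = x0" if eq: "best_ratio ?J \<sigma>' = m"
    proof -
      have "\<not> m < best_ratio ?J (\<lambda>_. g)" using g(3) s2(2) eq by linarith
      then have "g = x0" using dg(2) by blast
      moreover have "best_ratio ?J (\<lambda>_. g) = best_ratio ?J \<sigma>''"
        using dg(1) g(3) s2(2) eq by linarith
      moreover have "best_ratio ?J \<sigma>'' = best_ratio ?J \<sigma>'"
        using dg(1) g(3) s2(2) eq by linarith
      then have "\<not> (\<exists>j\<in>?J. \<sigma>' j < 1 \<or> \<sigma>' j > 4 / 3)" using s2(3) by linarith
      then have "\<sigma>'' = \<sigma>'" using s2(4) by (meson not_less)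
      ultimately show ?thesis using g(4) by simp
    qed
    ultimately show ?thesis by blast
  qed
  \<comment> \<open>Positivity lets the equality of two products be split into equality of their
    factors.\<close>
  have tr: "0 < trough x0" using trough_box_bounds[OF b0] by simp
  have min_iff: "limit_ratio e \<sigma>' \<tau>' = m \<longleftrightarrow> (\<forall>j\<in>?J. optimal_size e (\<sigma>' j) \<and>
       \<tau>' j \<in> {(1 - 2 * \<sigma>' j) / 4 + real_of_int n / 2 | n. n \<in> (UNIV :: int set)})"
    if pos: "\<forall>j\<in>?J. \<sigma>' j > 0" for \<sigma>' \<tau>'
  proof
    assume eq: "limit_ratio e \<sigma>' \<tau>' = m"
    have pos': "\<And>j. j \<in> ?J \<Longrightarrow> \<sigma>' j > 0" using pos by blast
    have br: "best_ratio ?J \<sigma>' = m"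
      using lower[OF pos] limit_ratio_ge(2)[of e \<sigma>' \<tau>', OF pos'] eq by linarith
    then have all: "\<forall>j\<in>?J. \<sigma>' j = x0" using lower[OF pos] by blast
    have "(\<Prod>j\<in>?J. \<Omega> (1 / \<sigma>' j) (1 + 2 * \<tau>' j / \<sigma>' j)) = (\<Prod>j\<in>?J. trough (\<sigma>' j))"
      using limit_ratio_ge(1)[of e \<sigma>' \<tau>', OF pos'] br eq by linarith
    moreover have "0 < trough (\<sigma>' j) \<and> trough (\<sigma>' j) \<le> \<Omega> (1 / \<sigma>' j) (1 + 2 * \<tau>' j / \<sigma>' j)"
      if "j \<in> ?J" for j
      using \<Omega>_half_le[of "1 / x0" "1 + 2 * \<tau>' j / x0"] b0 tr
      unfolding bspec[OF all that] by (simp add: trough_def)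
    ultimately have "trough (\<sigma>' j) = \<Omega> (1 / \<sigma>' j) (1 + 2 * \<tau>' j / \<sigma>' j)" if "j \<in> ?J" for j
      using that by (intro prod_eq_imp_factors_eq[of ?J "\<lambda>j. trough (\<sigma>' j)" "\<lambda>j. \<Omega> (1 / \<sigma>' j) (1 + 2 * \<tau>' j / \<sigma>' j)"])
        simp_all
    then show "\<forall>j\<in>?J. optimal_size e (\<sigma>' j) \<and>
       \<tau>' j \<in> {(1 - 2 * \<sigma>' j) / 4 + real_of_int n / 2 | n. n \<in> (UNIV :: int set)}"
    proof (intro ballI conjI)
      fix j assume j: "j \<in> ?J"
      show "optimal_size e (\<sigma>' j)" using all j opt by simp
      have "\<Omega> (1 / x0) (1 + 2 * \<tau>' j / x0) = trough x0"
        using \<open>\<And>j. j \<in> ?J \<Longrightarrow> trough (\<sigma>' j) = \<Omega> (1 / \<sigma>' j) (1 + 2 * \<tau>' j / \<sigma>' j)\<close>[OF j] all j by simp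
      then show "\<tau>' j \<in> {(1 - 2 * \<sigma>' j) / 4 + real_of_int n / 2 | n. n \<in> (UNIV :: int set)}"
        using trough_attained_iff[OF b0, of "\<tau>' j"] bspec[OF all j] by (simp only:)
    qed
  next
    assume R: "\<forall>j\<in>?J. optimal_size e (\<sigma>' j) \<and>
       \<tau>' j \<in> {(1 - 2 * \<sigma>' j) / 4 + real_of_int n / 2 | n. n \<in> (UNIV :: int set)}"
    then have all: "\<forall>j\<in>?J. \<sigma>' j = x0" using opt by blast
    have "\<Omega> (1 / \<sigma>' j) (1 + 2 * \<tau>' j / \<sigma>' j) = trough (\<sigma>' j)" if "j \<in> ?J" for j
      using bspec[OF R that] trough_attained_iff[OF b0, of "\<tau>' j"] unfolding bspec[OF all that] by blast
    then have "(\<Prod>j\<in>?J. \<Omega> (1 / \<sigma>' j) (1 + 2 * \<tau>' j / \<sigma>' j)) = (\<Prod>j\<in>?J. trough (\<sigma>' j))"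
      by (rule prod.cong[OF refl])
    moreover have "best_ratio ?J \<sigma>' = m" using all by (simp add: m_def best_ratio_def)
    ultimately show "limit_ratio e \<sigma>' \<tau>' = m"
      using limit_ratio_ge(1)[of e \<sigma>' \<tau>', OF bspec[OF pos]] by simp
  qed
  have ge: "m \<le> limit_ratio e \<sigma>' \<tau>'" if "\<forall>j\<in>?J. \<sigma>' j > 0" for \<sigma>' \<tau>'
  proof -
    have "best_ratio ?J \<sigma>' \<le> limit_ratio e \<sigma>' \<tau>'" by (rule limit_ratio_ge(2)) (use that in blast)
    then show ?thesis using lower[OF that] by linarith
  qed
  have att: "limit_ratio e (\<lambda>_. x0) (\<lambda>_. (1 - 2 * x0) / 4 + real_of_int 0 / 2) = m"
  proof (rule min_iff[THEN iffD2])
    show "\<forall>j\<in>?J. optimal_size e x0 \<and> (1 - 2 * x0) / 4 + real_of_int 0 / 2 \<in>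
        {(1 - 2 * x0) / 4 + real_of_int n / 2 | n. n \<in> (UNIV :: int set)}"
      using opt by blast
  qed (use x0(1) in simp)
  show ?thesis unfolding min_iff[OF \<sigma>, symmetric]
  proof
    assume min: "\<forall>\<sigma>' \<tau>'. (\<forall>j\<in>?J. \<sigma>' j > 0) \<longrightarrow> limit_ratio e \<sigma> \<tau> \<le> limit_ratio e \<sigma>' \<tau>'"
    have "limit_ratio e \<sigma> \<tau> \<le> m"
      unfolding att[symmetric] by (rule min[rule_format]) (use x0(1) in simp)
    then show "limit_ratio e \<sigma> \<tau> = m" using ge[OF \<sigma>] by (rule antisym)
  qed (use ge in simp)
qed

lemma optimal_size_unique: "e \<ge> 1 \<Longrightarrow> \<exists>!x. optimal_size e x"
  using size_poly_sign[of e] by metis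

section \<open>Character sums of cubics and quartics\<close>

lemma three_of_bool:
  "A \<or> B \<or> C \<Longrightarrow> (1::real) \<le> of_bool A + of_bool B + of_bool C"
  "(0::real) \<le> of_bool A + of_bool B + of_bool C"
  by auto

lemma not_paired_imp_isolated:
  "\<not> ((x = y \<and> z = w) \<or> (x = z \<and> y = w) \<or> (x = w \<and> y = z)) \<Longrightarrow>
    x \<notin> {y, z, w} \<or> y \<notin> {x, z, w} \<or> z \<notin> {x, y, w} \<or> w \<notin> {x, y, z}"
  by fastforce

text \<open>The values are real, so that conjugates of \<eta> do not appear and character sums can
  be bounded from above directly. Nontriviality is stated as the existence of a value -1.\<close>

locale finite_quadratic_character = Ring.field R for R :: "('a, 'b) ring_scheme" (structure) +
  fixes \<eta> :: "'a \<Rightarrow> real"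
  assumes finite_carrier: "finite (carrier R)"
    and eta_zero [simp]: "\<eta> \<zero> = 0"
    and eta_mult: "\<lbrakk>x \<in> carrier R; y \<in> carrier R\<rbrakk> \<Longrightarrow> \<eta> (x \<otimes> y) = \<eta> x * \<eta> y"
    and eta_sq: "\<lbrakk>x \<in> carrier R; x \<noteq> \<zero>\<rbrakk> \<Longrightarrow> (\<eta> x)\<^sup>2 = 1"
    and eta_nontrivial: "\<exists>g\<in>carrier R. \<eta> g = - 1"
begin

section \<open>Elementary sums of the quadratic character\<close>

abbreviation "K \<equiv> carrier R"
abbreviation "q \<equiv> card K"

lemma q_gt_1: "q > 1"
proof -
  have "card {\<zero>, \<one>} \<le> q" by (intro card_mono finite_carrier) auto
  then show ?thesis by simp
qed

lemma eta_one [simp]: "\<eta> \<one> = 1"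
proof -
  have "\<eta> \<one> = \<eta> \<one> * \<eta> \<one>" using eta_mult[of \<one> \<one>] by simp
  moreover have "\<eta> \<one> \<noteq> 0" using eta_sq[of \<one>] by auto
  ultimately show ?thesis by simp
qed

lemma abs_eta: "x \<in> K \<Longrightarrow> \<bar>\<eta> x\<bar> = (if x = \<zero> then 0 else 1)"
  using eta_sq[of x] by (auto simp: abs_if power2_eq_1_iff)

lemma abs_eta_le: "x \<in> K \<Longrightarrow> \<bar>\<eta> x\<bar> \<le> 1"
  by (simp add: abs_eta)

lemma sum_translate:
  assumes "a \<in> K" shows "(\<Sum>x\<in>K. f (x \<oplus> a)) = (\<Sum>x\<in>K. f x)"
  by (rule sum.reindex_bij_witness[of _ "\<lambda>x. x \<ominus> a" "\<lambda>x. x \<oplus> a"])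
    (use assms in \<open>auto simp: a_minus_def a_assoc l_neg r_neg\<close>)

lemma sum_dilate:
  assumes "a \<in> K" "a \<noteq> \<zero>" shows "(\<Sum>x\<in>K. f (a \<otimes> x)) = (\<Sum>x\<in>K. f x)"
proof (rule sum.reindex_bij_witness[of _ "\<lambda>x. inv a \<otimes> x" "\<lambda>x. a \<otimes> x"])
  have u: "a \<in> Units R" using assms field_Units by auto
  show "inv a \<otimes> (a \<otimes> x) = x" "a \<otimes> (inv a \<otimes> x) = x" if "x \<in> K" for x
    using u that assms by (simp_all add: m_assoc[symmetric])
qed (use assms field_Units in auto)

lemma sum_invert: "(\<Sum>x\<in>K - {\<zero>}. f (inv x)) = (\<Sum>x\<in>K - {\<zero>}. f x)"
proof -
  have "inv x \<in> Units R" "inv (inv x) = x" if "x \<in> Units R" for x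
    using that by auto
  then show ?thesis
    using field_Units by (intro sum.reindex_bij_witness[of _ "\<lambda>x. inv x" "\<lambda>x. inv x"]) auto
qed

lemma sum_eta: "(\<Sum>x\<in>K. \<eta> x) = 0"
proof -
  obtain g where g: "g \<in> K" "\<eta> g = - 1" using eta_nontrivial by blast
  then have "g \<noteq> \<zero>" by auto
  have "(\<Sum>x\<in>K. \<eta> x) = (\<Sum>x\<in>K. \<eta> (g \<otimes> x))" using sum_dilate[OF g(1) \<open>g \<noteq> \<zero>\<close>, of \<eta>] by simp
  also have "\<dots> = (\<Sum>x\<in>K. - \<eta> x)" using g by (intro sum.cong) (auto simp: eta_mult)
  finally show ?thesis by (simp add: sum_negf)
qed

lemma sum_eta_affine:
  assumes "a \<in> K" "b \<in> K" "b \<noteq> \<zero>" shows "(\<Sum>t\<in>K. \<eta> (a \<oplus> b \<otimes> t)) = 0"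
proof -
  have "(\<Sum>t\<in>K. \<eta> (a \<oplus> b \<otimes> t)) = (\<Sum>t\<in>K. \<eta> (a \<oplus> t))"
    using sum_dilate[OF assms(2,3), of "\<lambda>t. \<eta> (a \<oplus> t)"] .
  also have "\<dots> = (\<Sum>t\<in>K. \<eta> (t \<oplus> a))" using assms by (intro sum.cong) (auto simp: a_comm)
  also have "\<dots> = 0" using sum_translate[OF assms(1), of \<eta>] sum_eta by simp
  finally show ?thesis .
qed

lemma eta_inv: "x \<in> K \<Longrightarrow> x \<noteq> \<zero> \<Longrightarrow> \<eta> (inv x) = \<eta> x"
proof -
  assume x: "x \<in> K" "x \<noteq> \<zero>"
  then have u: "x \<in> Units R" using field_Units by auto
  then have "\<eta> x * \<eta> (inv x) = 1" using x eta_mult[of x "inv x"] by auto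
  moreover have "\<eta> x * \<eta> x = 1" using eta_sq[OF x] by (simp add: power2_eq_square)
  ultimately show ?thesis by (metis mult.assoc mult.commute mult_1)
qed

lemma minus_eq_zero_iff: "a \<in> K \<Longrightarrow> b \<in> K \<Longrightarrow> a \<ominus> b = \<zero> \<longleftrightarrow> a = b"
  by (metis a_minus_def add.inv_closed minus_equality minus_minus r_neg)

text \<open>After a translation the factors are \<eta> x and \<eta> (x + d). For x \<noteq> 0 their
  product is \<eta> (1 + d / x), and inversion makes the sum a complete linear one, which vanishes,
  minus its term at 0, which is \<eta> 1.\<close>

lemma eta_correlation:
  assumes "a \<in> K" "b \<in> K" "a \<noteq> b"
  shows "(\<Sum>x\<in>K. \<eta> (x \<oplus> a) * \<eta> (x \<oplus> b)) = - 1"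
proof -
  define d where "d = b \<ominus> a"
  have d: "d \<in> K" "d \<noteq> \<zero>" using assms minus_eq_zero_iff[of b a] by (auto simp: d_def)
  have ad: "(x \<oplus> a) \<oplus> d = x \<oplus> b" if "x \<in> K" for x
    using assms that unfolding d_def by algebra
  have "(\<Sum>x\<in>K. \<eta> (x \<oplus> a) * \<eta> (x \<oplus> b)) = (\<Sum>x\<in>K. \<eta> (x \<oplus> a) * \<eta> ((x \<oplus> a) \<oplus> d))"
    by (intro sum.cong) (simp_all add: ad)
  also have "\<dots> = (\<Sum>x\<in>K. \<eta> x * \<eta> (x \<oplus> d))" by (rule sum_translate[OF assms(1)])
  also have "\<dots> = (\<Sum>x\<in>K - {\<zero>}. \<eta> x * \<eta> (x \<oplus> d))"
    by (rule sum.mono_neutral_right) (auto simp: finite_carrier)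
  also have "\<dots> = (\<Sum>x\<in>K - {\<zero>}. \<eta> (\<one> \<oplus> d \<otimes> inv x))"
  proof (rule sum.cong[OF refl])
    fix x assume x: "x \<in> K - {\<zero>}"
    then have u: "x \<in> Units R" using field_Units by auto
    have "\<one> \<oplus> d \<otimes> inv x = inv x \<otimes> (x \<oplus> d)" using u x d by (simp add: r_distr m_comm)
    then show "\<eta> x * \<eta> (x \<oplus> d) = \<eta> (\<one> \<oplus> d \<otimes> inv x)"
      using u x d by (simp add: eta_mult eta_inv)
  qed
  also have "\<dots> = (\<Sum>x\<in>K - {\<zero>}. \<eta> (\<one> \<oplus> d \<otimes> x))" by (rule sum_invert)
  also have "\<dots> = (\<Sum>x\<in>K. \<eta> (\<one> \<oplus> d \<otimes> x)) - \<eta> (\<one> \<oplus> d \<otimes> \<zero>)"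
    by (subst sum_diff1) (auto simp: finite_carrier)
  also have "\<dots> = - 1" using d by (simp add: sum_eta_affine)
  finally show ?thesis .
qed

text \<open>Horner form, lowest coefficient first. The leading coefficient may be 0, so
  \<open>cubics\<close> is the whole 4-dimensional space of polynomials of degree at most 3 and is
  closed under addition.\<close>

fun cubic :: "'a \<times> 'a \<times> 'a \<times> 'a \<Rightarrow> 'a \<Rightarrow> 'a" where
  "cubic (c0, c1, c2, c3) x = c0 \<oplus> x \<otimes> (c1 \<oplus> x \<otimes> (c2 \<oplus> x \<otimes> c3))"

abbreviation "cubics \<equiv> K \<times> K \<times> K \<times> K"

text \<open>Coefficients of k (x + a) (x + b) (x + c); the roots are the negatives of a, b,
  c.\<close>

definition cubic_roots :: "'a \<Rightarrow> 'a \<Rightarrow> 'a \<Rightarrow> 'a \<Rightarrow> 'a \<times> 'a \<times> 'a \<times> 'a" where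
  "cubic_roots k a b c =
    (k \<otimes> (a \<otimes> b \<otimes> c), k \<otimes> (a \<otimes> b \<oplus> a \<otimes> c \<oplus> b \<otimes> c), k \<otimes> (a \<oplus> b \<oplus> c), k)"

lemma cubic_closed [simp]: "c \<in> cubics \<Longrightarrow> x \<in> K \<Longrightarrow> cubic c x \<in> K"
  by (cases c) auto

declare cubic.simps [simp del]

lemma cubic_roots_closed [simp]:
  "\<lbrakk>k \<in> K; a \<in> K; b \<in> K; c \<in> K\<rbrakk> \<Longrightarrow> cubic_roots k a b c \<in> cubics"
  by (auto simp: cubic_roots_def)

lemma cubic_cubic_roots:
  assumes "k \<in> K" "a \<in> K" "b \<in> K" "c \<in> K" "x \<in> K"
  shows "cubic (cubic_roots k a b c) x = k \<otimes> ((x \<oplus> a) \<otimes> (x \<oplus> b) \<otimes> (x \<oplus> c))"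
proof -
  have s1: "(x \<oplus> a) \<otimes> (x \<oplus> b) = a \<otimes> b \<oplus> x \<otimes> ((a \<oplus> b) \<oplus> x)" using assms by algebra
  have s2: "(v \<oplus> x \<otimes> (s \<oplus> x)) \<otimes> (x \<oplus> c) = v \<otimes> c \<oplus> x \<otimes> ((v \<oplus> s \<otimes> c) \<oplus> x \<otimes> ((s \<oplus> c) \<oplus> x))"
    if "v \<in> K" "s \<in> K" for v s
    using that assms(4,5) by algebra
  have s3: "k \<otimes> (v \<oplus> x \<otimes> (s \<oplus> x \<otimes> (w \<oplus> x))) = k \<otimes> v \<oplus> x \<otimes> (k \<otimes> s \<oplus> x \<otimes> (k \<otimes> w \<oplus> x \<otimes> k))"
    if "v \<in> K" "s \<in> K" "w \<in> K" for v s w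
    using that assms(1,5) by (simp add: r_distr m_lcomm m_comm)
  have s4: "a \<otimes> b \<oplus> (a \<oplus> b) \<otimes> c = a \<otimes> b \<oplus> a \<otimes> c \<oplus> b \<otimes> c" using assms by (simp add: l_distr a_assoc)
  have "(x \<oplus> a) \<otimes> (x \<oplus> b) \<otimes> (x \<oplus> c) =
      a \<otimes> b \<otimes> c \<oplus> x \<otimes> ((a \<otimes> b \<oplus> a \<otimes> c \<oplus> b \<otimes> c) \<oplus> x \<otimes> ((a \<oplus> b \<oplus> c) \<oplus> x))"
    unfolding s1 s4[symmetric] by (rule s2) (use assms in auto)
  then have "k \<otimes> ((x \<oplus> a) \<otimes> (x \<oplus> b) \<otimes> (x \<oplus> c)) = k \<otimes> (a \<otimes> b \<otimes> c) \<oplus> x \<otimes>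
      (k \<otimes> (a \<otimes> b \<oplus> a \<otimes> c \<oplus> b \<otimes> c) \<oplus> x \<otimes> (k \<otimes> (a \<oplus> b \<oplus> c) \<oplus> x \<otimes> k))"
    by (simp only:) (rule s3, use assms in auto)
  then show ?thesis unfolding cubic_roots_def cubic.simps by (simp only:)
qed

fun coeff_shift :: "'a \<Rightarrow> 'a \<times> 'a \<times> 'a \<times> 'a \<Rightarrow> 'a \<times> 'a \<times> 'a \<times> 'a \<Rightarrow> 'a \<times> 'a \<times> 'a \<times> 'a" where
  "coeff_shift t (g0, g1, g2, g3) (c0, c1, c2, c3) =
     (c0 \<oplus> g0 \<otimes> t, c1 \<oplus> g1 \<otimes> t, c2 \<oplus> g2 \<otimes> t, c3 \<oplus> g3 \<otimes> t)"

lemma cubic_coeff_shift: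
  assumes "t \<in> K" "g \<in> cubics" "c \<in> cubics" "x \<in> K"
  shows "cubic (coeff_shift t g c) x = cubic c x \<oplus> cubic g x \<otimes> t"
proof -
  obtain g0 g1 g2 g3 c0 c1 c2 c3 where e: "g = (g0, g1, g2, g3)" "c = (c0, c1, c2, c3)"
    by (metis prod_cases4)
  have "g0 \<in> K" "g1 \<in> K" "g2 \<in> K" "g3 \<in> K" "c0 \<in> K" "c1 \<in> K" "c2 \<in> K" "c3 \<in> K"
    using assms(2,3) unfolding e by simp_all
  note cl = this
  have s: "(u \<oplus> v \<otimes> t) \<oplus> x \<otimes> (u' \<oplus> v' \<otimes> t) = (u \<oplus> x \<otimes> u') \<oplus> (v \<oplus> x \<otimes> v') \<otimes> t"
    if "u \<in> K" "v \<in> K" "u' \<in> K" "v' \<in> K" for u v u' v'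
    using that assms(1,4) by (simp add: l_distr r_distr m_assoc a_assoc a_lcomm)
  have A: "(c2 \<oplus> g2 \<otimes> t) \<oplus> x \<otimes> (c3 \<oplus> g3 \<otimes> t) = (c2 \<oplus> x \<otimes> c3) \<oplus> (g2 \<oplus> x \<otimes> g3) \<otimes> t"
    by (rule s) (use cl in auto)
  have B: "(c1 \<oplus> g1 \<otimes> t) \<oplus> x \<otimes> ((c2 \<oplus> x \<otimes> c3) \<oplus> (g2 \<oplus> x \<otimes> g3) \<otimes> t) =
      (c1 \<oplus> x \<otimes> (c2 \<oplus> x \<otimes> c3)) \<oplus> (g1 \<oplus> x \<otimes> (g2 \<oplus> x \<otimes> g3)) \<otimes> t"
    by (rule s) (use cl assms(4) in auto)
  show ?thesis
    unfolding e coeff_shift.simps cubic.simps A B by (rule s) (use cl assms(4) in auto)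
qed

lemma sum_coeff_shift:
  assumes "t \<in> K" "g \<in> cubics"
  shows "(\<Sum>c\<in>cubics. f (coeff_shift t g c)) = (\<Sum>c\<in>cubics. f c)"
proof (rule sum.reindex_bij_witness[of _ "coeff_shift (\<ominus> t) g" "coeff_shift t g"])
  have inv: "x \<oplus> y \<otimes> s \<oplus> y \<otimes> (\<ominus> s) = x" if "x \<in> K" "y \<in> K" "s \<in> K" for x y s
    using that by algebra
  have inv': "x \<oplus> y \<otimes> (\<ominus> s) \<oplus> y \<otimes> s = x" if "x \<in> K" "y \<in> K" "s \<in> K" for x y s
    using that by algebra
  obtain g0 g1 g2 g3 where g: "g = (g0, g1, g2, g3)" by (metis prod_cases4)
  have gK: "g0 \<in> K" "g1 \<in> K" "g2 \<in> K" "g3 \<in> K" using assms(2) unfolding g by simp_all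
  fix c assume "c \<in> cubics"
  then obtain c0 c1 c2 c3 where c: "c = (c0, c1, c2, c3)" and cK: "c0 \<in> K" "c1 \<in> K" "c2 \<in> K" "c3 \<in> K"
    by blast
  show "coeff_shift (\<ominus> t) g (coeff_shift t g c) = c"
    unfolding g c coeff_shift.simps using gK cK assms(1) by (simp only: inv)
  show "coeff_shift t g (coeff_shift (\<ominus> t) g c) = c"
    unfolding g c coeff_shift.simps using gK cK assms(1) by (simp only: inv')
  show "coeff_shift t g c \<in> cubics" "coeff_shift (\<ominus> t) g c \<in> cubics"
    unfolding g c coeff_shift.simps using gK cK assms(1) by simp_all
qed simp

text \<open>Averaging over the multiples of the cubic that vanishes at \<open>y\<close>, \<open>z\<close>, \<open>w\<close> but not at \<open>x\<close>.\<close>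

lemma cubic_values_vanish:
  assumes "x \<in> K" "y \<in> K" "z \<in> K" "w \<in> K" "x \<notin> {y, z, w}"
  shows "(\<Sum>c\<in>cubics. \<eta> (cubic c x) * \<eta> (cubic c y) * \<eta> (cubic c z) * \<eta> (cubic c w)) = 0"
proof -
  define g where "g = cubic_roots \<one> (\<ominus> y) (\<ominus> z) (\<ominus> w)"
  have g: "g \<in> cubics" using assms by (simp add: g_def)
  have ev: "cubic g v = (v \<ominus> y) \<otimes> (v \<ominus> z) \<otimes> (v \<ominus> w)" if "v \<in> K" for v
    using assms that by (simp add: g_def cubic_cubic_roots a_minus_def)
  have gx: "cubic g x \<noteq> \<zero>"
    using assms by (auto simp: ev integral_iff minus_eq_zero_iff)
  have g0: "cubic g v = \<zero>" if "v \<in> {y, z, w}" for v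
    using that assms by (auto simp: ev r_neg a_minus_def)
  let ?f = "\<lambda>c. \<eta> (cubic c x) * \<eta> (cubic c y) * \<eta> (cubic c z) * \<eta> (cubic c w)"
  have "real q * (\<Sum>c\<in>cubics. ?f c) = (\<Sum>t\<in>K. \<Sum>c\<in>cubics. ?f (coeff_shift t g c))"
  proof -
    have "(\<Sum>c\<in>cubics. ?f (coeff_shift t g c)) = (\<Sum>c\<in>cubics. ?f c)" if "t \<in> K" for t
      using sum_coeff_shift[OF that g, of ?f] .
    then show ?thesis by simp
  qed
  also have "\<dots> = (\<Sum>t\<in>K. \<Sum>c\<in>cubics. \<eta> (cubic c x \<oplus> cubic g x \<otimes> t) * \<eta> (cubic c y) * \<eta> (cubic c z) * \<eta> (cubic c w))"
    using assms g by (intro sum.cong refl) (simp add: cubic_coeff_shift g0)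
  also have "\<dots> = (\<Sum>c\<in>cubics. (\<Sum>t\<in>K. \<eta> (cubic c x \<oplus> cubic g x \<otimes> t)) * \<eta> (cubic c y) * \<eta> (cubic c z) * \<eta> (cubic c w))"
    by (subst sum.swap) (simp add: sum_distrib_right)
  also have "\<dots> = (\<Sum>c\<in>cubics. 0)"
    using assms g gx by (intro sum.cong) (simp_all add: sum_eta_affine)
  finally show ?thesis using q_gt_1 by simp
qed

text \<open>If one point differs from the other three, the sum vanishes by
  \<open>cubic_values_vanish\<close>. Otherwise the points agree in pairs, and the number q^4 of
  polynomials is a trivial bound.\<close>

lemma cubic_values_bound:
  assumes "x \<in> K" "y \<in> K" "z \<in> K" "w \<in> K"
  shows "(\<Sum>c\<in>cubics. \<eta> (cubic c x) * \<eta> (cubic c y) * \<eta> (cubic c z) * \<eta> (cubic c w)) \<le>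
    real q ^ 4 * (of_bool (x = y \<and> z = w) + of_bool (x = z \<and> y = w) + of_bool (x = w \<and> y = z))"
proof (cases "(x = y \<and> z = w) \<or> (x = z \<and> y = w) \<or> (x = w \<and> y = z)")
  case True
  have "(\<Sum>c\<in>cubics. \<eta> (cubic c x) * \<eta> (cubic c y) * \<eta> (cubic c z) * \<eta> (cubic c w)) \<le> (\<Sum>c\<in>cubics. 1)"
  proof (rule sum_mono)
    fix c assume c: "c \<in> cubics"
    have "\<bar>\<eta> (cubic c v)\<bar> \<le> 1" if "v \<in> K" for v using abs_eta_le[OF cubic_closed[OF c that]] .
    then have "\<bar>\<eta> (cubic c x) * \<eta> (cubic c y) * \<eta> (cubic c z) * \<eta> (cubic c w)\<bar> \<le> 1"
      unfolding abs_mult using assms by (intro mult_le_one) simp_all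
    then show "\<eta> (cubic c x) * \<eta> (cubic c y) * \<eta> (cubic c z) * \<eta> (cubic c w) \<le> 1" by (rule abs_le_D1)
  qed
  also have "\<dots> = real q ^ 4 * 1" by (simp add: card_cartesian_product power4_eq_xxxx)
  also have "\<dots> \<le> real q ^ 4 * (of_bool (x = y \<and> z = w) + of_bool (x = z \<and> y = w) + of_bool (x = w \<and> y = z))"
    by (rule mult_left_mono[OF three_of_bool(1)[OF True]]) simp
  finally show ?thesis .
next
  case False
  then have "x \<notin> {y, z, w} \<or> y \<notin> {x, z, w} \<or> z \<notin> {x, y, w} \<or> w \<notin> {x, y, z}"
    by (rule not_paired_imp_isolated)
  then have "(\<Sum>c\<in>cubics. \<eta> (cubic c x) * \<eta> (cubic c y) * \<eta> (cubic c z) * \<eta> (cubic c w)) = 0"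
  proof (elim disjE)
    assume "x \<notin> {y, z, w}"
    then show ?thesis by (rule cubic_values_vanish[OF assms])
  next
    assume *: "y \<notin> {x, z, w}"
    have "(\<Sum>c\<in>cubics. \<eta> (cubic c x) * \<eta> (cubic c y) * \<eta> (cubic c z) * \<eta> (cubic c w)) =
      (\<Sum>c\<in>cubics. \<eta> (cubic c y) * \<eta> (cubic c x) * \<eta> (cubic c z) * \<eta> (cubic c w))"
      by (intro sum.cong refl) (simp only: mult_ac)
    then show ?thesis using cubic_values_vanish[OF assms(2,1,3,4) *] by (simp only:)
  next
    assume *: "z \<notin> {x, y, w}"
    have "(\<Sum>c\<in>cubics. \<eta> (cubic c x) * \<eta> (cubic c y) * \<eta> (cubic c z) * \<eta> (cubic c w)) =
      (\<Sum>c\<in>cubics. \<eta> (cubic c z) * \<eta> (cubic c x) * \<eta> (cubic c y) * \<eta> (cubic c w))"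
      by (intro sum.cong refl) (simp only: mult_ac)
    then show ?thesis using cubic_values_vanish[OF assms(3,1,2,4) *] by (simp only:)
  next
    assume *: "w \<notin> {x, y, z}"
    have "(\<Sum>c\<in>cubics. \<eta> (cubic c x) * \<eta> (cubic c y) * \<eta> (cubic c z) * \<eta> (cubic c w)) =
      (\<Sum>c\<in>cubics. \<eta> (cubic c w) * \<eta> (cubic c x) * \<eta> (cubic c y) * \<eta> (cubic c z))"
      by (intro sum.cong refl) (simp only: mult_ac)
    then show ?thesis using cubic_values_vanish[OF assms(4,1,2,3) *] by (simp only:)
  qed
  then show ?thesis by (simp only: mult_nonneg_nonneg zero_le_power of_nat_0_le_iff three_of_bool(2))
qed

lemma sum_power4:
  fixes f :: "'c \<Rightarrow> real"
  shows "(\<Sum>x\<in>A. f x) ^ 4 = (\<Sum>x\<in>A. \<Sum>y\<in>A. \<Sum>z\<in>A. \<Sum>w\<in>A. f x * f y * f z * f w)"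
proof -
  have "(\<Sum>x\<in>A. f x) ^ 4 = (\<Sum>x\<in>A. f x) * ((\<Sum>x\<in>A. f x) * ((\<Sum>x\<in>A. f x) * (\<Sum>x\<in>A. f x)))"
    by (simp add: power4_eq_xxxx mult.assoc)
  also have "\<dots> = (\<Sum>x\<in>A. \<Sum>y\<in>A. \<Sum>z\<in>A. \<Sum>w\<in>A. f x * (f y * (f z * f w)))"
    by (simp only: sum_distrib_left sum_distrib_right) (simp add: mult_ac)
  finally show ?thesis by (simp add: mult.assoc)
qed

text \<open>Only quadruples of points that agree in pairs survive the sum over the polynomials: at
  most 3 q^2 of them, each worth at most q^4.\<close>

lemma cubic_fourth_moment:
  "(\<Sum>c\<in>cubics. (\<Sum>x\<in>K. \<eta> (cubic c x)) ^ 4) \<le> 3 * real q ^ 6"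
proof -
  have "(\<Sum>c\<in>cubics. (\<Sum>x\<in>K. \<eta> (cubic c x)) ^ 4) =
     (\<Sum>c\<in>cubics. \<Sum>x\<in>K. \<Sum>y\<in>K. \<Sum>z\<in>K. \<Sum>w\<in>K. \<eta> (cubic c x) * \<eta> (cubic c y) * \<eta> (cubic c z) * \<eta> (cubic c w))"
    by (simp only: sum_power4)
  also have "\<dots> = (\<Sum>x\<in>K. \<Sum>y\<in>K. \<Sum>z\<in>K. \<Sum>w\<in>K. \<Sum>c\<in>cubics. \<eta> (cubic c x) * \<eta> (cubic c y) * \<eta> (cubic c z) * \<eta> (cubic c w))"
    by (simp only: sum.swap[of _ K cubics])
  also have "\<dots> \<le> (\<Sum>x\<in>K. \<Sum>y\<in>K. \<Sum>z\<in>K. \<Sum>w\<in>K. real q ^ 4 *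
      (of_bool (x = y \<and> z = w) + of_bool (x = z \<and> y = w) + of_bool (x = w \<and> y = z)))"
    by (intro sum_mono cubic_values_bound)
  also have "\<dots> = real q ^ 4 * (\<Sum>x\<in>K. \<Sum>y\<in>K. \<Sum>z\<in>K. \<Sum>w\<in>K.
      of_bool (x = y) * of_bool (z = w) + of_bool (x = z) * of_bool (y = w) + of_bool (x = w) * of_bool (y = z))"
    by (simp only: sum_distrib_left of_bool_conj)
  also have "(\<Sum>x\<in>K. \<Sum>y\<in>K. \<Sum>z\<in>K. \<Sum>w\<in>K. of_bool (x = y) * of_bool (z = w) +
      of_bool (x = z) * of_bool (y = w) + of_bool (x = w) * of_bool (y = z)) = 3 * (real q * real q)"
  proof -
    have d: "(\<Sum>w\<in>K. of_bool (z = w)) = (1::real)" if "z \<in> K" for z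
      using that finite_carrier by (simp add: of_bool_def)
    have "(\<Sum>x\<in>K. \<Sum>y\<in>K. \<Sum>z\<in>K. \<Sum>w\<in>K. of_bool (x = y) * of_bool (z = w)) = real q * real q"
      by (simp add: sum_distrib_left[symmetric] sum_distrib_right[symmetric] d)
    moreover have "(\<Sum>x\<in>K. \<Sum>y\<in>K. \<Sum>z\<in>K. \<Sum>w\<in>K. of_bool (x = z) * of_bool (y = w)) = real q * real q"
      by (simp add: sum_distrib_left[symmetric] sum_distrib_right[symmetric] d)
    moreover have "(\<Sum>x\<in>K. \<Sum>y\<in>K. \<Sum>z\<in>K. \<Sum>w\<in>K. of_bool (x = w) * of_bool (y = z)) = real q * real q"
      by (simp add: sum_distrib_left[symmetric] sum_distrib_right[symmetric] d)
    ultimately show ?thesis by (simp add: sum.distrib)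
  qed
  also have "real q ^ 4 * (3 * (real q * real q)) = 3 * real q ^ 6" by (simp add: eval_nat_numeral)
  finally show ?thesis .
qed

end

text \<open>The three indicators count the ways in which the frequencies agree in pairs; if all four
  coincide each of them is 1, and subtracting 2 restores the value 1. Times q this is the expected
  size of \<open>correlation4\<close>.\<close>

definition pairings :: "'a \<Rightarrow> 'a \<Rightarrow> 'a \<Rightarrow> 'a \<Rightarrow> real" where
  "pairings k l m n = of_bool (k = l \<and> m = n) + of_bool (k = m \<and> l = n) + of_bool (k = n \<and> l = m)
     - 2 * of_bool (k = l \<and> l = m \<and> m = n)"

text \<open>Each rearrangement brings one of the other five pairs of positions to the front.
  \<open>correlation4_perm\<close> has the same list, so a repeated pair may be assumed to stand
  first.\<close>

lemma pairings_perm: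
  "pairings k m l n = pairings k l m n" "pairings k n m l = pairings k l m n"
  "pairings l m k n = pairings k l m n" "pairings l n m k = pairings k l m n"
  "pairings m n k l = pairings k l m n"
  by (cases "k = l"; cases "k = m"; cases "k = n"; cases "l = m"; cases "l = n"; cases "m = n";
      simp add: pairings_def)+

lemma pairings_distinct: "distinct [k, l, m, n] \<Longrightarrow> pairings k l m n = 0"
  by (simp add: pairings_def)

lemma pairings_eq: "pairings k k m n = of_bool (m = n)"
  by (cases "m = n"; cases "k = m") (simp_all add: pairings_def)

context finite_quadratic_character
begin

lemma minus_add_cancel: "a \<in> K \<Longrightarrow> b \<in> K \<Longrightarrow> \<ominus> a \<oplus> b = \<zero> \<Longrightarrow> a = b"
proof -
  assume ab: "a \<in> K" "b \<in> K" "\<ominus> a \<oplus> b = \<zero>"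
  have "\<ominus> b = \<ominus> a" using ab by (intro minus_equality) auto
  then have "\<ominus> (\<ominus> b) = \<ominus> (\<ominus> a)" by simp
  then show "a = b" using ab by simp
qed

definition affine_cubic :: "'a \<Rightarrow> 'a \<Rightarrow> 'a \<Rightarrow> 'a \<times> 'a \<times> 'a \<Rightarrow> 'a \<times> 'a \<times> 'a \<times> 'a" where
  "affine_cubic a b c = (\<lambda>(k, u, v). cubic_roots k (u \<otimes> a \<oplus> v) (u \<otimes> b \<oplus> v) (u \<otimes> c \<oplus> v))"

abbreviation "affine_params \<equiv> (K - {\<zero>}) \<times> (K - {\<zero>}) \<times> K"

text \<open>A translation by v and a dilation by u lead back to the original sum times
  \<open>\<eta> k * \<eta> u ^ 3\<close>, which is 1 or -1; the fourth power removes the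
  sign.\<close>

lemma sum_affine_cubic:
  assumes "a \<in> K" "b \<in> K" "c \<in> K" "k \<in> K" "k \<noteq> \<zero>" "u \<in> K" "u \<noteq> \<zero>" "v \<in> K"
  shows "(\<Sum>x\<in>K. \<eta> (cubic (affine_cubic a b c (k, u, v)) x)) ^ 4 =
     (\<Sum>x\<in>K. \<eta> (x \<oplus> a) * \<eta> (x \<oplus> b) * \<eta> (x \<oplus> c)) ^ 4"
proof -
  define F where "F x = \<eta> k * (\<eta> (x \<oplus> u \<otimes> a) * \<eta> (x \<oplus> u \<otimes> b) * \<eta> (x \<oplus> u \<otimes> c))" for x
  have shift: "x \<oplus> (u \<otimes> w \<oplus> v) = (x \<oplus> v) \<oplus> u \<otimes> w" if "x \<in> K" "w \<in> K" for x w
    using assms that by (simp add: a_ac)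
  have "(\<Sum>x\<in>K. \<eta> (cubic (affine_cubic a b c (k, u, v)) x)) = (\<Sum>x\<in>K. F (x \<oplus> v))"
  proof (rule sum.cong[OF refl])
    fix x assume x: "x \<in> K"
    have "\<eta> (cubic (affine_cubic a b c (k, u, v)) x) =
      \<eta> (k \<otimes> ((x \<oplus> (u \<otimes> a \<oplus> v)) \<otimes> (x \<oplus> (u \<otimes> b \<oplus> v)) \<otimes> (x \<oplus> (u \<otimes> c \<oplus> v))))"
      unfolding affine_cubic_def prod.case using assms x by (subst cubic_cubic_roots) simp_all
    also have "\<dots> = F (x \<oplus> v)"
      unfolding F_def using assms x by (simp add: eta_mult shift)
    finally show "\<eta> (cubic (affine_cubic a b c (k, u, v)) x) = F (x \<oplus> v)" .
  qed
  also have "\<dots> = (\<Sum>x\<in>K. F x)" by (rule sum_translate[OF assms(8)])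
  also have "\<dots> = (\<Sum>x\<in>K. F (u \<otimes> x))" by (rule sum_dilate[OF assms(6,7), symmetric])
  also have "\<dots> = (\<Sum>x\<in>K. (\<eta> k * \<eta> u ^ 3) * (\<eta> (x \<oplus> a) * \<eta> (x \<oplus> b) * \<eta> (x \<oplus> c)))"
  proof (rule sum.cong[OF refl])
    fix x assume x: "x \<in> K"
    have "\<eta> (u \<otimes> x \<oplus> u \<otimes> w) = \<eta> u * \<eta> (x \<oplus> w)" if "w \<in> K" for w
      using eta_mult[of u "x \<oplus> w"] assms x that by (simp add: r_distr)
    then show "F (u \<otimes> x) = (\<eta> k * \<eta> u ^ 3) * (\<eta> (x \<oplus> a) * \<eta> (x \<oplus> b) * \<eta> (x \<oplus> c))"
      unfolding F_def using assms(1-3) by (simp add: power3_eq_cube)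
  qed
  finally have eq: "(\<Sum>x\<in>K. \<eta> (cubic (affine_cubic a b c (k, u, v)) x)) =
      (\<eta> k * \<eta> u ^ 3) * (\<Sum>x\<in>K. \<eta> (x \<oplus> a) * \<eta> (x \<oplus> b) * \<eta> (x \<oplus> c))"
    by (simp only: sum_distrib_left)
  have p4: "(\<eta> w) ^ 4 = 1" if "w \<in> K" "w \<noteq> \<zero>" for w
    using eta_sq[OF that] by (simp add: power4_eq_xxxx power2_eq_square)
  have "(\<eta> u ^ 3) ^ 4 = (\<eta> u ^ 4) ^ 3" by (simp only: power_mult[symmetric] mult.commute)
  then have "(\<eta> k * \<eta> u ^ 3) ^ 4 = 1"
    unfolding power_mult_distrib p4[OF assms(4,5)] p4[OF assms(6,7)] by simp
  then show ?thesis unfolding eq power_mult_distrib by (simp only: mult_1)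
qed

text \<open>The polynomial determines k, its leading coefficient, and its at most 3 roots. The pair
  u a + v, u b + v consists of negated roots and so takes at most 9 values, and from it u and v are
  recovered because a \<noteq> b.\<close>

lemma affine_cubic_fiber:
  assumes "a \<in> K" "b \<in> K" "c \<in> K" "a \<noteq> b"
  shows "card {\<tau> \<in> affine_params. affine_cubic a b c \<tau> = p} \<le> 9"
proof (cases "{\<tau> \<in> affine_params. affine_cubic a b c \<tau> = p} = {}")
  case False
  let ?F = "{\<tau> \<in> affine_params. affine_cubic a b c \<tau> = p}"
  obtain k0 u0 v0 where t0: "k0 \<in> K" "k0 \<noteq> \<zero>" "u0 \<in> K" "v0 \<in> K" "affine_cubic a b c (k0, u0, v0) = p"
    using False by blast
  \<comment> \<open>The negated roots of p, read off from one fixed parameter triple.\<close>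
  define A where "A = {u0 \<otimes> a \<oplus> v0, u0 \<otimes> b \<oplus> v0, u0 \<otimes> c \<oplus> v0}"
  have A: "finite A" "card A \<le> 3" unfolding A_def by (auto simp: card_insert_if)
  have root: "u \<otimes> w \<oplus> v \<in> A"
    if "k \<in> K" "u \<in> K" "v \<in> K" "affine_cubic a b c (k, u, v) = p" "w \<in> {a, b, c}" for k u v w
  proof -
    define s where "s = u \<otimes> w \<oplus> v"
    have w: "w \<in> K" using that(5) assms by auto
    have s: "s \<in> K" "\<ominus> s \<in> K" using w that by (auto simp: s_def)
    have "cubic (affine_cubic a b c (k, u, v)) (\<ominus> s) =
       k \<otimes> ((\<ominus> s \<oplus> (u \<otimes> a \<oplus> v)) \<otimes> (\<ominus> s \<oplus> (u \<otimes> b \<oplus> v)) \<otimes> (\<ominus> s \<oplus> (u \<otimes> c \<oplus> v)))"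
      unfolding affine_cubic_def prod.case using assms that s by (subst cubic_cubic_roots) simp_all
    also have "\<dots> = \<zero>"
    proof -
      have "\<ominus> s \<oplus> (u \<otimes> a \<oplus> v) = \<zero> \<or> \<ominus> s \<oplus> (u \<otimes> b \<oplus> v) = \<zero> \<or> \<ominus> s \<oplus> (u \<otimes> c \<oplus> v) = \<zero>"
        using that(5) l_neg[OF s(1)] unfolding s_def by auto
      then show ?thesis using assms that s by auto
    qed
    finally have "cubic (affine_cubic a b c (k0, u0, v0)) (\<ominus> s) = \<zero>" using that(4) t0(5) by simp
    then have "k0 \<otimes> ((\<ominus> s \<oplus> (u0 \<otimes> a \<oplus> v0)) \<otimes> (\<ominus> s \<oplus> (u0 \<otimes> b \<oplus> v0)) \<otimes> (\<ominus> s \<oplus> (u0 \<otimes> c \<oplus> v0))) = \<zero>"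
      unfolding affine_cubic_def prod.case using assms t0 s by (subst (asm) cubic_cubic_roots) simp_all
    then have "\<ominus> s \<oplus> (u0 \<otimes> a \<oplus> v0) = \<zero> \<or> \<ominus> s \<oplus> (u0 \<otimes> b \<oplus> v0) = \<zero> \<or> \<ominus> s \<oplus> (u0 \<otimes> c \<oplus> v0) = \<zero>"
      using t0 s assms by (simp add: integral_iff)
    then have "s = u0 \<otimes> a \<oplus> v0 \<or> s = u0 \<otimes> b \<oplus> v0 \<or> s = u0 \<otimes> c \<oplus> v0"
      using minus_add_cancel[OF s(1)] t0 assms by (metis a_closed m_closed)
    then show ?thesis unfolding s_def A_def by simp
  qed
  let ?g = "\<lambda>(k, u, v). (u \<otimes> a \<oplus> v, u \<otimes> b \<oplus> v)"
  have "inj_on ?g ?F"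
  proof (rule inj_onI)
    fix \<tau> \<tau>' assume tt: "\<tau> \<in> ?F" "\<tau>' \<in> ?F" "?g \<tau> = ?g \<tau>'"
    obtain k u v k' u' v' where t: "\<tau> = (k, u, v)" "\<tau>' = (k', u', v')" by (metis prod_cases3)
    have K: "k \<in> K" "u \<in> K" "v \<in> K" "k' \<in> K" "u' \<in> K" "v' \<in> K"
      and p: "affine_cubic a b c (k, u, v) = p" "affine_cubic a b c (k', u', v') = p"
      and e1: "u \<otimes> a \<oplus> v = u' \<otimes> a \<oplus> v'" and e2: "u \<otimes> b \<oplus> v = u' \<otimes> b \<oplus> v'"
      using tt unfolding t by simp_all
    have d: "w \<otimes> (a \<ominus> b) = (w \<otimes> a \<oplus> z) \<ominus> (w \<otimes> b \<oplus> z)" if "w \<in> K" "z \<in> K" for w z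
      using that assms by algebra
    have "u \<otimes> (a \<ominus> b) = u' \<otimes> (a \<ominus> b)"
      unfolding d[OF K(2,3)] d[OF K(5,6)] e1 e2 by (rule refl)
    then have u: "u = u'" using m_rcancel[of "a \<ominus> b" u u'] assms K minus_eq_zero_iff by simp
    then have "v = v'" using e1 K assms by simp
    moreover have "k = k'" using p by (auto simp: affine_cubic_def cubic_roots_def)
    ultimately show "\<tau> = \<tau>'" using u t by simp
  qed
  moreover have "?g ` ?F \<subseteq> A \<times> A"
  proof (rule image_subsetI)
    fix \<tau> assume tt: "\<tau> \<in> ?F"
    obtain k u v where t: "\<tau> = (k, u, v)" by (cases \<tau>)
    have K: "k \<in> K" "u \<in> K" "v \<in> K" "affine_cubic a b c (k, u, v) = p"
      using tt unfolding t by simp_all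
    show "?g \<tau> \<in> A \<times> A" unfolding t prod.case using root[OF K] by simp
  qed
  ultimately have "card ?F \<le> card (A \<times> A)" using A by (intro card_inj_on_le) auto
  also have "\<dots> \<le> 3 * 3" unfolding card_cartesian_product using A by (intro mult_le_mono) auto
  finally show ?thesis by simp
next
  case True
  show ?thesis unfolding True by simp
qed

text \<open>All q (q - 1)^2 \<ge> q^3 / 4 parameters give the same fourth power, each polynomial
  arises at most 9 times, and the fourth moment is at most 3 q^6; the constant is 108 = 4 * 9 *
  3.\<close>

lemma cubic_sum_power4_bound:
  assumes "a \<in> K" "b \<in> K" "c \<in> K" "a \<noteq> b"
  shows "(\<Sum>x\<in>K. \<eta> (x \<oplus> a) * \<eta> (x \<oplus> b) * \<eta> (x \<oplus> c)) ^ 4 \<le> 108 * real q ^ 3"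
proof -
  define S where "S = (\<Sum>x\<in>K. \<eta> (x \<oplus> a) * \<eta> (x \<oplus> b) * \<eta> (x \<oplus> c)) ^ 4"
  define M where "M p = (\<Sum>x\<in>K. \<eta> (cubic p x)) ^ 4" for p
  have M0: "M p \<ge> 0" for p by (simp add: M_def)
  have S0: "S \<ge> 0" by (simp add: S_def)
  have card: "card (K - {\<zero>}) = q - 1" using finite_carrier by (simp add: card_Diff_singleton)
  have fin: "finite affine_params" "finite cubics" using finite_carrier by auto
  have img: "affine_cubic a b c ` affine_params \<subseteq> cubics"
  proof (rule image_subsetI)
    fix \<tau> assume t: "\<tau> \<in> affine_params"
    obtain k u v where e: "\<tau> = (k, u, v)" by (cases \<tau>)
    show "affine_cubic a b c \<tau> \<in> cubics"
      using t unfolding e affine_cubic_def prod.case using assms by (intro cubic_roots_closed) auto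
  qed
  have "real (card affine_params) * S = (\<Sum>\<tau>\<in>affine_params. M (affine_cubic a b c \<tau>))"
  proof -
    have "M (affine_cubic a b c \<tau>) = S" if "\<tau> \<in> affine_params" for \<tau>
    proof -
      obtain k u v where t: "\<tau> = (k, u, v)" by (cases \<tau>)
      show ?thesis unfolding M_def S_def t
        by (rule sum_affine_cubic) (use that assms in \<open>auto simp: t\<close>)
    qed
    then have "(\<Sum>\<tau>\<in>affine_params. M (affine_cubic a b c \<tau>)) = (\<Sum>\<tau>\<in>affine_params. S)"
      by (rule sum.cong[OF refl])
    then show ?thesis by (simp only: sum_constant)
  qed
  also have "\<dots> = (\<Sum>p\<in>cubics. real (card {\<tau> \<in> affine_params. affine_cubic a b c \<tau> = p}) * M p)"
    by (rule sum_fun_comp[OF fin img, of M])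
  also have "\<dots> \<le> (\<Sum>p\<in>cubics. 9 * M p)"
  proof (intro sum_mono mult_right_mono M0)
    fix p
    have "real (card {\<tau> \<in> affine_params. affine_cubic a b c \<tau> = p}) \<le> real 9"
      by (rule of_nat_mono[OF affine_cubic_fiber[OF assms]])
    then show "real (card {\<tau> \<in> affine_params. affine_cubic a b c \<tau> = p}) \<le> 9"
      by (simp only: of_nat_numeral)
  qed
  also have "\<dots> = 9 * (\<Sum>p\<in>cubics. M p)" by (simp only: sum_distrib_left)
  also have "\<dots> \<le> 9 * (3 * real q ^ 6)"
    unfolding M_def using cubic_fourth_moment by (intro mult_left_mono) simp_all
  also have "9 * (3 * real q ^ 6) = 27 * real q ^ 6" by simp
  also have "card affine_params = (q - 1) * ((q - 1) * q)" by (simp only: card_cartesian_product card)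
  finally have A: "real ((q - 1) * ((q - 1) * q)) * S \<le> 27 * real q ^ 6" .
  have "real q \<le> 2 * real (q - 1)" using q_gt_1 by linarith
  then have "real q * (real q * real q) \<le> 2 * real (q - 1) * (2 * real (q - 1) * real q)"
    by (intro mult_mono) simp_all
  also have "\<dots> = 4 * real ((q - 1) * ((q - 1) * q))" by (simp only: of_nat_mult)
  finally have "real q * (real q * real q) * S \<le> 4 * real ((q - 1) * ((q - 1) * q)) * S"
    by (rule mult_right_mono[OF _ S0])
  then have "real q ^ 3 * S \<le> 4 * (real ((q - 1) * ((q - 1) * q)) * S)"
    by (simp only: power3_eq_cube mult.assoc)
  also have "\<dots> \<le> 4 * (27 * real q ^ 6)" by (rule mult_left_mono[OF A]) simp
  also have "\<dots> = real q ^ 3 * (108 * real q ^ 3)" by (simp add: power_add[symmetric])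
  finally have "S \<le> 108 * real q ^ 3" by (rule mult_left_le_imp_le) (use q_gt_1 in simp)
  then show ?thesis by (simp only: S_def)
qed

text \<open>Any exponent below 1 would make the error vanish in the limit: after normalization it is
  \<open>beta\<close> / q up to logarithms.\<close>

definition beta :: real where "beta = real q powr (3 / 4)"

lemma beta_power4: "beta ^ 4 = real q ^ 3"
proof -
  have "beta ^ 4 = beta powr 4" using q_gt_1 by (simp add: beta_def powr_realpow)
  also have "\<dots> = real q powr 3" by (simp add: beta_def powr_powr)
  finally show ?thesis using q_gt_1 by (simp add: powr_realpow)
qed

lemma beta_ge_1: "beta \<ge> 1"
  unfolding beta_def using q_gt_1 by (intro ge_one_powr_ge_zero) auto

text \<open>The fourth root of the preceding bound, with 108 rounded up to 256 = 4^4.\<close>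

lemma cubic_sum_bound:
  assumes "a \<in> K" "b \<in> K" "c \<in> K" "a \<noteq> b"
  shows "\<bar>\<Sum>x\<in>K. \<eta> (x \<oplus> a) * \<eta> (x \<oplus> b) * \<eta> (x \<oplus> c)\<bar> \<le> 4 * beta"
proof -
  have "\<bar>\<Sum>x\<in>K. \<eta> (x \<oplus> a) * \<eta> (x \<oplus> b) * \<eta> (x \<oplus> c)\<bar> ^ 4 \<le> 108 * real q ^ 3"
    using cubic_sum_power4_bound[OF assms] by (simp add: power_even_abs)
  also have "\<dots> \<le> (4 * beta) ^ 4" by (simp add: power_mult_distrib beta_power4)
  finally show ?thesis using beta_ge_1 by (subst (asm) power_mono_iff) auto
qed

text \<open>The substitution \<open>x \<mapsto> 1 / x\<close> turns a quartic with the root \<open>0\<close> into a cubic.\<close>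

lemma quartic_sum_bound_aux:
  assumes "b \<in> K" "c \<in> K" "d \<in> K" "b \<noteq> \<zero>" "c \<noteq> \<zero>" "d \<noteq> \<zero>" "b \<noteq> c"
  shows "\<bar>\<Sum>x\<in>K. \<eta> x * \<eta> (x \<oplus> b) * \<eta> (x \<oplus> c) * \<eta> (x \<oplus> d)\<bar> \<le> 5 * beta"
proof -
  have inv: "inv w \<in> K" "inv w \<noteq> \<zero>" "w \<otimes> inv w = \<one>" "inv w \<otimes> w = \<one>" if "w \<in> K" "w \<noteq> \<zero>" for w
    using that field_Units by auto
  define g where "g y = \<eta> (y \<oplus> inv b) * \<eta> (y \<oplus> inv c) * \<eta> (y \<oplus> inv d)" for y
  have e: "\<eta> (x \<oplus> w) = \<eta> x * \<eta> w * \<eta> (inv x \<oplus> inv w)"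
    if "x \<in> K" "x \<noteq> \<zero>" "w \<in> K" "w \<noteq> \<zero>" for x w
  proof -
    have "x \<otimes> w \<otimes> (inv x \<oplus> inv w) = x \<otimes> inv x \<otimes> w \<oplus> x \<otimes> (w \<otimes> inv w)"
    proof -
      have "x \<otimes> w \<otimes> (i \<oplus> j) = x \<otimes> i \<otimes> w \<oplus> x \<otimes> (w \<otimes> j)" if "i \<in> K" "j \<in> K" for i j
        using that \<open>x \<in> K\<close> \<open>w \<in> K\<close> by algebra
      then show ?thesis using inv that by simp
    qed
    also have "\<dots> = x \<oplus> w" using inv that by (simp add: a_comm)
    finally show ?thesis using eta_mult[of "x \<otimes> w" "inv x \<oplus> inv w"] inv that by (simp add: eta_mult)
  qed
  have "(\<Sum>x\<in>K. \<eta> x * \<eta> (x \<oplus> b) * \<eta> (x \<oplus> c) * \<eta> (x \<oplus> d)) =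
     (\<Sum>x\<in>K - {\<zero>}. \<eta> x * \<eta> (x \<oplus> b) * \<eta> (x \<oplus> c) * \<eta> (x \<oplus> d))"
    by (rule sum.mono_neutral_right) (auto simp: finite_carrier)
  also have "\<dots> = (\<Sum>x\<in>K - {\<zero>}. (\<eta> b * \<eta> c * \<eta> d) * g (inv x))"
  proof (rule sum.cong[OF refl])
    fix x assume x: "x \<in> K - {\<zero>}"
    then have sq: "\<eta> x * \<eta> x = 1" using eta_sq[of x] by (simp add: power2_eq_square)
    have "\<eta> x * \<eta> (x \<oplus> b) * \<eta> (x \<oplus> c) * \<eta> (x \<oplus> d) =
      (\<eta> x * \<eta> x) * (\<eta> x * \<eta> x) * ((\<eta> b * \<eta> c * \<eta> d) * g (inv x))"
      using x assms by (simp add: e g_def mult_ac)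
    then show "\<eta> x * \<eta> (x \<oplus> b) * \<eta> (x \<oplus> c) * \<eta> (x \<oplus> d) = (\<eta> b * \<eta> c * \<eta> d) * g (inv x)"
      by (simp only: sq mult_1)
  qed
  also have "\<dots> = (\<eta> b * \<eta> c * \<eta> d) * (\<Sum>x\<in>K - {\<zero>}. g x)"
    unfolding sum_invert[of "\<lambda>y. (\<eta> b * \<eta> c * \<eta> d) * g y"] by (simp only: sum_distrib_left)
  also have "(\<Sum>x\<in>K - {\<zero>}. g x) = (\<Sum>x\<in>K. g x) - g \<zero>"
    by (subst sum_diff1) (auto simp: finite_carrier)
  finally have eq: "(\<Sum>x\<in>K. \<eta> x * \<eta> (x \<oplus> b) * \<eta> (x \<oplus> c) * \<eta> (x \<oplus> d)) =
    (\<eta> b * \<eta> c * \<eta> d) * ((\<Sum>x\<in>K. g x) - g \<zero>)" .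
  have "inv b \<noteq> inv c"
  proof
    assume "inv b = inv c"
    then have "b \<otimes> inv b \<otimes> c = b \<otimes> (inv c \<otimes> c)" using inv assms by (simp add: m_assoc)
    then show False using inv assms by simp
  qed
  then have "\<bar>\<Sum>x\<in>K. g x\<bar> \<le> 4 * beta"
    unfolding g_def using inv assms by (intro cubic_sum_bound) auto
  moreover have "\<bar>g \<zero>\<bar> \<le> 1"
    unfolding g_def abs_mult using inv assms by (intro mult_le_one abs_eta_le) simp_all
  ultimately have "\<bar>(\<Sum>x\<in>K. g x) - g \<zero>\<bar> \<le> 5 * beta" using beta_ge_1 by linarith
  moreover have "\<bar>\<eta> b * \<eta> c * \<eta> d\<bar> \<le> 1"
    unfolding abs_mult using assms by (intro mult_le_one abs_eta_le) simp_all
  ultimately have "\<bar>\<eta> b * \<eta> c * \<eta> d\<bar> * \<bar>(\<Sum>x\<in>K. g x) - g \<zero>\<bar> \<le> 1 * (5 * beta)"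
    by (intro mult_mono) simp_all
  then show ?thesis unfolding eq abs_mult by (simp only: mult_1)
qed

section \<open>Correlations at four points\<close>

definition correlation4 :: "'a \<Rightarrow> 'a \<Rightarrow> 'a \<Rightarrow> 'a \<Rightarrow> real" where
  "correlation4 k l m n = (\<Sum>x\<in>K. \<eta> (x \<oplus> k) * \<eta> (x \<oplus> l) * \<eta> (x \<oplus> m) * \<eta> (x \<oplus> n))"

lemma correlation4_perm:
  "correlation4 k m l n = correlation4 k l m n" "correlation4 k n m l = correlation4 k l m n"
  "correlation4 l m k n = correlation4 k l m n" "correlation4 l n m k = correlation4 k l m n"
  "correlation4 m n k l = correlation4 k l m n"
  unfolding correlation4_def by (simp_all only: mult_ac)

text \<open>A translation by k moves one root to 0, where \<open>quartic_sum_bound_aux\<close>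
  applies.\<close>

lemma correlation4_distinct:
  assumes "k \<in> K" "l \<in> K" "m \<in> K" "n \<in> K" "distinct [k, l, m, n]"
  shows "\<bar>correlation4 k l m n\<bar> \<le> 5 * beta"
proof -
  have shift: "(x \<oplus> k) \<oplus> (w \<ominus> k) = x \<oplus> w" if "x \<in> K" "w \<in> K" for x w
    using assms(1) that by algebra
  define f where "f x = \<eta> x * \<eta> (x \<oplus> (l \<ominus> k)) * \<eta> (x \<oplus> (m \<ominus> k)) * \<eta> (x \<oplus> (n \<ominus> k))" for x
  have "correlation4 k l m n = (\<Sum>x\<in>K. f (x \<oplus> k))"
    unfolding correlation4_def f_def using assms(2-4) by (intro sum.cong refl) (simp only: shift)
  also have "\<dots> = (\<Sum>x\<in>K. f x)" by (rule sum_translate[OF assms(1)])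
  finally have "correlation4 k l m n = (\<Sum>x\<in>K. f x)" .
  moreover have "\<bar>\<Sum>x\<in>K. f x\<bar> \<le> 5 * beta"
    unfolding f_def
  proof (rule quartic_sum_bound_aux)
    show "l \<ominus> k \<noteq> m \<ominus> k"
      using shift[of \<zero> l] shift[of \<zero> m] assms by auto
  qed (use assms minus_eq_zero_iff in auto)
  ultimately show ?thesis by simp
qed

text \<open>The squared factor is 1 except at x = -k, where it is 0. This removes one term r with
  |r| \<le> 1 from a two-point correlation, which is q - 1 if m = n and -1 otherwise.\<close>

lemma correlation4_repeated:
  assumes "k \<in> K" "m \<in> K" "n \<in> K"
  shows "\<bar>correlation4 k k m n - real q * of_bool (m = n)\<bar> \<le> 2"
proof -
  define r where "r = \<eta> (\<ominus> k \<oplus> m) * \<eta> (\<ominus> k \<oplus> n)"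
  have r: "\<bar>r\<bar> \<le> 1" unfolding r_def abs_mult using assms by (intro mult_le_one abs_eta_le) auto
  have sq: "\<eta> (x \<oplus> w) * \<eta> (x \<oplus> w) = 1 - of_bool (x = \<ominus> w)" if "x \<in> K" "w \<in> K" for x w
  proof -
    have "x \<oplus> w = \<zero> \<longleftrightarrow> x = \<ominus> w"
      using that by (metis l_neg minus_equality minus_minus add.inv_closed a_comm)
    then show ?thesis using eta_sq[of "x \<oplus> w"] that by (cases "x = \<ominus> w") (auto simp: power2_eq_square)
  qed
  have "correlation4 k k m n = (\<Sum>x\<in>K. (1 - of_bool (x = \<ominus> k)) * (\<eta> (x \<oplus> m) * \<eta> (x \<oplus> n)))"
    unfolding correlation4_def using assms(1) by (intro sum.cong refl) (simp only: sq mult.assoc[symmetric])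
  also have "\<dots> = (\<Sum>x\<in>K. \<eta> (x \<oplus> m) * \<eta> (x \<oplus> n)) - (\<Sum>x\<in>K. of_bool (x = \<ominus> k) * (\<eta> (x \<oplus> m) * \<eta> (x \<oplus> n)))"
    by (simp only: left_diff_distrib mult_1 sum_subtractf)
  also have "(\<Sum>x\<in>K. of_bool (x = \<ominus> k) * (\<eta> (x \<oplus> m) * \<eta> (x \<oplus> n))) = r"
  proof -
    have "(\<Sum>x\<in>K. of_bool (x = \<ominus> k) * (\<eta> (x \<oplus> m) * \<eta> (x \<oplus> n))) =
        (\<Sum>x\<in>K. if x = \<ominus> k then \<eta> (x \<oplus> m) * \<eta> (x \<oplus> n) else 0)"
      by (intro sum.cong refl) simp
    also have "\<dots> = r" using assms(1) finite_carrier by (simp add: r_def sum.delta)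
    finally show ?thesis .
  qed
  finally have eq: "correlation4 k k m n = (\<Sum>x\<in>K. \<eta> (x \<oplus> m) * \<eta> (x \<oplus> n)) - r" .
  show ?thesis
  proof (cases "m = n")
    case True
    have "(\<Sum>x\<in>K. \<eta> (x \<oplus> n) * \<eta> (x \<oplus> n)) = (\<Sum>x\<in>K. 1 - of_bool (x = \<ominus> n))"
      using assms(3) by (intro sum.cong refl sq)
    also have "\<dots> = real q - (\<Sum>x\<in>K. of_bool (x = \<ominus> n))" by (simp add: sum_subtractf)
    also have "(\<Sum>x\<in>K. of_bool (x = \<ominus> n)) = (1::real)"
      using assms(3) finite_carrier by (simp add: of_bool_def sum.delta)
    finally show ?thesis using eq r True by simp
  next
    case False
    then show ?thesis using eq r eta_correlation[OF assms(2,3)] by simp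
  qed
qed

theorem correlation4_bound:
  assumes "k \<in> K" "l \<in> K" "m \<in> K" "n \<in> K"
  shows "\<bar>correlation4 k l m n - real q * pairings k l m n\<bar> \<le> 5 * beta"
proof -
  have rep: "\<bar>correlation4 k k m n - real q * pairings k k m n\<bar> \<le> 5 * beta"
    if "k \<in> K" "m \<in> K" "n \<in> K" for k m n
    using correlation4_repeated[OF that] beta_ge_1 unfolding pairings_eq by linarith
  consider "distinct [k, l, m, n]" | "k = l" | "k = m" | "k = n" | "l = m" | "l = n" | "m = n"
    by auto
  then show ?thesis
  proof cases
    case 1
    then show ?thesis using correlation4_distinct[OF assms 1] by (simp add: pairings_distinct)
  next
    case 2
    then show ?thesis using rep[of k m n] assms by blast
  next
    case 3
    then show ?thesis using rep[of k l n] assms correlation4_perm(1)[of k m l n] pairings_perm(1)[of k m l n] by metis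
  next
    case 4
    then show ?thesis using rep[of k m l] assms correlation4_perm(2)[of k n m l] pairings_perm(2)[of k n m l] by metis
  next
    case 5
    then show ?thesis using rep[of l k n] assms correlation4_perm(3)[of l m k n] pairings_perm(3)[of l m k n] by metis
  next
    case 6
    then show ?thesis using rep[of l m k] assms correlation4_perm(4)[of l n m k] pairings_perm(4)[of l n m k] by metis
  next
    case 7
    then show ?thesis using rep[of m k l] assms correlation4_perm(5)[of m n k l] pairings_perm(5)[of m n k l] by metis
  qed
qed

end

section \<open>Expansion in Gauss sums\<close>

lemma sum_mult4:
  fixes f g h k :: "'c \<Rightarrow> 'd::comm_semiring_1"
  shows "(\<Sum>x\<in>A. f x) * (\<Sum>x\<in>A. g x) * (\<Sum>x\<in>A. h x) * (\<Sum>x\<in>A. k x) =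
    (\<Sum>x\<in>A. \<Sum>y\<in>A. \<Sum>z\<in>A. \<Sum>w\<in>A. f x * g y * h z * k w)"
  by (simp only: sum_distrib_left[symmetric] sum_distrib_right[symmetric])

locale quadratic_gauss = finite_quadratic_character R \<eta> for R :: "('a, 'b) ring_scheme" (structure) and \<eta> +
  fixes \<psi> :: "'a \<Rightarrow> complex"
  assumes psi_add: "\<lbrakk>x \<in> carrier R; y \<in> carrier R\<rbrakk> \<Longrightarrow> \<psi> (x \<oplus> y) = \<psi> x * \<psi> y"
    and psi_norm: "x \<in> carrier R \<Longrightarrow> cmod (\<psi> x) = 1"
    and psi_nontrivial: "\<exists>x\<in>carrier R. \<psi> x \<noteq> 1"
begin

section \<open>Additive characters and Gauss sums\<close>

lemma psi_cnj: "x \<in> K \<Longrightarrow> \<psi> x * cnj (\<psi> x) = 1"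
  using psi_norm[of x] by (simp add: complex_norm_square[symmetric])

lemma psi_zero: "\<psi> \<zero> = 1"
proof -
  have "\<psi> \<zero> * \<psi> \<zero> = \<psi> \<zero>" using psi_add[of \<zero> \<zero>] by simp
  moreover have "\<psi> \<zero> \<noteq> 0" using psi_norm[of \<zero>] by auto
  ultimately show ?thesis by simp
qed

lemma psi_minus: "x \<in> K \<Longrightarrow> \<psi> (\<ominus> x) = cnj (\<psi> x)"
proof -
  assume x: "x \<in> K"
  have "\<psi> x * \<psi> (\<ominus> x) = 1" using psi_add[of x "\<ominus> x"] x by (simp add: r_neg psi_zero)
  moreover have "\<psi> x \<noteq> 0" using psi_norm[OF x] by auto
  ultimately show ?thesis using psi_cnj[OF x] by (metis mult_left_cancel)
qed

lemma sum_psi: "(\<Sum>x\<in>K. \<psi> x) = 0"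
proof -
  obtain a where a: "a \<in> K" "\<psi> a \<noteq> 1" using psi_nontrivial by blast
  have "(\<Sum>x\<in>K. \<psi> x) = (\<Sum>x\<in>K. \<psi> (x \<oplus> a))" using sum_translate[OF a(1), of \<psi>] by simp
  also have "\<dots> = (\<Sum>x\<in>K. \<psi> x) * \<psi> a"
    using a(1) by (simp add: psi_add sum_distrib_right)
  finally have "(\<Sum>x\<in>K. \<psi> x) * (\<psi> a - 1) = 0" by (simp add: algebra_simps)
  then show ?thesis using a(2) by simp
qed

lemma sum_psi_mult:
  assumes "x \<in> K" shows "(\<Sum>y\<in>K. \<psi> (x \<otimes> y)) = of_nat q * of_bool (x = \<zero>)"
proof (cases "x = \<zero>")
  case True
  have "(\<Sum>y\<in>K. \<psi> (x \<otimes> y)) = (\<Sum>y\<in>K. 1)" unfolding True by (intro sum.cong) (simp_all add: psi_zero)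
  then show ?thesis using True by simp
next
  case False
  then show ?thesis using sum_dilate[OF assms False, of \<psi>] sum_psi by simp
qed

definition gauss_sum :: complex where "gauss_sum = (\<Sum>y\<in>K. of_real (\<eta> y) * \<psi> y)"

text \<open>For x \<noteq> 0 the substitution y -> x y pulls out \<eta> x; at x = 0 both sides
  vanish by \<open>sum_eta\<close>. So \<eta> is its own Fourier transform up to the factor
  \<open>gauss_sum\<close>.\<close>

lemma gauss_sum_twist:
  assumes "x \<in> K"
  shows "(\<Sum>y\<in>K. of_real (\<eta> y) * \<psi> (x \<otimes> y)) = of_real (\<eta> x) * gauss_sum"
proof (cases "x = \<zero>")
  case True
  have "(\<Sum>y\<in>K. of_real (\<eta> y) * \<psi> (x \<otimes> y)) = (\<Sum>y\<in>K. complex_of_real (\<eta> y))"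
    unfolding True by (intro sum.cong) (simp_all add: psi_zero)
  also have "\<dots> = 0" unfolding of_real_sum[symmetric] sum_eta by simp
  finally show ?thesis using True by simp
next
  case False
  have sq: "\<eta> x * \<eta> x = 1" using eta_sq[OF assms False] by (simp add: power2_eq_square)
  have "gauss_sum = (\<Sum>y\<in>K. of_real (\<eta> (x \<otimes> y)) * \<psi> (x \<otimes> y))"
    unfolding gauss_sum_def by (rule sum_dilate[OF assms False, symmetric])
  also have "\<dots> = of_real (\<eta> x) * (\<Sum>y\<in>K. of_real (\<eta> y) * \<psi> (x \<otimes> y))"
    unfolding sum_distrib_left using assms by (intro sum.cong refl) (simp add: eta_mult)
  finally have "of_real (\<eta> x) * gauss_sum = of_real (\<eta> x * \<eta> x) * (\<Sum>y\<in>K. of_real (\<eta> y) * \<psi> (x \<otimes> y))"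
    by simp
  then show ?thesis by (simp only: sq of_real_1 mult_1)
qed

lemma psi_diff: "x \<in> K \<Longrightarrow> y \<in> K \<Longrightarrow> \<psi> x * cnj (\<psi> y) = \<psi> (x \<ominus> y)"
  by (simp add: a_minus_def psi_add psi_minus)

lemma sum_eta_sq: "(\<Sum>x\<in>K. \<eta> x * \<eta> x) = real q - 1"
proof -
  have "(\<Sum>x\<in>K. \<eta> x * \<eta> x) = (\<Sum>x\<in>K - {\<zero>}. \<eta> x * \<eta> x)"
    by (rule sum.mono_neutral_right) (auto simp: finite_carrier)
  also have "\<dots> = (\<Sum>x\<in>K - {\<zero>}. 1)"
    by (intro sum.cong refl) (use eta_sq in \<open>auto simp: power2_eq_square\<close>)
  also have "\<dots> = real q - 1"
    using q_gt_1 finite_carrier by (simp add: card_Diff_singleton of_nat_diff)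
  finally show ?thesis .
qed

text \<open>Parseval for \<eta>: the twisted sums have squared modulus |G|^2 at q - 1 points x,
  while expanding the square and summing over x leaves q times the q - 1 nonzero y.\<close>

lemma gauss_sum_norm: "gauss_sum * cnj gauss_sum = of_nat q"
proof -
  have "of_real (real q - 1) * (gauss_sum * cnj gauss_sum) =
      (\<Sum>x\<in>K. of_real (\<eta> x) * gauss_sum * cnj (of_real (\<eta> x) * gauss_sum))"
    unfolding sum_eta_sq[symmetric] of_real_sum sum_distrib_right
    by (intro sum.cong refl) (simp add: mult_ac)
  also have "\<dots> = (\<Sum>x\<in>K. (\<Sum>y\<in>K. of_real (\<eta> y) * \<psi> (x \<otimes> y)) * cnj (\<Sum>z\<in>K. of_real (\<eta> z) * \<psi> (x \<otimes> z)))"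
    by (intro sum.cong refl) (simp only: gauss_sum_twist)
  also have "\<dots> = (\<Sum>x\<in>K. \<Sum>y\<in>K. \<Sum>z\<in>K. of_real (\<eta> y * \<eta> z) * \<psi> ((y \<ominus> z) \<otimes> x))"
  proof (rule sum.cong[OF refl])
    fix x assume x: "x \<in> K"
    have "of_real (\<eta> y) * \<psi> (x \<otimes> y) * cnj (of_real (\<eta> z) * \<psi> (x \<otimes> z)) =
        of_real (\<eta> y * \<eta> z) * \<psi> ((y \<ominus> z) \<otimes> x)" if "y \<in> K" "z \<in> K" for y z
    proof -
      have "(y \<ominus> z) \<otimes> x = x \<otimes> y \<ominus> x \<otimes> z" using that x by algebra
      then show ?thesis using psi_diff[of "x \<otimes> y" "x \<otimes> z"] x that by (simp add: mult_ac)
    qed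
    then show "(\<Sum>y\<in>K. of_real (\<eta> y) * \<psi> (x \<otimes> y)) * cnj (\<Sum>z\<in>K. of_real (\<eta> z) * \<psi> (x \<otimes> z)) =
       (\<Sum>y\<in>K. \<Sum>z\<in>K. of_real (\<eta> y * \<eta> z) * \<psi> ((y \<ominus> z) \<otimes> x))"
      unfolding cnj_sum sum_product by (intro sum.cong refl) simp
  qed
  also have "\<dots> = (\<Sum>y\<in>K. \<Sum>z\<in>K. \<Sum>x\<in>K. of_real (\<eta> y * \<eta> z) * \<psi> ((y \<ominus> z) \<otimes> x))"
    by (subst sum.swap) (intro sum.cong refl sum.swap)
  also have "\<dots> = (\<Sum>y\<in>K. \<Sum>z\<in>K. of_real (\<eta> y * \<eta> z) * (of_nat q * of_bool (y = z)))"
    by (intro sum.cong refl) (simp add: sum_distrib_left[symmetric] sum_psi_mult minus_eq_zero_iff)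
  also have "\<dots> = (\<Sum>y\<in>K. \<Sum>z\<in>K. if y = z then of_real (\<eta> y * \<eta> z) * of_nat q else 0)"
    by (intro sum.cong refl) simp
  also have "\<dots> = (\<Sum>y\<in>K. of_real (\<eta> y * \<eta> y) * of_nat q)"
    using finite_carrier by (intro sum.cong refl) (simp add: sum.delta)
  also have "\<dots> = of_real (real q - 1) * of_nat q"
    unfolding sum_distrib_right[symmetric] of_real_sum[symmetric] sum_eta_sq by (rule refl)
  finally show ?thesis using q_gt_1 by (simp del: of_real_diff)
qed

text \<open>Two of the four phases are conjugated, to match the balance X + Y = Z + V. The
  corresponding Gauss sums multiply to |G|^4 = q^2.\<close>

definition phase_sum :: "'i set \<Rightarrow> ('i \<Rightarrow> 'a) \<Rightarrow> ('i \<Rightarrow> 'a) \<Rightarrow> ('i \<Rightarrow> 'a) \<Rightarrow> ('i \<Rightarrow> 'a) \<Rightarrow>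
    'a \<Rightarrow> 'a \<Rightarrow> 'a \<Rightarrow> 'a \<Rightarrow> complex" where
  "phase_sum Q X Y Z V k l m n =
    (\<Sum>i\<in>Q. \<psi> (X i \<otimes> k) * \<psi> (Y i \<otimes> l) * cnj (\<psi> (Z i \<otimes> m)) * cnj (\<psi> (V i \<otimes> n)))"

context
  fixes Q :: "'i set" and X Y Z V :: "'i \<Rightarrow> 'a"
  assumes Q: "finite Q"
    and closed: "\<And>i. i \<in> Q \<Longrightarrow> X i \<in> carrier R" "\<And>i. i \<in> Q \<Longrightarrow> Y i \<in> carrier R"
      "\<And>i. i \<in> Q \<Longrightarrow> Z i \<in> carrier R" "\<And>i. i \<in> Q \<Longrightarrow> V i \<in> carrier R"
    and balanced: "\<And>i. i \<in> Q \<Longrightarrow> X i \<oplus> Y i = Z i \<oplus> V i"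
begin

abbreviation "W \<equiv> phase_sum Q X Y Z V"

lemma balanced_phase:
  assumes "i \<in> Q" "x \<in> K"
  shows "\<psi> (X i \<otimes> x) * \<psi> (Y i \<otimes> x) * cnj (\<psi> (Z i \<otimes> x)) * cnj (\<psi> (V i \<otimes> x)) = 1"
proof -
  have "\<psi> (X i \<otimes> x) * \<psi> (Y i \<otimes> x) * cnj (\<psi> (Z i \<otimes> x)) * cnj (\<psi> (V i \<otimes> x)) =
     \<psi> ((X i \<oplus> Y i) \<otimes> x) * cnj (\<psi> ((Z i \<oplus> V i) \<otimes> x))"
    using closed[OF assms(1)] assms(2) by (simp add: l_distr psi_add)
  also have "\<dots> = 1" unfolding balanced[OF assms(1)]
    using closed[OF assms(1)] assms(2) by (intro psi_cnj) simp
  finally show ?thesis .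
qed

lemma phase_sum_shift:
  assumes "x \<in> K" "k \<in> K" "l \<in> K" "m \<in> K" "n \<in> K"
  shows "W (k \<oplus> x) (l \<oplus> x) (m \<oplus> x) (n \<oplus> x) = W k l m n"
  unfolding phase_sum_def
proof (rule sum.cong[OF refl])
  fix i assume i: "i \<in> Q"
  have d: "\<psi> (w \<otimes> (y \<oplus> x)) = \<psi> (w \<otimes> y) * \<psi> (w \<otimes> x)" if "w \<in> K" "y \<in> K" for w y
    using that assms(1) by (simp add: r_distr psi_add)
  have "\<psi> (X i \<otimes> (k \<oplus> x)) * \<psi> (Y i \<otimes> (l \<oplus> x)) * cnj (\<psi> (Z i \<otimes> (m \<oplus> x))) * cnj (\<psi> (V i \<otimes> (n \<oplus> x))) =
    (\<psi> (X i \<otimes> k) * \<psi> (Y i \<otimes> l) * cnj (\<psi> (Z i \<otimes> m)) * cnj (\<psi> (V i \<otimes> n))) *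
    (\<psi> (X i \<otimes> x) * \<psi> (Y i \<otimes> x) * cnj (\<psi> (Z i \<otimes> x)) * cnj (\<psi> (V i \<otimes> x)))"
    using closed[OF i] assms by (simp only: d complex_cnj_mult mult_ac)
  then show "\<psi> (X i \<otimes> (k \<oplus> x)) * \<psi> (Y i \<otimes> (l \<oplus> x)) * cnj (\<psi> (Z i \<otimes> (m \<oplus> x))) * cnj (\<psi> (V i \<otimes> (n \<oplus> x))) =
    \<psi> (X i \<otimes> k) * \<psi> (Y i \<otimes> l) * cnj (\<psi> (Z i \<otimes> m)) * cnj (\<psi> (V i \<otimes> n))"
    unfolding balanced_phase[OF i assms(1)] by (simp only: mult_1_right)
qed

abbreviation "char_sum \<equiv> \<Sum>i\<in>Q. \<eta> (X i) * \<eta> (Y i) * \<eta> (Z i) * \<eta> (V i)"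

lemma char_sum_fourier:
  "of_nat q ^ 2 * of_real char_sum =
    (\<Sum>k\<in>K. \<Sum>l\<in>K. \<Sum>m\<in>K. \<Sum>n\<in>K. of_real (\<eta> k * \<eta> l * \<eta> m * \<eta> n) * W k l m n)"
proof -
  have tw: "of_real (\<eta> x) * gauss_sum = (\<Sum>y\<in>K. of_real (\<eta> y) * \<psi> (x \<otimes> y))"
    "of_real (\<eta> x) * cnj gauss_sum = (\<Sum>y\<in>K. of_real (\<eta> y) * cnj (\<psi> (x \<otimes> y)))" if "x \<in> K" for x
  proof -
    show "of_real (\<eta> x) * gauss_sum = (\<Sum>y\<in>K. of_real (\<eta> y) * \<psi> (x \<otimes> y))"
      using gauss_sum_twist[OF that] by simp
    have "of_real (\<eta> x) * cnj gauss_sum = cnj (of_real (\<eta> x) * gauss_sum)" by simp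
    also have "\<dots> = cnj (\<Sum>y\<in>K. of_real (\<eta> y) * \<psi> (x \<otimes> y))" by (simp only: gauss_sum_twist[OF that])
    finally show "of_real (\<eta> x) * cnj gauss_sum = (\<Sum>y\<in>K. of_real (\<eta> y) * cnj (\<psi> (x \<otimes> y)))"
      by (simp add: cnj_sum)
  qed
  have "of_nat q ^ 2 * complex_of_real char_sum = (gauss_sum * cnj gauss_sum) ^ 2 * of_real char_sum"
    by (simp only: gauss_sum_norm)
  also have "\<dots> = (\<Sum>i\<in>Q. (of_real (\<eta> (X i)) * gauss_sum) * (of_real (\<eta> (Y i)) * gauss_sum) *
      (of_real (\<eta> (Z i)) * cnj gauss_sum) * (of_real (\<eta> (V i)) * cnj gauss_sum))"
    unfolding of_real_sum sum_distrib_left by (intro sum.cong refl) (simp add: power2_eq_square mult_ac)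
  also have "\<dots> = (\<Sum>i\<in>Q. \<Sum>k\<in>K. \<Sum>l\<in>K. \<Sum>m\<in>K. \<Sum>n\<in>K. (of_real (\<eta> k) * \<psi> (X i \<otimes> k)) *
     (of_real (\<eta> l) * \<psi> (Y i \<otimes> l)) * (of_real (\<eta> m) * cnj (\<psi> (Z i \<otimes> m))) * (of_real (\<eta> n) * cnj (\<psi> (V i \<otimes> n))))"
    by (intro sum.cong refl) (simp only: tw closed sum_mult4)
  also have "\<dots> = (\<Sum>i\<in>Q. \<Sum>k\<in>K. \<Sum>l\<in>K. \<Sum>m\<in>K. \<Sum>n\<in>K. of_real (\<eta> k * \<eta> l * \<eta> m * \<eta> n) *
     (\<psi> (X i \<otimes> k) * \<psi> (Y i \<otimes> l) * cnj (\<psi> (Z i \<otimes> m)) * cnj (\<psi> (V i \<otimes> n))))"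
    by (intro sum.cong refl) (simp only: of_real_mult mult_ac)
  also have "\<dots> = (\<Sum>k\<in>K. \<Sum>l\<in>K. \<Sum>m\<in>K. \<Sum>n\<in>K. of_real (\<eta> k * \<eta> l * \<eta> m * \<eta> n) * W k l m n)"
    unfolding phase_sum_def sum_distrib_left by (simp only: sum.swap[of _ K Q])
  finally show ?thesis .
qed

lemma char_sum_correlation:
  "of_nat q ^ 3 * of_real char_sum =
    (\<Sum>k\<in>K. \<Sum>l\<in>K. \<Sum>m\<in>K. \<Sum>n\<in>K. of_real (correlation4 k l m n) * W k l m n)"
proof -
  define f where "f k l m n = of_real (\<eta> k * \<eta> l * \<eta> m * \<eta> n) * W k l m n" for k l m n
  have shift: "(\<Sum>k\<in>K. \<Sum>l\<in>K. \<Sum>m\<in>K. \<Sum>n\<in>K. f k l m n) =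
      (\<Sum>k\<in>K. \<Sum>l\<in>K. \<Sum>m\<in>K. \<Sum>n\<in>K. f (k \<oplus> x) (l \<oplus> x) (m \<oplus> x) (n \<oplus> x))" if x: "x \<in> K" for x
  proof -
    note tr = sum_translate[OF x]
    have "(\<Sum>n\<in>K. f a b c (n \<oplus> x)) = (\<Sum>n\<in>K. f a b c n)" for a b c by (rule tr)
    moreover have "(\<Sum>m\<in>K. \<Sum>n\<in>K. f a b (m \<oplus> x) n) = (\<Sum>m\<in>K. \<Sum>n\<in>K. f a b m n)" for a b by (rule tr)
    moreover have "(\<Sum>l\<in>K. \<Sum>m\<in>K. \<Sum>n\<in>K. f a (l \<oplus> x) m n) = (\<Sum>l\<in>K. \<Sum>m\<in>K. \<Sum>n\<in>K. f a l m n)" for a by (rule tr)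
    moreover have "(\<Sum>k\<in>K. \<Sum>l\<in>K. \<Sum>m\<in>K. \<Sum>n\<in>K. f (k \<oplus> x) l m n) = (\<Sum>k\<in>K. \<Sum>l\<in>K. \<Sum>m\<in>K. \<Sum>n\<in>K. f k l m n)" by (rule tr)
    ultimately show ?thesis by (simp only:)
  qed
  have "of_nat q * (\<Sum>k\<in>K. \<Sum>l\<in>K. \<Sum>m\<in>K. \<Sum>n\<in>K. f k l m n) =
    (\<Sum>x\<in>K. \<Sum>k\<in>K. \<Sum>l\<in>K. \<Sum>m\<in>K. \<Sum>n\<in>K. f k l m n)" by (simp only: sum_constant)
  also have "\<dots> = (\<Sum>x\<in>K. \<Sum>k\<in>K. \<Sum>l\<in>K. \<Sum>m\<in>K. \<Sum>n\<in>K. f (k \<oplus> x) (l \<oplus> x) (m \<oplus> x) (n \<oplus> x))"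
    by (rule sum.cong[OF refl shift])
  also have "\<dots> = (\<Sum>x\<in>K. \<Sum>k\<in>K. \<Sum>l\<in>K. \<Sum>m\<in>K. \<Sum>n\<in>K.
      of_real (\<eta> (x \<oplus> k) * \<eta> (x \<oplus> l) * \<eta> (x \<oplus> m) * \<eta> (x \<oplus> n)) * W k l m n)"
  proof (intro sum.cong refl)
    fix x k l m n assume K: "x \<in> K" "k \<in> K" "l \<in> K" "m \<in> K" "n \<in> K"
    show "f (k \<oplus> x) (l \<oplus> x) (m \<oplus> x) (n \<oplus> x) =
      of_real (\<eta> (x \<oplus> k) * \<eta> (x \<oplus> l) * \<eta> (x \<oplus> m) * \<eta> (x \<oplus> n)) * W k l m n"
      unfolding f_def phase_sum_shift[OF K] unfolding a_comm[OF K(2,1)] a_comm[OF K(3,1)] a_comm[OF K(4,1)] a_comm[OF K(5,1)]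
      by (rule refl)
  qed
  also have "\<dots> = (\<Sum>k\<in>K. \<Sum>l\<in>K. \<Sum>m\<in>K. \<Sum>n\<in>K. \<Sum>x\<in>K.
      of_real (\<eta> (x \<oplus> k) * \<eta> (x \<oplus> l) * \<eta> (x \<oplus> m) * \<eta> (x \<oplus> n)) * W k l m n)"
    by (subst sum.swap, rule sum.cong[OF refl], subst sum.swap, rule sum.cong[OF refl],
        subst sum.swap, rule sum.cong[OF refl], rule sum.swap)
  also have "\<dots> = (\<Sum>k\<in>K. \<Sum>l\<in>K. \<Sum>m\<in>K. \<Sum>n\<in>K. of_real (correlation4 k l m n) * W k l m n)"
    unfolding correlation4_def of_real_sum sum_distrib_right by (rule refl)
  finally have "of_nat q * (of_nat q ^ 2 * complex_of_real char_sum) =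
      (\<Sum>k\<in>K. \<Sum>l\<in>K. \<Sum>m\<in>K. \<Sum>n\<in>K. of_real (correlation4 k l m n) * W k l m n)"
    unfolding char_sum_fourier f_def .
  then show ?thesis by (simp only: power3_eq_cube power2_eq_square mult.assoc)
qed

lemma sum_psi_cnj_mult:
  "x \<in> K \<Longrightarrow> (\<Sum>y\<in>K. cnj (\<psi> (x \<otimes> y))) = of_nat q * of_bool (x = \<zero>)"
  unfolding cnj_sum[symmetric] by (simp add: sum_psi_mult)

lemma sum_psi_diff:
  assumes "x \<in> K" "y \<in> K"
  shows "(\<Sum>k\<in>K. \<psi> (x \<otimes> k) * cnj (\<psi> (y \<otimes> k))) = of_nat q * of_bool (x = y)"
proof -
  have "\<psi> (x \<otimes> k) * cnj (\<psi> (y \<otimes> k)) = \<psi> ((x \<ominus> y) \<otimes> k)" if "k \<in> K" for k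
  proof -
    have "(x \<ominus> y) \<otimes> k = x \<otimes> k \<ominus> y \<otimes> k" using assms that by algebra
    then show ?thesis using assms that by (simp add: psi_diff)
  qed
  then have "(\<Sum>k\<in>K. \<psi> (x \<otimes> k) * cnj (\<psi> (y \<otimes> k))) = (\<Sum>k\<in>K. \<psi> ((x \<ominus> y) \<otimes> k))" by (rule sum.cong[OF refl])
  then show ?thesis using assms by (simp add: sum_psi_mult minus_eq_zero_iff)
qed

lemma sum_psi_sum:
  assumes "x \<in> K" "y \<in> K"
  shows "(\<Sum>k\<in>K. \<psi> (x \<otimes> k) * \<psi> (y \<otimes> k)) = of_nat q * of_bool (x \<oplus> y = \<zero>)"
    and "(\<Sum>k\<in>K. cnj (\<psi> (x \<otimes> k)) * cnj (\<psi> (y \<otimes> k))) = of_nat q * of_bool (x \<oplus> y = \<zero>)"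
proof -
  have e: "\<psi> (x \<otimes> k) * \<psi> (y \<otimes> k) = \<psi> ((x \<oplus> y) \<otimes> k)" if "k \<in> K" for k
    using assms that by (simp add: l_distr psi_add)
  show "(\<Sum>k\<in>K. \<psi> (x \<otimes> k) * \<psi> (y \<otimes> k)) = of_nat q * of_bool (x \<oplus> y = \<zero>)"
    using assms sum_psi_mult[of "x \<oplus> y"] by (simp add: e)
  show "(\<Sum>k\<in>K. cnj (\<psi> (x \<otimes> k)) * cnj (\<psi> (y \<otimes> k))) = of_nat q * of_bool (x \<oplus> y = \<zero>)"
    unfolding complex_cnj_mult[symmetric] using assms sum_psi_cnj_mult[of "x \<oplus> y"] by (simp add: e)
qed

text \<open>Orthogonality in the two free frequencies imposes two conditions on i, each of which
  implies the other by the balance condition, so that one count remains. If all frequencies are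
  equal, every phase is 1.\<close>

lemma phase_sum_diagonals:
  "(\<Sum>k\<in>K. \<Sum>l\<in>K. W k l k l) = of_nat q ^ 2 * of_nat (card {i \<in> Q. X i = Z i})"
  "(\<Sum>k\<in>K. \<Sum>l\<in>K. W k l l k) = of_nat q ^ 2 * of_nat (card {i \<in> Q. X i = V i})"
  "(\<Sum>k\<in>K. \<Sum>l\<in>K. W k k l l) = of_nat q ^ 2 * of_nat (card {i \<in> Q. X i \<oplus> Y i = \<zero>})"
  "(\<Sum>k\<in>K. W k k k k) = of_nat q * of_nat (card Q)"
proof -
  have cnt: "(\<Sum>i\<in>Q. of_nat q * of_bool (P i) * (of_nat q * of_bool (P' i))) = of_nat q ^ 2 * (of_nat (card {i \<in> Q. P i}) :: complex)"
    if "\<And>i. i \<in> Q \<Longrightarrow> P i \<longleftrightarrow> P' i" for P P' :: "'i \<Rightarrow> bool"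
  proof -
    have "(\<Sum>i\<in>Q. of_nat q * of_bool (P i) * (of_nat q * of_bool (P' i))) = (\<Sum>i\<in>Q. of_nat q ^ 2 * (if P i then 1 else (0::complex)))"
      using that by (intro sum.cong refl) (simp add: power2_eq_square)
    also have "\<dots> = of_nat q ^ 2 * of_nat (card {i \<in> Q. P i})"
      unfolding sum_distrib_left[symmetric] using Q by (simp add: sum.If_cases Int_def)
    finally show ?thesis .
  qed
  have cancel: "a \<oplus> b = c \<oplus> d \<Longrightarrow> a = c \<longleftrightarrow> b = d" "a \<oplus> b = c \<oplus> d \<Longrightarrow> a = d \<longleftrightarrow> b = c"
    if "a \<in> K" "b \<in> K" "c \<in> K" "d \<in> K" for a b c d
  proof -
    assume e: "a \<oplus> b = c \<oplus> d"
    have l: "y = z" if "x \<oplus> y = x \<oplus> z" "x \<in> K" "y \<in> K" "z \<in> K" for x y z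
      using that by simp
    show "a = c \<longleftrightarrow> b = d" using e l[of a b d] l[of b a c] that by (metis a_comm)
    show "a = d \<longleftrightarrow> b = c" using e l[of a b c] l[of b a d] that by (metis a_comm)
  qed
  have swap: "(\<Sum>k\<in>K. \<Sum>l\<in>K. \<Sum>i\<in>Q. f i k * g i l) = (\<Sum>i\<in>Q. (\<Sum>k\<in>K. f i k) * (\<Sum>l\<in>K. g i l))" for f g :: "'i \<Rightarrow> 'a \<Rightarrow> complex"
    unfolding sum_product by (simp only: sum.swap[of _ K Q])
  have "(\<Sum>k\<in>K. \<Sum>l\<in>K. W k l k l) =
      (\<Sum>k\<in>K. \<Sum>l\<in>K. \<Sum>i\<in>Q. (\<psi> (X i \<otimes> k) * cnj (\<psi> (Z i \<otimes> k))) * (\<psi> (Y i \<otimes> l) * cnj (\<psi> (V i \<otimes> l))))"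
    unfolding phase_sum_def by (simp only: mult_ac)
  also have "\<dots> = (\<Sum>i\<in>Q. of_nat q * of_bool (X i = Z i) * (of_nat q * of_bool (Y i = V i)))"
    unfolding swap by (intro sum.cong refl) (simp only: sum_psi_diff closed)
  also have "\<dots> = of_nat q ^ 2 * of_nat (card {i \<in> Q. X i = Z i})"
  proof (rule cnt)
    fix i assume i: "i \<in> Q"
    show "X i = Z i \<longleftrightarrow> Y i = V i" using balanced[OF i] closed[OF i] cancel by metis
  qed
  finally show "(\<Sum>k\<in>K. \<Sum>l\<in>K. W k l k l) = of_nat q ^ 2 * of_nat (card {i \<in> Q. X i = Z i})" .
  have "(\<Sum>k\<in>K. \<Sum>l\<in>K. W k l l k) =
      (\<Sum>k\<in>K. \<Sum>l\<in>K. \<Sum>i\<in>Q. (\<psi> (X i \<otimes> k) * cnj (\<psi> (V i \<otimes> k))) * (\<psi> (Y i \<otimes> l) * cnj (\<psi> (Z i \<otimes> l))))"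
    unfolding phase_sum_def by (simp only: mult_ac)
  also have "\<dots> = (\<Sum>i\<in>Q. of_nat q * of_bool (X i = V i) * (of_nat q * of_bool (Y i = Z i)))"
    unfolding swap by (intro sum.cong refl) (simp only: sum_psi_diff closed)
  also have "\<dots> = of_nat q ^ 2 * of_nat (card {i \<in> Q. X i = V i})"
  proof (rule cnt)
    fix i assume i: "i \<in> Q"
    show "X i = V i \<longleftrightarrow> Y i = Z i" using balanced[OF i] closed[OF i] cancel by metis
  qed
  finally show "(\<Sum>k\<in>K. \<Sum>l\<in>K. W k l l k) = of_nat q ^ 2 * of_nat (card {i \<in> Q. X i = V i})" .
  have "(\<Sum>k\<in>K. \<Sum>l\<in>K. W k k l l) =
      (\<Sum>k\<in>K. \<Sum>l\<in>K. \<Sum>i\<in>Q. (\<psi> (X i \<otimes> k) * \<psi> (Y i \<otimes> k)) * (cnj (\<psi> (Z i \<otimes> l)) * cnj (\<psi> (V i \<otimes> l))))"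
    unfolding phase_sum_def by (simp only: mult_ac)
  also have "\<dots> = (\<Sum>i\<in>Q. of_nat q * of_bool (X i \<oplus> Y i = \<zero>) * (of_nat q * of_bool (Z i \<oplus> V i = \<zero>)))"
    unfolding swap by (intro sum.cong refl) (simp only: sum_psi_sum closed)
  also have "\<dots> = of_nat q ^ 2 * of_nat (card {i \<in> Q. X i \<oplus> Y i = \<zero>})"
    by (rule cnt) (simp only: balanced)
  finally show "(\<Sum>k\<in>K. \<Sum>l\<in>K. W k k l l) = of_nat q ^ 2 * of_nat (card {i \<in> Q. X i \<oplus> Y i = \<zero>})" .
  have "(\<Sum>k\<in>K. W k k k k) = (\<Sum>k\<in>K. of_nat (card Q))"
    unfolding phase_sum_def by (intro sum.cong refl) (simp add: balanced_phase)
  then show "(\<Sum>k\<in>K. W k k k k) = of_nat q * of_nat (card Q)" by simp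
qed

lemma sum_pairings_phase:
  "(\<Sum>k\<in>K. \<Sum>l\<in>K. \<Sum>m\<in>K. \<Sum>n\<in>K. of_real (pairings k l m n) * W k l m n) =
     (\<Sum>k\<in>K. \<Sum>l\<in>K. W k k l l) + (\<Sum>k\<in>K. \<Sum>l\<in>K. W k l k l) + (\<Sum>k\<in>K. \<Sum>l\<in>K. W k l l k)
     - 2 * (\<Sum>k\<in>K. W k k k k)"
proof -
  have delta: "(\<Sum>y\<in>K. of_bool (x = y) * f y) = f x" if "x \<in> K" for x and f :: "'a \<Rightarrow> complex"
  proof -
    have "(\<Sum>y\<in>K. of_bool (x = y) * f y) = (\<Sum>y\<in>K. if x = y then f y else 0)"
      by (intro sum.cong refl) simp
    then show ?thesis using that finite_carrier by (simp add: sum.delta)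
  qed
  have 1: "(\<Sum>k\<in>K. \<Sum>l\<in>K. \<Sum>m\<in>K. \<Sum>n\<in>K. of_bool (k = l) * (of_bool (m = n) * W k l m n)) = (\<Sum>k\<in>K. \<Sum>l\<in>K. W k k l l)"
    by (rule sum.cong[OF refl]) (simp only: delta sum_distrib_left[symmetric] cong: sum.cong)
  have 2: "(\<Sum>k\<in>K. \<Sum>l\<in>K. \<Sum>m\<in>K. \<Sum>n\<in>K. of_bool (k = m) * (of_bool (l = n) * W k l m n)) = (\<Sum>k\<in>K. \<Sum>l\<in>K. W k l k l)"
    by (rule sum.cong[OF refl]) (simp only: delta sum_distrib_left[symmetric] cong: sum.cong)
  have 3: "(\<Sum>k\<in>K. \<Sum>l\<in>K. \<Sum>m\<in>K. \<Sum>n\<in>K. of_bool (l = m) * (of_bool (k = n) * W k l m n)) = (\<Sum>k\<in>K. \<Sum>l\<in>K. W k l l k)"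
    by (rule sum.cong[OF refl]) (simp only: delta sum_distrib_left[symmetric] cong: sum.cong)
  have 4: "(\<Sum>k\<in>K. \<Sum>l\<in>K. \<Sum>m\<in>K. \<Sum>n\<in>K. of_bool (k = l) * (of_bool (l = m) * (of_bool (m = n) * W k l m n))) = (\<Sum>k\<in>K. W k k k k)"
    by (rule sum.cong[OF refl]) (simp only: delta sum_distrib_left[symmetric] cong: sum.cong)
  have "of_real (pairings k l m n) * W k l m n = of_bool (k = l) * (of_bool (m = n) * W k l m n) +
     of_bool (k = m) * (of_bool (l = n) * W k l m n) + of_bool (l = m) * (of_bool (k = n) * W k l m n)
     - 2 * (of_bool (k = l) * (of_bool (l = m) * (of_bool (m = n) * W k l m n)))" for k l m n
    unfolding pairings_def of_bool_conj by (simp add: algebra_simps)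
  note eq = this
  have 5: "(\<Sum>k\<in>K. \<Sum>l\<in>K. \<Sum>m\<in>K. \<Sum>n\<in>K. 2 * (of_bool (k = l) * (of_bool (l = m) * (of_bool (m = n) * W k l m n)))) =
      2 * (\<Sum>k\<in>K. W k k k k)"
    unfolding 4[symmetric] by (simp only: sum_distrib_left)
  show ?thesis unfolding eq sum.distrib sum_subtractf 1 2 3 5 by (rule refl)
qed

text \<open>The three pairings give the three counts, and the correction -2 in
  \<open>pairings\<close> gives the term -2 card Q / q. In the application that term has the same
  order q^2 as the counts and becomes the negative term of the limit.\<close>

theorem char_sum_approx:
  "real q ^ 3 * \<bar>char_sum - (real (card {i \<in> Q. X i = Z i}) + real (card {i \<in> Q. X i = V i})
      + real (card {i \<in> Q. X i \<oplus> Y i = \<zero>}) - 2 * real (card Q) / real q)\<bar>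
    \<le> 5 * beta * (\<Sum>k\<in>K. \<Sum>l\<in>K. \<Sum>m\<in>K. \<Sum>n\<in>K. cmod (W k l m n))"
proof -
  define M where "M = real (card {i \<in> Q. X i = Z i}) + real (card {i \<in> Q. X i = V i})
      + real (card {i \<in> Q. X i \<oplus> Y i = \<zero>}) - 2 * real (card Q) / real q"
  have q0: "real q \<noteq> 0" using q_gt_1 by simp
  have "complex_of_real (real q ^ 3 * M) = of_real (real q ^ 3 * (real (card {i \<in> Q. X i = Z i}) + real (card {i \<in> Q. X i = V i})
      + real (card {i \<in> Q. X i \<oplus> Y i = \<zero>})) - 2 * real q ^ 2 * real (card Q))"
    unfolding M_def using q0 by (simp add: field_simps power3_eq_cube power2_eq_square)
  also have "\<dots> = of_nat q * (\<Sum>k\<in>K. \<Sum>l\<in>K. \<Sum>m\<in>K. \<Sum>n\<in>K. of_real (pairings k l m n) * W k l m n)"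
    unfolding sum_pairings_phase phase_sum_diagonals by (simp add: algebra_simps power3_eq_cube power2_eq_square)
  finally have "complex_of_real (real q ^ 3 * (char_sum - M)) =
     (\<Sum>k\<in>K. \<Sum>l\<in>K. \<Sum>m\<in>K. \<Sum>n\<in>K. of_real (correlation4 k l m n - real q * pairings k l m n) * W k l m n)"
    using char_sum_correlation
    by (simp add: right_diff_distrib left_diff_distrib sum_subtractf sum_distrib_left mult.assoc)
  then have "cmod (complex_of_real (real q ^ 3 * (char_sum - M))) \<le>
     (\<Sum>k\<in>K. \<Sum>l\<in>K. \<Sum>m\<in>K. \<Sum>n\<in>K. cmod (of_real (correlation4 k l m n - real q * pairings k l m n) * W k l m n))"
    by (simp only:) (intro order.trans[OF norm_sum] sum_mono order.refl)
  also have "\<dots> \<le> (\<Sum>k\<in>K. \<Sum>l\<in>K. \<Sum>m\<in>K. \<Sum>n\<in>K. 5 * beta * cmod (W k l m n))"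
    unfolding norm_mult norm_of_real by (intro sum_mono mult_right_mono correlation4_bound) simp_all
  finally show ?thesis
    unfolding M_def[symmetric] norm_of_real abs_mult sum_distrib_left[symmetric] by simp
qed

end

end

section \<open>Exponential sums\<close>

definition unit_exp :: "real \<Rightarrow> complex" where "unit_exp x = cis (2 * pi * x)"

lemma unit_exp_add: "unit_exp (x + y) = unit_exp x * unit_exp y"
  by (simp add: unit_exp_def cis_mult distrib_left)

lemma unit_exp_int [simp]: "unit_exp (of_int n) = 1"
  unfolding unit_exp_def by (rule cis_multiple_2pi) simp

lemma unit_exp_0 [simp]: "unit_exp 0 = 1"
  by (simp add: unit_exp_def)

lemma norm_unit_exp [simp]: "cmod (unit_exp x) = 1"
  by (simp add: unit_exp_def)

lemma unit_exp_minus: "unit_exp (- x) = cnj (unit_exp x)"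
  by (simp add: unit_exp_def cis_cnj)

lemma unit_exp_power: "unit_exp x ^ n = unit_exp (real n * x)"
  by (induction n) (simp_all add: unit_exp_add[symmetric] distrib_right)

lemma unit_exp_add_int [simp]: "unit_exp (x + of_int n) = unit_exp x"
  by (simp add: unit_exp_add)

text \<open>By the mean value theorem up to pi / 3, where the cosine is at least 1/2, and by
  monotonicity of the sine beyond. The factor 1/4 affects only constants.\<close>

lemma sin_lower: "0 \<le> x \<Longrightarrow> x \<le> pi / 2 \<Longrightarrow> x / 4 \<le> sin x"
proof (cases "x \<le> pi / 3")
  case True
  assume x: "0 \<le> x" "x \<le> pi / 2"
  show ?thesis
  proof (cases "x = 0")
    case False
    then have "x > 0" using x by simp
    then obtain z where z: "0 < z" "z < x" "sin x - sin 0 = (x - 0) * cos z"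
      using MVT2[of 0 x sin cos] DERIV_sin by blast
    have "cos (pi / 3) \<le> cos z" using z True by (intro cos_monotone_0_pi_le) auto
    then have "x * (1 / 4) \<le> x * cos z" using \<open>x > 0\<close> by (intro mult_left_mono) (auto simp: cos_60)
    then show ?thesis using z by simp
  qed simp
next
  case False
  assume x: "0 \<le> x" "x \<le> pi / 2"
  have "sin (pi / 3) \<le> sin x" using x False by (intro sin_monotone_2pi_le) auto
  moreover have "sqrt 1 \<le> sqrt 3" by (rule real_sqrt_le_mono) simp
  moreover have "x / 4 \<le> 1 / 2" using x pi_less_4 by simp
  moreover have "sqrt 1 = 1" by simp
  ultimately show ?thesis unfolding sin_60 by argo
qed

lemma norm_one_minus_unit_exp:
  "cmod (unit_exp x - 1) = 2 * \<bar>sin (pi * x)\<bar>"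
proof -
  have c: "cos (2 * pi * x) = 1 - 2 * (sin (pi * x))\<^sup>2"
    using cos_double_sin[of "pi * x"] by (simp add: mult.assoc)
  have "(cos (2 * pi * x) - 1)\<^sup>2 + (sin (2 * pi * x))\<^sup>2 =
      ((cos (2 * pi * x))\<^sup>2 + (sin (2 * pi * x))\<^sup>2) + 1 - 2 * cos (2 * pi * x)"
    by (simp add: power2_eq_square algebra_simps)
  also have "\<dots> = 2 - 2 * cos (2 * pi * x)" by simp
  also have "\<dots> = (2 * sin (pi * x))\<^sup>2" unfolding c by (simp add: power2_eq_square)
  finally have "sqrt ((cos (2 * pi * x) - 1)\<^sup>2 + (sin (2 * pi * x))\<^sup>2) = \<bar>2 * sin (pi * x)\<bar>"
    by (simp only: real_sqrt_abs)
  then show ?thesis by (simp add: unit_exp_def cmod_def abs_mult)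
qed

text \<open>The modulus is 2 |sin (pi x)|, and the sine has a linear lower bound on each half of the
  unit interval. A sum of two poles dominates both halves at once, which suits summation over a full
  period.\<close>

lemma norm_unit_exp_minus_one_ge:
  assumes "0 < x" "x < 1"
  shows "1 / cmod (unit_exp x - 1) \<le> 1 / x + 1 / (1 - x)"
proof -
  have key: "1 / (2 * \<bar>sin (pi * y)\<bar>) \<le> 1 / y" if "0 < y" "y \<le> 1 / 2" for y
  proof -
    have "0 \<le> pi * y" "pi * y \<le> pi / 2" using that by auto
    then have "pi * y / 4 \<le> sin (pi * y)" by (rule sin_lower)
    moreover have "2 * y \<le> pi * y" using pi_ge_two that by (intro mult_right_mono) auto
    ultimately have "y \<le> 2 * \<bar>sin (pi * y)\<bar>" using that by linarith
    then show ?thesis using that by (intro divide_left_mono) auto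
  qed
  show ?thesis
  proof (cases "x \<le> 1 / 2")
    case True
    then have "1 / (2 * \<bar>sin (pi * x)\<bar>) \<le> 1 / x" using key assms by simp
    moreover have "1 / (1 - x) \<ge> 0" using assms by simp
    ultimately show ?thesis unfolding norm_one_minus_unit_exp by linarith
  next
    case False
    have "sin (pi * (1 - x)) = sin (pi * x)" by (simp add: right_diff_distrib sin_diff)
    then have "1 / (2 * \<bar>sin (pi * x)\<bar>) \<le> 1 / (1 - x)" using key[of "1 - x"] False assms by simp
    moreover have "1 / x \<ge> 0" using assms by simp
    ultimately show ?thesis unfolding norm_one_minus_unit_exp by linarith
  qed
qed

text \<open>The Dirichlet kernel, up to a phase.\<close>

definition kernel :: "nat \<Rightarrow> real \<Rightarrow> complex" where
  "kernel s x = (\<Sum>a<s. unit_exp (real a * x))"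

lemma kernel_le: "cmod (kernel s x) \<le> real s"
proof -
  have "cmod (kernel s x) \<le> (\<Sum>a<s. cmod (unit_exp (real a * x)))" unfolding kernel_def by (rule norm_sum)
  then show ?thesis by simp
qed

lemma kernel_periodic: "kernel s (x + of_int n) = kernel s x"
proof -
  have "unit_exp (real a * (x + of_int n)) = unit_exp (real a * x)" for a
    using unit_exp_add_int[of "real a * x" "int a * n"] by (simp add: distrib_left)
  then show ?thesis by (simp add: kernel_def)
qed

lemma kernel_le_inverse:
  assumes "0 < x" "x < 1"
  shows "cmod (kernel s x) \<le> 2 * (1 / x + 1 / (1 - x))"
proof -
  have "sin (pi * x) > 0" using assms by (intro sin_gt_zero) auto
  then have ne: "cmod (unit_exp x - 1) > 0" unfolding norm_one_minus_unit_exp by simp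
  then have "unit_exp x \<noteq> 1" by auto
  then have "kernel s x = (unit_exp x ^ s - 1) / (unit_exp x - 1)"
    unfolding kernel_def unit_exp_power[symmetric] by (rule geometric_sum)
  then have "cmod (kernel s x) = cmod (unit_exp x ^ s - 1) * (1 / cmod (unit_exp x - 1))"
    by (simp add: norm_divide)
  also have "\<dots> \<le> 2 * (1 / cmod (unit_exp x - 1))"
  proof (rule mult_right_mono)
    have "cmod (unit_exp x ^ s - 1) \<le> cmod (unit_exp x ^ s) + cmod 1" by (rule norm_triangle_ineq4)
    then show "cmod (unit_exp x ^ s - 1) \<le> 2" by (simp add: norm_power)
  qed simp
  also have "\<dots> \<le> 2 * (1 / x + 1 / (1 - x))"
    using norm_unit_exp_minus_one_ge[OF assms] by simp
  finally show ?thesis .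
qed

lemma harmonic_le: "n \<ge> 1 \<Longrightarrow> (\<Sum>m=1..n. 1 / real m) \<le> 1 + ln (real n)"
proof (induction n rule: nat_induct_at_least)
  case base
  then show ?case by simp
next
  case (Suc n)
  have "ln (real n / real (Suc n)) \<le> real n / real (Suc n) - 1"
    using Suc by (intro ln_le_minus_one) simp
  moreover have "real n / real (Suc n) - 1 = - (1 / real (Suc n))" by (simp add: field_simps)
  moreover have "ln (real n / real (Suc n)) = ln (real n) - ln (real (Suc n))"
    using Suc by (simp add: ln_div)
  ultimately have "1 / real (Suc n) \<le> ln (real (Suc n)) - ln (real n)" by linarith
  then show ?case using Suc by (simp del: of_nat_Suc)
qed

lemma sum_int_periodic:
  fixes g :: "int \<Rightarrow> real"
  assumes "p > 0" "\<And>j. g (j mod int p) = g j"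
  shows "(\<Sum>m<p. g (int m + c)) = (\<Sum>m<p. g (int m))"
proof (rule sum.reindex_bij_witness[of _ "\<lambda>m. nat ((int m - c) mod int p)" "\<lambda>m. nat ((int m + c) mod int p)"])
  fix m assume "m \<in> {..<p}"
  then show "nat ((int (nat ((int m + c) mod int p)) - c) mod int p) = m"
    "nat ((int (nat ((int m - c) mod int p)) + c) mod int p) = m"
    using assms(1) by (simp_all add: mod_simps)
  show "nat ((int m + c) mod int p) \<in> {..<p}" "nat ((int m - c) mod int p) \<in> {..<p}"
    using assms(1) by (simp_all add: nat_less_iff)
  show "g (int (nat ((int m + c) mod int p))) = g (int m + c)"
    using assms by simp
qed

text \<open>Uniform in t, since it is applied with the shifts u / \<open>period\<close>. The
  residues m = 0 and m = p - 1, nearest to the integers, take the trivial bound s, and the others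
  lead to two harmonic sums.\<close>

lemma kernel_sum_bound:
  assumes "p \<ge> 1"
  shows "(\<Sum>m<p. cmod (kernel s (real m / real p + t))) \<le> 2 * real s + 4 * real p * (1 + ln (real p))"
proof -
  \<comment> \<open>The integer part of p t only permutes the residues; an offset \<phi> / p with 0
    \<le> \<phi> < 1 remains.\<close>
  define c where "c = \<lfloor>real p * t\<rfloor>"
  define \<phi> where "\<phi> = real p * t - of_int c"
  have phi: "0 \<le> \<phi>" "\<phi> < 1" unfolding \<phi>_def c_def by linarith+
  have p: "real p > 0" using assms by simp
  define g where "g j = cmod (kernel s ((of_int j + \<phi>) / real p))" for j :: int
  have per: "g (j mod int p) = g j" for j
  proof -
    have "of_int j = real p * of_int (j div int p) + real_of_int (j mod int p)"
      by (metis mult_div_mod_eq of_int_add of_int_mult of_int_of_nat_eq)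
    then have "(of_int j + \<phi>) / real p = (of_int (j mod int p) + \<phi>) / real p + of_int (j div int p)"
      using p by (simp add: field_simps)
    then show ?thesis unfolding g_def by (simp only: kernel_periodic)
  qed
  have t: "t = (of_int c + \<phi>) / real p" using p by (simp add: \<phi>_def)
  have "(\<Sum>m<p. cmod (kernel s (real m / real p + t))) = (\<Sum>m<p. g (int m + c))"
    unfolding g_def t by (intro sum.cong refl) (simp add: add_divide_distrib add.assoc)
  also have "\<dots> = (\<Sum>m<p. g (int m))" using assms per by (intro sum_int_periodic) auto
  also have "\<dots> \<le> (\<Sum>m<p. real s * of_bool (m = 0) + real s * of_bool (m = p - 1)
      + 2 * real p * (if m = 0 then 0 else 1 / real m) + 2 * real p * (if m = p - 1 then 0 else 1 / real (p - 1 - m)))"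
  proof (rule sum_mono)
    fix m assume m: "m \<in> {..<p}"
    have nn: "0 \<le> 2 * real p * (if m = 0 then 0 else 1 / real m)"
      "0 \<le> 2 * real p * (if m = p - 1 then 0 else 1 / real (p - 1 - m))" by auto
    show "g (int m) \<le> real s * of_bool (m = 0) + real s * of_bool (m = p - 1)
      + 2 * real p * (if m = 0 then 0 else 1 / real m) + 2 * real p * (if m = p - 1 then 0 else 1 / real (p - 1 - m))"
    proof (cases "m = 0 \<or> m = p - 1")
      case True
      have "g (int m) \<le> real s" unfolding g_def by (rule kernel_le)
      also have "real s \<le> real s * of_bool (m = 0) + real s * of_bool (m = p - 1)" using True by auto
      finally show ?thesis using nn by linarith
    next
      case False
      then have m': "0 < m" "m < p - 1" using m by auto
      define x where "x = (real m + \<phi>) / real p"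
      have rm: "real (p - 1 - m) = real p - 1 - real m" using m' by (simp add: of_nat_diff)
      have m1: "real m \<ge> 1" "real m + 1 < real p" using m' by linarith+
      have x: "real m / real p \<le> x" "real (p - 1 - m) / real p \<le> 1 - x"
        unfolding x_def rm using p phi by (simp_all add: field_simps)
      have pos: "0 < real m / real p" "0 < real (p - 1 - m) / real p" using m' p by simp_all
      have "g (int m) \<le> 2 * (1 / x + 1 / (1 - x))"
        unfolding g_def of_int_of_nat_eq x_def[symmetric] using x pos by (intro kernel_le_inverse) linarith+
      also have "\<dots> \<le> 2 * (1 / (real m / real p) + 1 / (real (p - 1 - m) / real p))"
        using x pos by (intro mult_left_mono add_mono divide_left_mono mult_pos_pos) linarith+
      also have "\<dots> = 2 * real p * (1 / real m) + 2 * real p * (1 / real (p - 1 - m))" by simp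
      finally show ?thesis using False by simp
    qed
  qed
  also have "\<dots> = real s * (\<Sum>m<p. of_bool (m = 0)) + real s * (\<Sum>m<p. of_bool (m = p - 1))
      + 2 * real p * (\<Sum>m<p. if m = 0 then 0 else 1 / real m)
      + 2 * real p * (\<Sum>m<p. if m = p - 1 then 0 else 1 / real (p - 1 - m))"
    by (simp only: sum.distrib sum_distrib_left)
  also have "(\<Sum>m<p. if m = p - 1 then 0 else 1 / real (p - 1 - m)) = (\<Sum>m<p. if m = 0 then 0 else 1 / real m)"
  proof -
    have "(\<Sum>m<p. if m = p - 1 then 0 else 1 / real (p - 1 - m)) =
        (\<Sum>m<p. (\<lambda>k. if k = 0 then 0 else 1 / real k) (p - Suc m))"
      by (intro sum.cong refl) auto
    also have "\<dots> = (\<Sum>m<p. if m = 0 then 0 else 1 / real m)" by (rule sum.nat_diff_reindex)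
    finally show ?thesis .
  qed
  also have "(\<Sum>m<p. of_bool (m = 0)) = (1::real)" using assms by (simp add: of_bool_def sum.delta)
  also have "(\<Sum>m<p. of_bool (m = p - 1)) = (1::real)" using assms by (simp add: of_bool_def sum.delta)
  also have "real s * 1 + real s * 1 + 2 * real p * (\<Sum>m<p. if m = 0 then 0 else 1 / real m)
      + 2 * real p * (\<Sum>m<p. if m = 0 then 0 else 1 / real m) =
      2 * real s + 4 * real p * (\<Sum>m<p. if m = 0 then 0 else 1 / real m)" by simp
  also have "\<dots> \<le> 2 * real s + 4 * real p * (1 + ln (real p))"
  proof -
    have "(\<Sum>m<p. if m = 0 then 0 else 1 / real m) \<le> (\<Sum>m=1..p. 1 / real m)"
    proof -
      have "(\<Sum>m<p. if m = 0 then 0 else 1 / real m) = (\<Sum>m\<in>{1..<p}. 1 / real m)"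
        by (rule sum.mono_neutral_cong_right) auto
      also have "\<dots> \<le> (\<Sum>m=1..p. 1 / real m)" by (rule sum_mono2) auto
      finally show ?thesis .
    qed
    then show ?thesis using harmonic_le[OF assms] p by simp
  qed
  finally show ?thesis .
qed

lemma sum_unit_exp_roots:
  assumes "M > 0" "\<bar>n\<bar> < int M"
  shows "(\<Sum>t<M. unit_exp (real t * of_int n / real M)) = of_nat M * of_bool (n = 0)"
proof (cases "n = 0")
  case False
  define z where "z = unit_exp (of_int n / real M)"
  have M: "real M > 0" using assms by simp
  have zM: "z ^ M = 1" unfolding z_def unit_exp_power using M by simp
  have "z \<noteq> 1"
  proof
    assume "z = 1"
    then have "sin (pi * (of_int n / real M)) = 0"
      using norm_one_minus_unit_exp[of "of_int n / real M"] by (simp add: z_def)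
    then obtain i :: int where i: "pi * (of_int n / real M) = of_int i * pi" using sin_zero_iff_int2 by blast
    then have "pi * (of_int n / real M) = pi * of_int i" by (simp only: mult.commute)
    then have "of_int n / real M = of_int i" by (rule mult_left_cancel[THEN iffD1, rotated]) simp
    then have "real_of_int n = of_int (i * int M)" using M by (simp add: field_simps)
    then have n: "n = i * int M" by linarith
    then have "i \<noteq> 0" using False by auto
    then have "1 * int M \<le> \<bar>i\<bar> * int M" by (intro mult_right_mono) auto
    then show False using assms n by (simp add: abs_mult)
  qed
  have "(\<Sum>t<M. unit_exp (real t * of_int n / real M)) = (\<Sum>t<M. z ^ t)"
    unfolding z_def unit_exp_power by simp
  also have "\<dots> = (z ^ M - 1) / (z - 1)" using \<open>z \<noteq> 1\<close> by (rule geometric_sum)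
  finally show ?thesis using zM False by simp
qed simp

section \<open>Norms on the torus\<close>

lemma integral_cis_multiple:
  fixes n :: int
  shows "has_bochner_integral lborel (\<lambda>t. indicat_real {0..2 * pi} t *\<^sub>R cis (of_int n * t))
    (of_real (2 * pi) * of_bool (n = 0))"
proof (cases "n = 0")
  case True
  have "has_bochner_integral lborel (\<lambda>t. indicat_real {0..2 * pi} t *\<^sub>R (1::complex))
    (of_real (2 * pi) - of_real 0)"
    by (rule has_bochner_integral_FTC_Icc) (auto intro!: derivative_eq_intros continuous_intros has_vector_derivative_of_real)
  then show ?thesis using True by simp
next
  case False
  let ?F = "\<lambda>t. cis (of_int n * t) / (\<i> * of_int n)"
  have "has_bochner_integral lborel (\<lambda>t. indicat_real {0..2 * pi} t *\<^sub>R cis (of_int n * t)) (?F (2 * pi) - ?F 0)"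
  proof (rule has_bochner_integral_FTC_Icc)
    fix t :: real
    have "((\<lambda>z. exp (\<i> * of_int n * z) / (\<i> * of_int n)) has_field_derivative
        exp (\<i> * of_int n * of_real t)) (at (of_real t))"
      using False by (auto intro!: derivative_eq_intros)
    from has_vector_derivative_real_field[OF this]
    show "(?F has_vector_derivative cis (of_int n * t)) (at t within {0..2 * pi})"
      by (simp add: cis_conv_exp mult.assoc)
  qed (auto intro!: continuous_intros)
  moreover have "cis (of_int n * (2 * pi)) = 1"
    using cis_multiple_2pi[of "of_int n"] by (simp add: mult.commute)
  ultimately show ?thesis using False by simp
qed

abbreviation torus :: "nat \<Rightarrow> (nat \<Rightarrow> real) set" where
  "torus e \<equiv> \<Pi>\<^sub>E k\<in>{1..e}. {0..2 * pi}"

abbreviation torus_measure :: "nat \<Rightarrow> (nat \<Rightarrow> real) measure" where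
  "torus_measure e \<equiv> \<Pi>\<^sub>M k\<in>{1..e}. lborel"

lemma torus_monomial:
  fixes n :: "nat \<Rightarrow> int"
  shows "has_bochner_integral (torus_measure e)
    (\<lambda>\<theta>. indicat_real (torus e) \<theta> *\<^sub>R (\<Prod>k\<in>{1..e}. cis (of_int (n k) * \<theta> k)))
    (of_real ((2 * pi) ^ e) * of_bool (\<forall>k\<in>{1..e}. n k = 0))"
proof -
  interpret product_sigma_finite "\<lambda>_::nat. lborel :: real measure" by standard
  let ?h = "\<lambda>k t. indicat_real {0..2 * pi} t *\<^sub>R cis (of_int (n k) * t)"
  have i: "integrable lborel (?h k)" for k
    using integral_cis_multiple[of "n k"] by (simp add: has_bochner_integral_iff)
  have v: "integral\<^sup>L lborel (?h k) = of_real (2 * pi) * of_bool (n k = 0)" for k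
    using integral_cis_multiple[of "n k"] by (simp add: has_bochner_integral_iff)
  have "integrable (torus_measure e) (\<lambda>\<theta>. \<Prod>k\<in>{1..e}. ?h k (\<theta> k))"
    by (rule product_integrable_prod) (auto intro: i)
  moreover have "integral\<^sup>L (torus_measure e) (\<lambda>\<theta>. \<Prod>k\<in>{1..e}. ?h k (\<theta> k)) =
      (\<Prod>k\<in>{1..e}. of_real (2 * pi) * of_bool (n k = 0))"
    by (subst product_integral_prod) (auto intro: i simp only: v)
  moreover have "(\<Prod>k\<in>{1..e}. of_real (2 * pi) * of_bool (n k = 0)) =
      (of_real ((2 * pi) ^ e) * of_bool (\<forall>k\<in>{1..e}. n k = 0) :: complex)"
  proof (cases "\<forall>k\<in>{1..e}. n k = 0")
    case False
    then obtain k where "k \<in> {1..e}" "n k \<noteq> 0" by blast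
    then show ?thesis using False by (subst prod_zero) auto
  qed simp
  ultimately have "has_bochner_integral (torus_measure e) (\<lambda>\<theta>. \<Prod>k\<in>{1..e}. ?h k (\<theta> k))
      (of_real ((2 * pi) ^ e) * of_bool (\<forall>k\<in>{1..e}. n k = 0))"
    by (simp only: has_bochner_integral_iff)
  then show ?thesis
  proof (rule has_bochner_integral_cong[THEN iffD1, rotated 3])
    fix \<theta> assume "\<theta> \<in> space (torus_measure e)"
    then have ext: "\<theta> \<in> extensional {1..e}" by (simp add: space_PiM PiE_def)
    have "(\<Prod>k\<in>{1..e}. indicat_real {0..2 * pi} (\<theta> k)) = indicat_real (torus e) \<theta>"
    proof (cases "\<theta> \<in> torus e")
      case True
      then have "\<forall>k\<in>{1..e}. indicat_real {0..2 * pi} (\<theta> k) = 1" by (auto simp: PiE_iff)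
      then show ?thesis using True by (subst prod.neutral) auto
    next
      case False
      then obtain k where "k \<in> {1..e}" "\<theta> k \<notin> {0..2 * pi}" using ext unfolding PiE_iff by blast
      then have "(\<Prod>k\<in>{1..e}. indicat_real {0..2 * pi} (\<theta> k)) = 0"
        by (intro prod_zero) (auto intro!: bexI[of _ k])
      then show ?thesis using False by simp
    qed
    then show "(\<Prod>k\<in>{1..e}. ?h k (\<theta> k)) =
      indicat_real (torus e) \<theta> *\<^sub>R (\<Prod>k\<in>{1..e}. cis (of_int (n k) * \<theta> k))"
      unfolding scaleR_conv_of_real prod.distrib of_real_prod[symmetric] by (simp only:)
  qed auto
qed

text \<open>Averaging extracts the constant term, so that moments become sums over the solutions of
  N = 0.\<close>

lemma torus_average:
  fixes N :: "'t \<Rightarrow> nat \<Rightarrow> int"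
  assumes "finite T" and
    F: "\<And>\<theta>. complex_of_real (F \<theta>) = (\<Sum>t\<in>T. C t * (\<Prod>k\<in>{1..e}. cis (of_int (N t k) * \<theta> k)))"
  shows "complex_of_real (1 / (2 * pi) ^ e * (LINT \<theta>:torus e|torus_measure e. F \<theta>)) =
    (\<Sum>t\<in>T. C t * of_bool (\<forall>k\<in>{1..e}. N t k = 0))"
proof -
  have "has_bochner_integral (torus_measure e)
    (\<lambda>\<theta>. \<Sum>t\<in>T. C t * (indicat_real (torus e) \<theta> *\<^sub>R (\<Prod>k\<in>{1..e}. cis (of_int (N t k) * \<theta> k))))
    (\<Sum>t\<in>T. C t * (of_real ((2 * pi) ^ e) * of_bool (\<forall>k\<in>{1..e}. N t k = 0)))"
    by (intro has_bochner_integral_sum has_bochner_integral_mult_right torus_monomial)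
  moreover have "(\<Sum>t\<in>T. C t * (indicat_real (torus e) \<theta> *\<^sub>R (\<Prod>k\<in>{1..e}. cis (of_int (N t k) * \<theta> k)))) =
      complex_of_real (indicat_real (torus e) \<theta> *\<^sub>R F \<theta>)" for \<theta>
  proof -
    have "complex_of_real (indicat_real (torus e) \<theta> *\<^sub>R F \<theta>) = indicat_real (torus e) \<theta> *\<^sub>R complex_of_real (F \<theta>)"
      by (simp add: scaleR_conv_of_real)
    then show ?thesis unfolding F scaleR_sum_right by (simp only: mult_scaleR_right)
  qed
  ultimately have "has_bochner_integral (torus_measure e) (\<lambda>\<theta>. complex_of_real (indicat_real (torus e) \<theta> *\<^sub>R F \<theta>))
    (\<Sum>t\<in>T. C t * (of_real ((2 * pi) ^ e) * of_bool (\<forall>k\<in>{1..e}. N t k = 0)))"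
    by (simp only:)
  then have "complex_of_real (LINT \<theta>:torus e|torus_measure e. F \<theta>) =
    (\<Sum>t\<in>T. C t * (of_real ((2 * pi) ^ e) * of_bool (\<forall>k\<in>{1..e}. N t k = 0)))"
    unfolding set_lebesgue_integral_def integral_complex_of_real[symmetric]
    by (rule has_bochner_integral_integral_eq)
  also have "\<dots> = of_real ((2 * pi) ^ e) * (\<Sum>t\<in>T. C t * of_bool (\<forall>k\<in>{1..e}. N t k = 0))"
    unfolding sum_distrib_left by (intro sum.cong refl) (simp only: mult_ac)
  finally have eq: "complex_of_real (LINT \<theta>:torus e|torus_measure e. F \<theta>) =
    of_real ((2 * pi) ^ e) * (\<Sum>t\<in>T. C t * of_bool (\<forall>k\<in>{1..e}. N t k = 0))" .
  have ne: "complex_of_real ((2 * pi) ^ e) \<noteq> 0" by simp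
  have "complex_of_real (1 / (2 * pi) ^ e * (LINT \<theta>:torus e|torus_measure e. F \<theta>)) =
    complex_of_real (LINT \<theta>:torus e|torus_measure e. F \<theta>) / of_real ((2 * pi) ^ e)"
    by simp
  then show ?thesis unfolding eq using ne by (simp only: nonzero_mult_div_cancel_left not_False_eq_True)
qed

lemma cis_prod_power:
  "(\<Prod>k\<in>{1..e}. exp (\<i> * complex_of_real (\<theta> k)) ^ j k) = (\<Prod>k\<in>{1..e}. cis (of_int (int (j k)) * \<theta> k))"
proof (rule prod.cong[OF refl])
  fix k
  show "exp (\<i> * complex_of_real (\<theta> k)) ^ j k = cis (of_int (int (j k)) * \<theta> k)"
    unfolding exp_of_nat_mult[symmetric] cis_conv_exp by (simp add: mult_ac)
qed

lemma torus_norm_powr: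
  assumes "r > 0"
  shows "torus_norm e (real r) g ^ r = 1 / (2 * pi) ^ e *
    (LINT \<theta>:torus e|torus_measure e. cmod (g (\<lambda>k. exp (\<i> * complex_of_real (\<theta> k)))) ^ r)"
proof -
  have p: "cmod z powr real r = cmod z ^ r" for z
    using assms by (cases "z = 0") (simp_all add: powr_realpow)
  define J where "J = 1 / (2 * pi) ^ e *
    (LINT \<theta>:torus e|torus_measure e. cmod (g (\<lambda>k. exp (\<i> * complex_of_real (\<theta> k)))) ^ r)"
  have "J \<ge> 0" unfolding J_def set_lebesgue_integral_def
    by (intro mult_nonneg_nonneg integral_nonneg_AE) auto
  moreover have "torus_norm e (real r) g = J powr (1 / real r)"
    unfolding torus_norm_def J_def p ..
  ultimately have "torus_norm e (real r) g ^ r = J"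
    using assms by (cases "J = 0") (simp_all add: powr_realpow[symmetric] powr_powr)
  then show ?thesis by (simp only: J_def)
qed

definition trig_poly :: "nat \<Rightarrow> (nat \<Rightarrow> nat) set \<Rightarrow> ((nat \<Rightarrow> nat) \<Rightarrow> real) \<Rightarrow> (nat \<Rightarrow> complex) \<Rightarrow> complex" where
  "trig_poly e S c z = (\<Sum>j\<in>S. of_real (c j) * (\<Prod>k\<in>{1..e}. z k ^ j k))"

lemma torus_norm_2:
  assumes "finite S"
  shows "torus_norm e 2 (trig_poly e S c) ^ 2 =
    (\<Sum>a\<in>S. \<Sum>b\<in>S. c a * c b * of_bool (\<forall>k\<in>{1..e}. a k = b k))"
proof -
  let ?P = "\<lambda>j \<theta>. \<Prod>k\<in>{1..e}. cis (of_int (int (j k)) * \<theta> k)"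
  have P: "?P a \<theta> * cnj (?P b \<theta>) = (\<Prod>k\<in>{1..e}. cis (of_int (int (a k) - int (b k)) * \<theta> k))" for a b \<theta>
    unfolding cnj_prod prod.distrib[symmetric] cis_cnj cis_mult by (intro prod.cong refl) (simp add: algebra_simps)
  have "complex_of_real (1 / (2 * pi) ^ e * (LINT \<theta>:torus e|torus_measure e.
       cmod (trig_poly e S c (\<lambda>k. exp (\<i> * complex_of_real (\<theta> k)))) ^ 2)) =
     (\<Sum>t\<in>S \<times> S. of_real (c (fst t) * c (snd t)) * of_bool (\<forall>k\<in>{1..e}. int (fst t k) - int (snd t k) = 0))"
  proof (rule torus_average)
    fix \<theta> :: "nat \<Rightarrow> real"
    have "complex_of_real (cmod (trig_poly e S c (\<lambda>k. exp (\<i> * complex_of_real (\<theta> k)))) ^ 2) =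
       (\<Sum>a\<in>S. of_real (c a) * ?P a \<theta>) * cnj (\<Sum>b\<in>S. of_real (c b) * ?P b \<theta>)"
      unfolding complex_norm_square trig_poly_def cis_prod_power by (rule refl)
    also have "\<dots> = (\<Sum>a\<in>S. \<Sum>b\<in>S. (of_real (c a) * of_real (c b)) * (?P a \<theta> * cnj (?P b \<theta>)))"
      unfolding cnj_sum sum_product complex_cnj_mult complex_cnj_complex_of_real by (simp only: mult_ac)
    also have "\<dots> = (\<Sum>t\<in>S \<times> S. of_real (c (fst t) * c (snd t)) *
        (\<Prod>k\<in>{1..e}. cis (of_int (int (fst t k) - int (snd t k)) * \<theta> k)))"
      unfolding P by (simp only: sum.cartesian_product split_def of_real_mult)
    finally show "complex_of_real (cmod (trig_poly e S c (\<lambda>k. exp (\<i> * complex_of_real (\<theta> k)))) ^ 2) =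
      (\<Sum>t\<in>S \<times> S. of_real (c (fst t) * c (snd t)) *
        (\<Prod>k\<in>{1..e}. cis (of_int (int (fst t k) - int (snd t k)) * \<theta> k)))" .
  qed (use assms in simp)
  also have "\<dots> = complex_of_real (\<Sum>a\<in>S. \<Sum>b\<in>S. c a * c b * of_bool (\<forall>k\<in>{1..e}. a k = b k))"
  proof -
    have "complex_of_real (of_bool b) = of_bool b" for b by simp
    then show ?thesis by (simp add: sum.cartesian_product split_def)
  qed
  finally show ?thesis
    using torus_norm_powr[of 2 e "trig_poly e S c"] unfolding of_real_eq_iff by simp
qed

lemma torus_norm_4:
  assumes "finite S"
  shows "torus_norm e 4 (trig_poly e S c) ^ 4 =
    (\<Sum>a\<in>S. \<Sum>b\<in>S. \<Sum>a'\<in>S. \<Sum>b'\<in>S. c a * c b * c a' * c b' * of_bool (\<forall>k\<in>{1..e}. a k + b k = a' k + b' k))"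
proof -
  let ?P = "\<lambda>j \<theta>. \<Prod>k\<in>{1..e}. cis (of_int (int (j k)) * \<theta> k)"
  have P: "?P a \<theta> * ?P b \<theta> * cnj (?P a' \<theta>) * cnj (?P b' \<theta>) =
      (\<Prod>k\<in>{1..e}. cis (of_int (int (a k) + int (b k) - int (a' k) - int (b' k)) * \<theta> k))" for a b a' b' \<theta>
    unfolding cnj_prod prod.distrib[symmetric] cis_cnj cis_mult by (intro prod.cong refl) (simp add: algebra_simps)
  let ?C = "\<lambda>(a, b, a', b'). complex_of_real (c a * c b * c a' * c b')"
  let ?N = "\<lambda>(a, b, a', b') k. int (a k) + int (b k) - int (a' k) - int (b' k)"
  have "complex_of_real (1 / (2 * pi) ^ e * (LINT \<theta>:torus e|torus_measure e.
       cmod (trig_poly e S c (\<lambda>k. exp (\<i> * complex_of_real (\<theta> k)))) ^ 4)) =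
     (\<Sum>t\<in>S \<times> S \<times> S \<times> S. ?C t * of_bool (\<forall>k\<in>{1..e}. ?N t k = 0))"
  proof (rule torus_average)
    fix \<theta> :: "nat \<Rightarrow> real"
    let ?f = "trig_poly e S c (\<lambda>k. exp (\<i> * complex_of_real (\<theta> k)))"
    have "complex_of_real (cmod ?f ^ 4) = (?f * cnj ?f) ^ 2"
      unfolding complex_norm_square[symmetric] by (simp only: power_mult[symmetric] of_real_power) simp
    also have "\<dots> = ?f * ?f * cnj ?f * cnj ?f" by (simp add: power2_eq_square mult_ac)
    also have "\<dots> = (\<Sum>a\<in>S. of_real (c a) * ?P a \<theta>) * (\<Sum>a\<in>S. of_real (c a) * ?P a \<theta>) *
       (\<Sum>a\<in>S. of_real (c a) * cnj (?P a \<theta>)) * (\<Sum>a\<in>S. of_real (c a) * cnj (?P a \<theta>))"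
      unfolding trig_poly_def cis_prod_power cnj_sum complex_cnj_mult complex_cnj_complex_of_real by (rule refl)
    also have "\<dots> = (\<Sum>a\<in>S. \<Sum>b\<in>S. \<Sum>a'\<in>S. \<Sum>b'\<in>S. of_real (c a * c b * c a' * c b') *
       (?P a \<theta> * ?P b \<theta> * cnj (?P a' \<theta>) * cnj (?P b' \<theta>)))"
      unfolding sum_mult4 by (simp only: of_real_mult mult_ac)
    also have "\<dots> = (\<Sum>t\<in>S \<times> S \<times> S \<times> S. ?C t * (\<Prod>k\<in>{1..e}. cis (of_int (?N t k) * \<theta> k)))"
      unfolding P by (simp only: sum.cartesian_product split_def fst_conv snd_conv)
    finally show "complex_of_real (cmod ?f ^ 4) =
      (\<Sum>t\<in>S \<times> S \<times> S \<times> S. ?C t * (\<Prod>k\<in>{1..e}. cis (of_int (?N t k) * \<theta> k)))" .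
  qed (use assms in simp)
  also have "\<dots> = (\<Sum>a\<in>S. \<Sum>b\<in>S. \<Sum>a'\<in>S. \<Sum>b'\<in>S. complex_of_real (c a * c b * c a' * c b') *
      of_bool (\<forall>k\<in>{1..e}. int (a k) + int (b k) - int (a' k) - int (b' k) = 0))"
    by (simp only: sum.cartesian_product split_def fst_conv snd_conv)
  also have "\<dots> = complex_of_real (\<Sum>a\<in>S. \<Sum>b\<in>S. \<Sum>a'\<in>S. \<Sum>b'\<in>S. c a * c b * c a' * c b' *
      of_bool (\<forall>k\<in>{1..e}. a k + b k = a' k + b' k))"
  proof -
    have "(\<forall>k\<in>{1..e}. int (a k) + int (b k) - int (a' k) - int (b' k) = 0) \<longleftrightarrow>
        (\<forall>k\<in>{1..e}. a k + b k = a' k + b' k)" for a b a' b' :: "nat \<Rightarrow> nat"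
      by (intro ball_cong refl) linarith
    moreover have "complex_of_real (of_bool b) = of_bool b" for b by simp
    ultimately show ?thesis by (simp only: of_real_sum of_real_mult)
  qed
  finally show ?thesis
    using torus_norm_powr[of 4 e "trig_poly e S c"] unfolding of_real_eq_iff by simp
qed

section \<open>Lattice point counts\<close>

text \<open>Near the limit one fixed window of indices carries all nonzero terms, so only a finite
  sum has to converge. N is chosen for the slope x / 2 and the offset |y| + 1, which eventually
  bound X from below and |Y| from above.\<close>

lemma tendsto_\<Omega>:
  assumes "(X \<longlongrightarrow> x) F" "(Y \<longlongrightarrow> y) F" "x > 0"
  shows "((\<lambda>i. \<Omega> (X i) (Y i)) \<longlongrightarrow> \<Omega> x y) F"
proof -
  obtain N :: nat where N: "x / 2 * real N \<ge> 2 + \<bar>y\<bar>"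
    by (rule exists_large_multiple[OF half_gt_zero[OF assms(3)]])
  have limit: "\<Omega> x y = (\<Sum>n\<in>{- int N..int N}. hat (x * of_int n - y))"
  proof (rule \<Omega>_eq_sum_symmetric)
    have "x / 2 * real N \<le> x * real N" using assms(3) by (intro mult_right_mono) auto
    then show "1 + \<bar>y\<bar> \<le> x * real N" using N by linarith
  qed (rule assms(3))
  have "((\<lambda>i. \<Sum>n\<in>{- int N..int N}. hat (X i * of_int n - Y i)) \<longlongrightarrow> \<Omega> x y) F"
    unfolding limit hat_def by (intro tendsto_intros assms)
  moreover have "\<forall>\<^sub>F i in F. \<Omega> (X i) (Y i) = (\<Sum>n\<in>{- int N..int N}. hat (X i * of_int n - Y i))"
  proof -
    have "\<forall>\<^sub>F i in F. X i > x / 2" using assms(1,3) by (intro order_tendstoD) auto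
    moreover have "\<forall>\<^sub>F i in F. \<bar>Y i\<bar> < \<bar>y\<bar> + 1"
      using tendsto_rabs[OF assms(2)] by (intro order_tendstoD) auto
    ultimately show ?thesis
    proof eventually_elim
      case (elim i)
      have "x / 2 * real N \<le> X i * real N" using elim by (intro mult_right_mono) auto
      then have "1 + \<bar>Y i\<bar> \<le> X i * real N" using N elim by linarith
      then show ?case using elim assms(3) by (intro \<Omega>_eq_sum_symmetric) auto
    qed
  qed
  ultimately show ?thesis by (simp cong: tendsto_cong)
qed

text \<open>Moving each positive point x (m + 1) half a step toward 0 increases \<open>hat\<close>,
  and the moved points form a midpoint sum. With \<open>\<Omega>_0_ge\<close> this gives the
  asymptotics for x -> 0.\<close>

lemma \<Omega>_0_upper:
  assumes "x > 0"
  shows "\<Omega> x 0 \<le> 1 + 2 / (3 * x)"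
proof -
  obtain N where N: "x * real N \<ge> 1" using exists_large_multiple[OF assms] .
  have "(\<Sum>m<N. hat (x * real m)) = 1 + (\<Sum>m<N. hat (x * real (Suc m)))"
  proof -
    have "(\<Sum>m<Suc N. hat (x * real m)) = hat (x * real 0) + (\<Sum>m<N. hat (x * real (Suc m)))"
      by (rule sum.lessThan_Suc_shift)
    moreover have "hat (x * real N) = 0" using N by (intro hat_eq_0) simp
    moreover have "hat (x * real 0) = 1" by (simp add: hat_def)
    ultimately show ?thesis by simp
  qed
  then have "\<Omega> x 0 = 1 + (\<Sum>m<N. 2 * hat (x * real (Suc m)))"
    using \<Omega>_pairs[of x 0 N] assms N by (simp add: sum.distrib sum_distrib_left[symmetric])
  also have "\<dots> \<le> 1 + (\<Sum>m<N. 2 * hat (x * (real m + 1 / 2)))"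
  proof (intro add_left_mono sum_mono mult_left_mono)
    fix m
    have "0 \<le> x * (real m + 1 / 2)" "x * (real m + 1 / 2) \<le> x * real (Suc m)"
      using assms by (simp_all add: mult_left_mono)
    then show "hat (x * real (Suc m)) \<le> hat (x * (real m + 1 / 2))"
      unfolding hat_def by (intro power_mono) auto
  qed simp
  also have "\<dots> = 1 + \<Omega> x (x / 2)" using \<Omega>_half_pairs[OF assms N] by simp
  also have "\<dots> \<le> 1 + 2 / (3 * x)" using \<Omega>_half_upper[OF assms] by simp
  finally show ?thesis .
qed

section \<open>Additive energy of an interval\<close>

definition diff_count :: "nat \<Rightarrow> int \<Rightarrow> real" where
  "diff_count s n = (\<Sum>a<s. \<Sum>c<s. of_bool (int a - int c = n))"

lemma diff_count_minus: "diff_count s (- n) = diff_count s n"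
proof -
  have "diff_count s (- n) = (\<Sum>c<s. \<Sum>a<s. of_bool (int a - int c = - n))"
    unfolding diff_count_def by (rule sum.swap)
  also have "\<dots> = diff_count s n"
    unfolding diff_count_def by (intro sum.cong refl arg_cong[where f = of_bool]) linarith
  finally show ?thesis .
qed

lemma diff_count_nonneg: "diff_count s (int n) = max 0 (real s - real n)"
proof -
  have "diff_count s (int n) = (\<Sum>c<s. \<Sum>a<s. of_bool (int a - int c = int n))"
    unfolding diff_count_def by (rule sum.swap)
  also have "\<dots> = (\<Sum>c<s. of_bool (c < s - n))"
  proof (rule sum.cong[OF refl])
    fix c assume "c \<in> {..<s}"
    have "(\<Sum>a<s. of_bool (int a - int c = int n)) = (\<Sum>a<s. if a = c + n then 1 else (0::real))"
      by (intro sum.cong refl) auto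
    also have "\<dots> = of_bool (c < s - n)" by (auto simp: sum.delta)
    finally show "(\<Sum>a<s. of_bool (int a - int c = int n)) = (of_bool (c < s - n) :: real)" .
  qed
  also have "\<dots> = (\<Sum>c<s - n. 1)"
    by (rule sum.mono_neutral_cong_right) auto
  finally show ?thesis by (simp add: of_nat_diff max_def)
qed

lemma diff_count_eq: "diff_count s n = max 0 (real s - \<bar>of_int n\<bar>)"
proof (cases "n \<ge> 0")
  case True
  then obtain k where "n = int k" using nonneg_int_cases by blast
  then show ?thesis by (simp add: diff_count_nonneg)
next
  case False
  then obtain k where "n = - int k" by (metis int_cases2 linorder_not_le of_nat_0_le_iff)
  then show ?thesis by (simp add: diff_count_nonneg diff_count_minus)
qed

lemma sum_differences:
  fixes g :: "int \<Rightarrow> real"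
  shows "(\<Sum>a<s. \<Sum>c<s. g (int a - int c)) = (\<Sum>n\<in>{- int s..int s}. diff_count s n * g n)"
proof -
  have "(\<Sum>n\<in>{- int s..int s}. diff_count s n * g n) =
      (\<Sum>n\<in>{- int s..int s}. \<Sum>a<s. \<Sum>c<s. of_bool (int a - int c = n) * g n)"
    unfolding diff_count_def by (simp only: sum_distrib_right)
  also have "\<dots> = (\<Sum>a<s. \<Sum>n\<in>{- int s..int s}. \<Sum>c<s. of_bool (int a - int c = n) * g n)"
    by (rule sum.swap)
  also have "\<dots> = (\<Sum>a<s. \<Sum>c<s. \<Sum>n\<in>{- int s..int s}. of_bool (int a - int c = n) * g n)"
    by (intro sum.cong refl sum.swap)
  also have "\<dots> = (\<Sum>a<s. \<Sum>c<s. g (int a - int c))"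
  proof (intro sum.cong refl)
    fix a c assume "a \<in> {..<s}" "c \<in> {..<s}"
    then have "int a - int c \<in> {- int s..int s}" by auto
    moreover have "(\<Sum>n\<in>{- int s..int s}. of_bool (int a - int c = n) * g n) =
       (\<Sum>n\<in>{- int s..int s}. if int a - int c = n then g n else 0)"
      by (intro sum.cong refl) simp
    ultimately show "(\<Sum>n\<in>{- int s..int s}. of_bool (int a - int c = n) * g n) = g (int a - int c)"
      by (simp add: sum.delta)
  qed
  finally show ?thesis by simp
qed

text \<open>The additive energy of {0..<s} under the congruence of a and c + h modulo p. Modulus 1
  imposes nothing, so it counts all balanced quadruples.\<close>

definition energy :: "nat \<Rightarrow> nat \<Rightarrow> int \<Rightarrow> real" where
  "energy s p h = (\<Sum>a<s. \<Sum>b<s. \<Sum>c<s. \<Sum>d<s. of_bool (a + b = c + d) * of_bool (int p dvd int a - int c - h))"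

text \<open>Balance means b - d = -(a - c), so a difference n = a - c counts with the square of its
  s - |n| representations. Divided by s^2 this is the squared tent of \<Omega> at n / s, and the
  admissible n are h + p i.\<close>

lemma energy_eq_\<Omega>:
  assumes "s \<ge> 1" "p \<ge> 1"
  shows "energy s p h = (real s)\<^sup>2 * \<Omega> (real p / real s) (- of_int h / real s)"
proof -
  have s: "real s > 0" and p: "int p > 0" using assms by auto
  have "energy s p h = (\<Sum>a<s. \<Sum>c<s. \<Sum>b<s. \<Sum>d<s. of_bool (a + b = c + d) * of_bool (int p dvd int a - int c - h))"
    unfolding energy_def by (intro sum.cong refl sum.swap)
  also have "\<dots> = (\<Sum>a<s. \<Sum>c<s. diff_count s (int a - int c) * of_bool (int p dvd int a - int c - h))"
  proof (intro sum.cong refl)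
    fix a c :: nat
    have "(\<Sum>b<s. \<Sum>d<s. of_bool (a + b = c + d) * of_bool (int p dvd int a - int c - h) :: real) =
        (\<Sum>b<s. \<Sum>d<s. of_bool (a + b = c + d)) * of_bool (int p dvd int a - int c - h)"
      by (simp only: sum_distrib_right)
    also have "(\<Sum>b<s. \<Sum>d<s. of_bool (a + b = c + d)) = (\<Sum>b<s. \<Sum>d<s. of_bool (int b - int d = - (int a - int c)) :: real)"
      by (intro sum.cong refl arg_cong[where f = of_bool]) linarith
    also have "\<dots> = diff_count s (int a - int c)"
      unfolding diff_count_def[symmetric] by (rule diff_count_minus)
    finally show "(\<Sum>b<s. \<Sum>d<s. of_bool (a + b = c + d) * of_bool (int p dvd int a - int c - h)) =
      diff_count s (int a - int c) * of_bool (int p dvd int a - int c - h)" .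
  qed
  also have "\<dots> = (\<Sum>n\<in>{- int s..int s}. diff_count s n * (diff_count s n * of_bool (int p dvd n - h)))"
    by (rule sum_differences[of "\<lambda>n. diff_count s n * of_bool (int p dvd n - h)"])
  also have "\<dots> = (\<Sum>n\<in>{n \<in> {- int s..int s}. int p dvd n - h}. (diff_count s n)\<^sup>2)"
    by (rule sum.mono_neutral_cong_right) (auto simp: power2_eq_square)
  finally have E: "energy s p h = (\<Sum>n\<in>{n \<in> {- int s..int s}. int p dvd n - h}. (diff_count s n)\<^sup>2)" .
  define B where "B = {n \<in> {- int s..int s}. int p dvd n - h}"
  define \<phi> where "\<phi> n = (n - h) div int p" for n
  have phi: "int p * \<phi> n = n - h" if "n \<in> B" for n using that by (simp add: B_def \<phi>_def)
  have inj: "inj_on \<phi> B"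
  proof (rule inj_onI)
    fix m n assume mn: "m \<in> B" "n \<in> B" "\<phi> m = \<phi> n"
    have "m - h = int p * \<phi> m" using phi[OF mn(1)] by (rule sym)
    also have "\<dots> = int p * \<phi> n" by (simp only: mn(3))
    also have "\<dots> = n - h" by (rule phi[OF mn(2)])
    finally show "m = n" by simp
  qed
  have "\<Omega> (real p / real s) (- of_int h / real s) =
      (\<Sum>i\<in>\<phi> ` B. hat (real p / real s * of_int i - - of_int h / real s))"
  proof (rule \<Omega>_eq_sum)
    have "B \<subseteq> {- int s..int s}" by (auto simp: B_def)
    from finite_subset[OF this finite_atLeastAtMost_int] show "finite (\<phi> ` B)" by (rule finite_imageI)
    fix i assume i: "i \<notin> \<phi> ` B"
    show "1 \<le> \<bar>real p / real s * of_int i - - of_int h / real s\<bar>"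
    proof (rule ccontr)
      assume "\<not> ?thesis"
      moreover have "real p / real s * of_int i - - of_int h / real s = of_int (int p * i + h) / real s"
        using s by (simp add: field_simps)
      ultimately have "\<bar>real_of_int (int p * i + h)\<bar> < real s" using s by (simp add: abs_divide)
      then have "\<bar>int p * i + h\<bar> < int s" by linarith
      then have "int p * i + h \<in> B" by (auto simp: B_def)
      moreover have "\<phi> (int p * i + h) = i" using p by (simp add: \<phi>_def)
      ultimately show False using i by (metis imageI)
    qed
  qed
  also have "\<dots> = (\<Sum>n\<in>B. hat (of_int n / real s))"
  proof (subst sum.reindex[OF inj], rule sum.cong[OF refl], unfold o_def)
    fix n assume n: "n \<in> B"
    have "real p * real_of_int (\<phi> n) = of_int n - of_int h"
      using arg_cong[OF phi[OF n], of real_of_int] by (simp only: of_int_mult of_int_diff of_int_of_nat_eq)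
    then have "real p / real s * of_int (\<phi> n) - - of_int h / real s = of_int n / real s"
      using s by (simp add: field_simps)
    then show "hat (real p / real s * of_int (\<phi> n) - - of_int h / real s) = hat (of_int n / real s)"
      by (simp only:)
  qed
  finally have "(real s)\<^sup>2 * \<Omega> (real p / real s) (- of_int h / real s) = (\<Sum>n\<in>B. (real s)\<^sup>2 * hat (of_int n / real s))"
    by (simp only: sum_distrib_left)
  also have "\<dots> = (\<Sum>n\<in>B. (diff_count s n)\<^sup>2)"
  proof (rule sum.cong[OF refl])
    fix n
    have "real s * max 0 (1 - \<bar>of_int n / real s\<bar>) = max 0 (real s - \<bar>of_int n\<bar>)"
      using s by (simp add: max_mult_distrib_left right_diff_distrib abs_divide)
    then show "(real s)\<^sup>2 * hat (of_int n / real s) = (diff_count s n)\<^sup>2"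
      unfolding hat_def diff_count_eq power_mult_distrib[symmetric] by (simp only:)
  qed
  finally show ?thesis unfolding E B_def by (rule sym)
qed

text \<open>Reflecting b and c by x -> s - 1 - x turns the sum a + b into a difference and preserves
  the balance; the reflection is the source of the shift s - 1.\<close>

lemma energy_sum_congruence:
  "(\<Sum>a<s. \<Sum>b<s. \<Sum>c<s. \<Sum>d<s. of_bool (a + b = c + d) * of_bool (int p dvd int a + int b + 2 * t)) =
    energy s p (- (int s - 1 + 2 * t))"
proof -
  have refl1: "(\<Sum>i<s. g i) = (\<Sum>i<s. g (s - Suc i))" for g :: "nat \<Rightarrow> real"
    by (rule sum.nat_diff_reindex[symmetric])
  have "(\<Sum>a<s. \<Sum>b<s. \<Sum>c<s. \<Sum>d<s. of_bool (a + b = c + d) * of_bool (int p dvd int a + int b + 2 * t)) =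
    (\<Sum>a<s. \<Sum>b<s. \<Sum>c<s. \<Sum>d<s. of_bool (a + (s - Suc b) = (s - Suc c) + d) *
        (of_bool (int p dvd int a + int (s - Suc b) + 2 * t) :: real))"
    by (rule sum.cong[OF refl], subst refl1, rule sum.cong[OF refl], subst refl1, rule refl)
  also have "\<dots> = (\<Sum>a<s. \<Sum>b<s. \<Sum>c<s. \<Sum>d<s. of_bool (a + c = b + d) *
        of_bool (int p dvd int a - int b - (- (int s - 1 + 2 * t))))"
  proof (intro sum.cong refl)
    fix a b c d assume "b \<in> {..<s}" "c \<in> {..<s}"
    then have "a + (s - Suc b) = (s - Suc c) + d \<longleftrightarrow> a + c = b + d"
      "int a + int (s - Suc b) + 2 * t = int a - int b - (- (int s - 1 + 2 * t))"
      by auto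
    then show "of_bool (a + (s - Suc b) = (s - Suc c) + d) * of_bool (int p dvd int a + int (s - Suc b) + 2 * t) =
      (of_bool (a + c = b + d) * of_bool (int p dvd int a - int b - (- (int s - 1 + 2 * t))) :: real)"
      by (simp only:)
  qed
  also have "\<dots> = energy s p (- (int s - 1 + 2 * t))"
    unfolding energy_def by (intro sum.cong refl sum.swap)
  finally show ?thesis .
qed

lemma sum_PiE_4:
  fixes f :: "'k \<Rightarrow> nat \<Rightarrow> nat \<Rightarrow> nat \<Rightarrow> nat \<Rightarrow> 'c::comm_semiring_1"
  assumes "finite I" "\<And>k. k \<in> I \<Longrightarrow> finite (B k)"
  shows "(\<Sum>a\<in>Pi\<^sub>E I B. \<Sum>b\<in>Pi\<^sub>E I B. \<Sum>c\<in>Pi\<^sub>E I B. \<Sum>d\<in>Pi\<^sub>E I B. \<Prod>k\<in>I. f k (a k) (b k) (c k) (d k)) =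
    (\<Prod>k\<in>I. \<Sum>x\<in>B k. \<Sum>y\<in>B k. \<Sum>z\<in>B k. \<Sum>w\<in>B k. f k x y z w)"
proof -
  note ps = prod_sum_PiE[OF assms, symmetric]
  have "(\<Sum>d\<in>Pi\<^sub>E I B. \<Prod>k\<in>I. f k (a k) (b k) (c k) (d k)) = (\<Prod>k\<in>I. \<Sum>w\<in>B k. f k (a k) (b k) (c k) w)" for a b c :: "'k \<Rightarrow> nat"
    by (rule ps)
  moreover have "(\<Sum>c\<in>Pi\<^sub>E I B. \<Prod>k\<in>I. \<Sum>w\<in>B k. f k (a k) (b k) (c k) w) =
     (\<Prod>k\<in>I. \<Sum>z\<in>B k. \<Sum>w\<in>B k. f k (a k) (b k) z w)" for a b :: "'k \<Rightarrow> nat"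
    by (rule ps)
  moreover have "(\<Sum>b\<in>Pi\<^sub>E I B. \<Prod>k\<in>I. \<Sum>z\<in>B k. \<Sum>w\<in>B k. f k (a k) (b k) z w) =
     (\<Prod>k\<in>I. \<Sum>y\<in>B k. \<Sum>z\<in>B k. \<Sum>w\<in>B k. f k (a k) y z w)" for a :: "'k \<Rightarrow> nat"
    by (rule ps)
  moreover have "(\<Sum>a\<in>Pi\<^sub>E I B. \<Prod>k\<in>I. \<Sum>y\<in>B k. \<Sum>z\<in>B k. \<Sum>w\<in>B k. f k (a k) y z w) =
     (\<Prod>k\<in>I. \<Sum>x\<in>B k. \<Sum>y\<in>B k. \<Sum>z\<in>B k. \<Sum>w\<in>B k. f k x y z w)"
    by (rule ps)
  ultimately show ?thesis by (simp only:)
qed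

lemma of_bool_ball:
  assumes "finite I"
  shows "of_bool (\<forall>k\<in>I. P k) = (\<Prod>k\<in>I. of_bool (P k) :: 'c::comm_semiring_1)"
  using assms by (induction I) (simp_all add: of_bool_conj)

section \<open>Arrangements\<close>

locale arranged_field = Ring.field R for R :: "('a, 'b) ring_scheme" (structure) +
  fixes p e :: nat and \<alpha> :: "(nat \<Rightarrow> int) \<Rightarrow> 'a"
  assumes prime_p: "prime p" and e_pos: "e \<ge> 1"
    and card_carrier: "card (carrier R) = p ^ e"
    and epi: "\<alpha> \<in> epi (int_vectors e) (add_monoid R)"
begin

abbreviation "I \<equiv> {1..e}"
abbreviation "vectors \<equiv> (\<Pi>\<^sub>E k\<in>I. UNIV :: int set)"

declare One_nat_def [simp del]

lemma p_gt_1: "p > 1"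
  by (rule prime_gt_1_nat[OF prime_p])

lemma p_pos: "p > 0"
  using p_gt_1 by linarith

lemma finite_K: "finite (carrier R)"
  using card_carrier p_pos by (metis card.infinite power_eq_0_iff less_irrefl)

lemma vectors_carrier: "carrier (int_vectors e) = vectors"
  by (simp add: PiE_def Pi_def integer_group_def)

lemma vector_eqI: "i \<in> vectors \<Longrightarrow> j \<in> vectors \<Longrightarrow> (\<And>k. k \<in> I \<Longrightarrow> i k = j k) \<Longrightarrow> i = j"
  by (rule PiE_ext)

lemma alpha_closed [simp]: "j \<in> vectors \<Longrightarrow> \<alpha> j \<in> carrier R"
  using epi vectors_carrier by (auto simp: epi_def hom_def)

lemma alpha_add:
  assumes "i \<in> vectors" "j \<in> vectors"
  shows "\<alpha> (\<lambda>k\<in>I. i k + j k) = \<alpha> i \<oplus> \<alpha> j"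
proof -
  have "\<alpha> \<in> hom (int_vectors e) (add_monoid R)" using epi by (simp add: epi_def)
  then have "\<alpha> (i \<otimes>\<^bsub>int_vectors e\<^esub> j) = \<alpha> i \<oplus> \<alpha> j"
    using hom_mult[of \<alpha> "int_vectors e" "add_monoid R" i j] assms unfolding vectors_carrier by simp
  then show ?thesis by (simp add: product_group_def integer_group_def)
qed

lemma alpha_surj: "\<alpha> ` vectors = carrier R"
  using epi vectors_carrier by (auto simp: epi_def)

lemma alpha_zero: "\<alpha> (\<lambda>k\<in>I. 0) = \<zero>"
proof -
  have z: "(\<lambda>k\<in>I. 0) \<in> vectors" by auto
  have "\<alpha> (\<lambda>k\<in>I. 0) \<oplus> \<alpha> (\<lambda>k\<in>I. 0) = \<alpha> (\<lambda>k\<in>I. (\<lambda>k\<in>I. 0) k + (\<lambda>k\<in>I. 0) k)"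
    by (rule alpha_add[OF z z, symmetric])
  also have "(\<lambda>k\<in>I. (\<lambda>k\<in>I. 0) k + (\<lambda>k\<in>I. 0) k) = (\<lambda>k\<in>I. 0 :: int)" by (rule restrict_ext) simp
  finally have "\<alpha> (\<lambda>k\<in>I. 0) \<oplus> \<alpha> (\<lambda>k\<in>I. 0) = \<alpha> (\<lambda>k\<in>I. 0)" .
  then show ?thesis by (rule add.l_cancel_one[OF alpha_closed[OF z] alpha_closed[OF z], THEN iffD1])
qed

lemma alpha_nat_mult:
  assumes "j \<in> vectors"
  shows "\<alpha> (\<lambda>k\<in>I. int n * j k) = [n] \<cdot> \<alpha> j"
proof (induction n)
  case 0
  have "(\<lambda>k\<in>I. int 0 * j k) = (\<lambda>k\<in>I. 0)" by (rule restrict_ext) simp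
  then have z: "\<alpha> (\<lambda>k\<in>I. int 0 * j k) = \<zero>" by (simp only: alpha_zero)
  show ?case unfolding z by simp
next
  case (Suc n)
  have v: "(\<lambda>k\<in>I. int n * j k) \<in> vectors" by auto
  have "(\<lambda>k\<in>I. int (Suc n) * j k) = (\<lambda>k\<in>I. (\<lambda>k\<in>I. int n * j k) k + j k)"
    by (rule restrict_ext) (simp add: algebra_simps)
  then have "\<alpha> (\<lambda>k\<in>I. int (Suc n) * j k) = \<alpha> (\<lambda>k\<in>I. int n * j k) \<oplus> \<alpha> j"
    using alpha_add[OF v assms] by (simp only:)
  then show ?case unfolding Suc by (simp only: add.nat_pow_Suc)
qed

text \<open>The order p^e of the additive group annihilates 1, and p^e times 1 is the e-th power of
  p times 1; a field has no nonzero nilpotents.\<close>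

lemma characteristic: "[p] \<cdot> \<one> = \<zero>"
proof -
  have pw: "[(p ^ n)] \<cdot> \<one> = ([p] \<cdot> \<one>) [^] n" for n
  proof (induction n)
    case (Suc n)
    have "[(p ^ Suc n)] \<cdot> \<one> = [p] \<cdot> ([(p ^ n)] \<cdot> \<one>)"
      using add.nat_pow_pow[of \<one> p "p ^ n"] by (simp add: mult.commute)
    also have "\<dots> = ([(p ^ n)] \<cdot> \<one>) \<otimes> ([p] \<cdot> \<one>)"
      using add_pow_rdistr[of "[(p ^ n)] \<cdot> \<one>" \<one> p] by simp
    finally show ?case using Suc by simp
  qed simp
  have "[order (add_monoid R)] \<cdot> \<one> = \<zero>"
    using add.pow_order_eq_1[of \<one>] by simp
  then have "([p] \<cdot> \<one>) [^] e = \<zero>"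
    using pw[of e] card_carrier by (simp add: order_def)
  moreover have "c = \<zero>" if "c \<in> carrier R" "c [^] n = \<zero>" for c and n :: nat
    using that
  proof (induction n)
    case (Suc n)
    then show ?case using integral_iff[of "c [^] n" c] by auto
  qed simp
  ultimately show ?thesis by blast
qed

lemma alpha_p_mult:
  assumes "j \<in> vectors"
  shows "\<alpha> (\<lambda>k\<in>I. int p * j k) = \<zero>"
proof -
  have "[p] \<cdot> \<alpha> j = [p] \<cdot> \<one> \<otimes> \<alpha> j"
    using add_pow_ldistr[of \<one> "\<alpha> j" p] assms by simp
  then show ?thesis unfolding alpha_nat_mult[OF assms] characteristic
    using alpha_closed[OF assms] by (simp only: l_null)
qed

lemma alpha_mod:
  assumes "j \<in> vectors"
  shows "\<alpha> (\<lambda>k\<in>I. j k mod int p) = \<alpha> j"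
proof -
  have v: "(\<lambda>k\<in>I. j k div int p) \<in> vectors" "(\<lambda>k\<in>I. j k mod int p) \<in> vectors" by auto
  let ?u = "\<lambda>k\<in>I. int p * (\<lambda>k\<in>I. j k div int p) k"
  have u: "?u \<in> vectors" by auto
  have "j = (\<lambda>k\<in>I. ?u k + (\<lambda>k\<in>I. j k mod int p) k)"
  proof (rule vector_eqI[OF assms])
    show "(\<lambda>k\<in>I. ?u k + (\<lambda>k\<in>I. j k mod int p) k) \<in> vectors" by auto
    fix k assume k: "k \<in> I"
    show "j k = (\<lambda>k\<in>I. ?u k + (\<lambda>k\<in>I. j k mod int p) k) k"
      unfolding restrict_apply'[OF k] by simp
  qed
  from arg_cong[OF this, of \<alpha>] have "\<alpha> j = \<alpha> ?u \<oplus> \<alpha> (\<lambda>k\<in>I. j k mod int p)"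
    unfolding alpha_add[OF u v(2)] .
  also have "\<dots> = \<alpha> (\<lambda>k\<in>I. j k mod int p)"
    unfolding alpha_p_mult[OF v(1)] by (rule l_zero[OF alpha_closed[OF v(2)]])
  finally show ?thesis by (rule sym)
qed

definition box :: "(nat \<Rightarrow> int) set" where "box = (\<Pi>\<^sub>E k\<in>I. {0..<int p})"

lemma box_vectors: "j \<in> box \<Longrightarrow> j \<in> vectors"
  by (auto simp: box_def PiE_iff)

lemma mod_in_box: "(\<lambda>k\<in>I. j k mod int p) \<in> box"
  using p_pos by (auto simp: box_def)

text \<open>By \<open>alpha_mod\<close> the box already maps onto the field, and both have p^e
  elements.\<close>

lemma alpha_bij: "bij_betw \<alpha> box (carrier R)"
proof -
  have img: "\<alpha> ` box = carrier R"
  proof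
    show "carrier R \<subseteq> \<alpha> ` box"
    proof
      fix x assume "x \<in> carrier R"
      then obtain j where j: "j \<in> vectors" "x = \<alpha> j" using alpha_surj by blast
      then have "x = \<alpha> (\<lambda>k\<in>I. j k mod int p)" using alpha_mod by simp
      then show "x \<in> \<alpha> ` box" using mod_in_box by blast
    qed
  qed (use box_vectors in auto)
  have "finite box" by (simp add: box_def finite_PiE)
  moreover have "card box = p ^ e" by (simp add: box_def card_PiE)
  ultimately have "inj_on \<alpha> box" using img card_carrier by (intro eq_card_imp_inj_on) auto
  then show ?thesis using img by (simp add: bij_betw_def)
qed

lemma alpha_eq_zero_iff:
  assumes "j \<in> vectors"
  shows "\<alpha> j = \<zero> \<longleftrightarrow> (\<forall>k\<in>I. int p dvd j k)"
proof -
  have z: "(\<lambda>k\<in>I. 0) \<in> box" using p_pos by (auto simp: box_def)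
  have "\<alpha> j = \<zero> \<longleftrightarrow> \<alpha> (\<lambda>k\<in>I. j k mod int p) = \<alpha> (\<lambda>k\<in>I. 0)"
    by (simp only: alpha_mod[OF assms] alpha_zero)
  also have "\<dots> \<longleftrightarrow> (\<lambda>k\<in>I. j k mod int p) = (\<lambda>k\<in>I. 0)"
    by (rule inj_on_eq_iff[OF bij_betw_imp_inj_on[OF alpha_bij] mod_in_box z])
  also have "\<dots> \<longleftrightarrow> (\<forall>k\<in>I. j k mod int p = 0)"
    by (auto simp: restrict_def fun_eq_iff)
  finally show ?thesis by (simp add: dvd_eq_mod_eq_0)
qed

lemma alpha_eq_iff:
  assumes "i \<in> vectors" "j \<in> vectors"
  shows "\<alpha> i = \<alpha> j \<longleftrightarrow> (\<forall>k\<in>I. int p dvd i k - j k)"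
proof -
  let ?d = "\<lambda>k\<in>I. i k - j k"
  have d: "?d \<in> vectors" by auto
  have "i = (\<lambda>k\<in>I. ?d k + j k)"
  proof (rule vector_eqI[OF assms(1)])
    show "(\<lambda>k\<in>I. ?d k + j k) \<in> vectors" by auto
    fix k assume k: "k \<in> I"
    show "i k = (\<lambda>k\<in>I. ?d k + j k) k" unfolding restrict_apply'[OF k] by simp
  qed
  from arg_cong[OF this, of \<alpha>] have "\<alpha> i = \<alpha> ?d \<oplus> \<alpha> j" unfolding alpha_add[OF d assms(2)] .
  then have "\<alpha> i = \<alpha> j \<longleftrightarrow> \<alpha> ?d = \<zero>"
    using add.r_cancel_one[OF alpha_closed[OF assms(2)] alpha_closed[OF d]] by argo
  also have "\<dots> \<longleftrightarrow> (\<forall>k\<in>I. int p dvd ?d k)" by (rule alpha_eq_zero_iff[OF d])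
  also have "\<dots> \<longleftrightarrow> (\<forall>k\<in>I. int p dvd i k - j k)" by (rule ball_cong[OF refl]) simp
  finally show ?thesis .
qed

text \<open>The coordinate with index 1, which exists as e \<ge> 1, of the representative in
  \<open>box\<close>. It is additive modulo p, and so yields the additive character
  \<open>add_char\<close>.\<close>

definition coord :: "'a \<Rightarrow> nat" where "coord x = nat (inv_into box \<alpha> x 1)"

definition add_char :: "'a \<Rightarrow> complex" where "add_char x = unit_exp (real (coord x) / real p)"

lemma one_in_I: "1 \<in> I" using e_pos by simp

lemma unit_exp_mod: "unit_exp (of_int (n mod int p) / real p) = unit_exp (of_int n / real p)"
proof -
  have "real_of_int n = real p * of_int (n div int p) + of_int (n mod int p)"
    by (metis mult_div_mod_eq of_int_add of_int_mult of_int_of_nat_eq)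
  then have "of_int n / real p = of_int (n mod int p) / real p + of_int (n div int p)"
    using p_pos by (simp add: field_simps)
  then show ?thesis by (simp only: unit_exp_add_int)
qed

lemma coord_less: "x \<in> carrier R \<Longrightarrow> coord x < p"
proof -
  assume "x \<in> carrier R"
  then have "inv_into box \<alpha> x \<in> box"
    using alpha_bij by (intro inv_into_into) (simp add: bij_betw_def)
  then have "inv_into box \<alpha> x 1 \<in> {0..<int p}" using one_in_I unfolding box_def by blast
  then show ?thesis by (simp add: coord_def nat_less_iff)
qed

lemma add_char_alpha:
  assumes "j \<in> vectors"
  shows "add_char (\<alpha> j) = unit_exp (of_int (j 1) / real p)"
proof -
  have "inv_into box \<alpha> (\<alpha> (\<lambda>k\<in>I. j k mod int p)) = (\<lambda>k\<in>I. j k mod int p)"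
    using alpha_bij mod_in_box by (intro inv_into_f_f) (simp add: bij_betw_def)
  then have "coord (\<alpha> j) = nat (j 1 mod int p)"
    using alpha_mod[OF assms] one_in_I by (simp add: coord_def)
  moreover have "j 1 mod int p \<ge> 0" using p_pos by simp
  ultimately have "real (coord (\<alpha> j)) = of_int (j 1 mod int p)" by simp
  then show ?thesis unfolding add_char_def by (simp only: unit_exp_mod)
qed

lemma add_char_add:
  assumes "x \<in> carrier R" "y \<in> carrier R"
  shows "add_char (x \<oplus> y) = add_char x * add_char y"
proof -
  obtain i j where ij: "i \<in> vectors" "x = \<alpha> i" "j \<in> vectors" "y = \<alpha> j"
    using assms unfolding alpha_surj[symmetric] by blast
  have v: "(\<lambda>k\<in>I. i k + j k) \<in> vectors" by auto
  have "add_char (x \<oplus> y) = add_char (\<alpha> (\<lambda>k\<in>I. i k + j k))"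
    unfolding ij(2,4) by (simp only: alpha_add[OF ij(1,3)])
  also have "\<dots> = unit_exp (of_int (i 1) / real p + of_int (j 1) / real p)"
    unfolding add_char_alpha[OF v] restrict_apply'[OF one_in_I] by (simp add: add_divide_distrib)
  also have "\<dots> = add_char x * add_char y"
    unfolding ij(2,4) add_char_alpha[OF ij(1)] add_char_alpha[OF ij(3)] by (rule unit_exp_add)
  finally show ?thesis .
qed

lemma add_char_nontrivial: "\<exists>x\<in>carrier R. add_char x \<noteq> 1"
proof -
  let ?j = "\<lambda>k\<in>I. 1 :: int"
  have v: "?j \<in> vectors" by auto
  have "pi * (1 / real p) > 0" "pi * (1 / real p) < pi" using p_gt_1 by (auto simp: field_simps)
  then have "sin (pi * (1 / real p)) > 0" by (intro sin_gt_zero) auto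
  then have "cmod (unit_exp (1 / real p) - 1) > 0" unfolding norm_one_minus_unit_exp by simp
  then have "unit_exp (1 / real p) \<noteq> 1" by auto
  moreover have "add_char (\<alpha> ?j) = unit_exp (1 / real p)"
    unfolding add_char_alpha[OF v] restrict_apply'[OF one_in_I] by simp
  ultimately have "add_char (\<alpha> ?j) \<noteq> 1" by (simp only: not_False_eq_True)
  then show ?thesis using alpha_closed[OF v] by blast
qed

text \<open>The dual arrangement: \<open>freq \<kappa>\<close> lists the frequencies of the character
  \<open>j \<mapsto> \<psi> (\<alpha> j \<kappa>)\<close> of the integer lattice.\<close>

definition basis_vector :: "nat \<Rightarrow> nat \<Rightarrow> int" where
  "basis_vector i = (\<lambda>k\<in>I. if k = i then 1 else 0)"

lemma basis_vector_closed: "basis_vector i \<in> vectors"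
  by (auto simp: basis_vector_def)

definition freq :: "'a \<Rightarrow> nat \<Rightarrow> nat" where
  "freq \<kappa> = (\<lambda>i\<in>I. coord (\<alpha> (basis_vector i) \<otimes> \<kappa>))"

lemma freq_range: "\<kappa> \<in> carrier R \<Longrightarrow> freq \<kappa> \<in> (\<Pi>\<^sub>E k\<in>I. {..<p})"
  using basis_vector_closed by (auto simp: freq_def intro!: coord_less)

text \<open>A homomorphism on the lattice is determined by its values on the basis vectors, which
  \<open>freq\<close> records; the coordinates are switched on one at a time.\<close>

lemma add_char_lattice:
  assumes "\<kappa> \<in> carrier R"
  shows "add_char (\<alpha> (\<lambda>k\<in>I. int (a k)) \<otimes> \<kappa>) = (\<Prod>k\<in>I. unit_exp (real (a k) * (real (freq \<kappa> k) / real p)))"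
proof -
  define h where "h j = add_char (\<alpha> j \<otimes> \<kappa>)" for j
  have hadd: "h (\<lambda>k\<in>I. i k + j k) = h i * h j" if "i \<in> vectors" "j \<in> vectors" for i j
    unfolding h_def alpha_add[OF that] using that assms by (simp add: l_distr add_char_add)
  have h0: "h (\<lambda>k\<in>I. 0) = 1"
  proof -
    have v: "(\<lambda>k\<in>I. 0) \<in> vectors" by auto
    have "add_char \<zero> = 1"
      using add_char_alpha[OF v] unfolding alpha_zero restrict_apply'[OF one_in_I] by simp
    then show ?thesis unfolding h_def alpha_zero using assms by simp
  qed
  have hb: "h (\<lambda>k\<in>I. int n * basis_vector i k) = unit_exp (real n * (real (freq \<kappa> i) / real p))" if "i \<in> I" for i n
  proof (induction n)
    case 0
    have "(\<lambda>k\<in>I. int 0 * basis_vector i k) = (\<lambda>k\<in>I. 0)" by (rule restrict_ext) simp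
    then show ?case using h0 by (simp only:) simp
  next
    case (Suc n)
    have v: "(\<lambda>k\<in>I. int n * basis_vector i k) \<in> vectors" by auto
    have "(\<lambda>k\<in>I. int (Suc n) * basis_vector i k) = (\<lambda>k\<in>I. (\<lambda>k\<in>I. int n * basis_vector i k) k + basis_vector i k)"
      by (rule restrict_ext) (simp add: algebra_simps)
    then have "h (\<lambda>k\<in>I. int (Suc n) * basis_vector i k) =
        h (\<lambda>k\<in>I. int n * basis_vector i k) * h (basis_vector i)"
      using hadd[OF v basis_vector_closed] by (simp only:)
    also have "h (basis_vector i) = unit_exp (real (freq \<kappa> i) / real p)"
      using that by (simp add: h_def add_char_def freq_def)
    finally show ?case using Suc by (simp add: unit_exp_add[symmetric] algebra_simps add_divide_distrib)
  qed
  have "h (\<lambda>k\<in>I. if k \<in> J then int (a k) else 0) = (\<Prod>k\<in>J. unit_exp (real (a k) * (real (freq \<kappa> k) / real p)))"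
    if "finite J" "J \<subseteq> I" for J
    using that
  proof (induction J)
    case empty
    have "(\<lambda>k\<in>I. if k \<in> {} then int (a k) else 0) = (\<lambda>k\<in>I. 0)" by (rule restrict_ext) simp
    then show ?case using h0 by (simp only: prod.empty)
  next
    case (insert i J)
    have v: "(\<lambda>k\<in>I. int (a i) * basis_vector i k) \<in> vectors" "(\<lambda>k\<in>I. if k \<in> J then int (a k) else 0) \<in> vectors"
      by auto
    have "(\<lambda>k\<in>I. if k \<in> insert i J then int (a k) else 0) =
      (\<lambda>k\<in>I. (\<lambda>k\<in>I. int (a i) * basis_vector i k) k + (\<lambda>k\<in>I. if k \<in> J then int (a k) else 0) k)"
      using insert.hyps by (intro restrict_ext) (simp add: basis_vector_def)
    then have "h (\<lambda>k\<in>I. if k \<in> insert i J then int (a k) else 0) =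
      h (\<lambda>k\<in>I. int (a i) * basis_vector i k) * h (\<lambda>k\<in>I. if k \<in> J then int (a k) else 0)"
      using hadd[OF v] by (simp only:)
    also have "h (\<lambda>k\<in>I. if k \<in> J then int (a k) else 0) = (\<Prod>k\<in>J. unit_exp (real (a k) * (real (freq \<kappa> k) / real p)))"
      using insert.IH insert.prems by blast
    also have "h (\<lambda>k\<in>I. int (a i) * basis_vector i k) = unit_exp (real (a i) * (real (freq \<kappa> i) / real p))"
      using insert.prems by (intro hb) blast
    finally show ?case by (simp only: prod.insert[OF insert.hyps(1,2)])
  qed
  from this[OF finite_atLeastAtMost order.refl]
  have "h (\<lambda>k\<in>I. if k \<in> I then int (a k) else 0) = (\<Prod>k\<in>I. unit_exp (real (a k) * (real (freq \<kappa> k) / real p)))" .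
  moreover have "(\<lambda>k\<in>I. if k \<in> I then int (a k) else 0) = (\<lambda>k\<in>I. int (a k))" by (rule restrict_ext) simp
  ultimately show ?thesis unfolding h_def by (simp only:)
qed

end

locale arranged_quadratic = arranged_field R p e \<alpha> + finite_quadratic_character R \<eta>
  for R :: "('a, 'b) ring_scheme" (structure) and p e \<alpha> \<eta>
begin

sublocale quadratic_gauss R \<eta> add_char
proof
  show "add_char (x \<oplus> y) = add_char x * add_char y" if "x \<in> carrier R" "y \<in> carrier R" for x y
    using add_char_add that .
  show "cmod (add_char x) = 1" for x by (simp add: add_char_def)
  show "\<exists>x\<in>carrier R. add_char x \<noteq> 1" by (rule add_char_nontrivial)
qed

text \<open>Equal frequencies give equal characters x -> \<open>add_char\<close> (x \<kappa>), and
  orthogonality separates these. Injectivity lets a sum over the field be bounded by one over all of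
  {0..<p}^e, which factors.\<close>

lemma freq_inj: "inj_on freq K"
proof (rule inj_onI)
  fix \<kappa> \<mu> assume km: "\<kappa> \<in> K" "\<mu> \<in> K" "freq \<kappa> = freq \<mu>"
  have eq: "add_char (x \<otimes> \<kappa>) = add_char (x \<otimes> \<mu>)" if "x \<in> K" for x
  proof -
    have "x \<in> \<alpha> ` box" using that unfolding bij_betw_imp_surj_on[OF alpha_bij] .
    then obtain j where j: "j \<in> box" "x = \<alpha> j" by (rule imageE)
    have "j = (\<lambda>k\<in>I. int (nat (j k)))"
    proof (rule vector_eqI[OF box_vectors[OF j(1)]])
      show "(\<lambda>k\<in>I. int (nat (j k))) \<in> vectors" by auto
      fix k assume k: "k \<in> I"
      then have "j k \<in> {0..<int p}" using j(1) unfolding box_def by blast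
      then show "j k = (\<lambda>k\<in>I. int (nat (j k))) k" unfolding restrict_apply'[OF k] by simp
    qed
    from arg_cong[OF this, of \<alpha>] have x: "x = \<alpha> (\<lambda>k\<in>I. int (nat (j k)))" unfolding j(2) .
    show ?thesis unfolding x add_char_lattice[OF km(1)] add_char_lattice[OF km(2)] km(3) by (rule refl)
  qed
  have d: "\<kappa> \<ominus> \<mu> \<in> K" using km by simp
  have "add_char ((\<kappa> \<ominus> \<mu>) \<otimes> x) = 1" if x: "x \<in> K" for x
  proof -
    have "(\<kappa> \<ominus> \<mu>) \<otimes> x = x \<otimes> \<kappa> \<ominus> x \<otimes> \<mu>" using km x by algebra
    then have "add_char ((\<kappa> \<ominus> \<mu>) \<otimes> x) = add_char (x \<otimes> \<kappa>) * cnj (add_char (x \<otimes> \<mu>))"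
      using psi_diff[of "x \<otimes> \<kappa>" "x \<otimes> \<mu>"] km x by simp
    then show ?thesis using eq[OF x] psi_cnj[of "x \<otimes> \<mu>"] km x by simp
  qed
  then have "(\<Sum>x\<in>K. add_char ((\<kappa> \<ominus> \<mu>) \<otimes> x)) = of_nat q" by simp
  then have "\<kappa> \<ominus> \<mu> = \<zero>" using sum_psi_mult[OF d] q_gt_1 by (cases "\<kappa> \<ominus> \<mu> = \<zero>") auto
  then show "\<kappa> = \<mu>" using minus_eq_zero_iff km by simp
qed

end

section \<open>Moments of character polynomials\<close>

lemma sum_quadruples:
  "(\<Sum>i\<in>S \<times> S \<times> S \<times> S. f (fst i) (fst (snd i)) (fst (snd (snd i))) (snd (snd (snd i)))) =
    (\<Sum>a\<in>S. \<Sum>b\<in>S. \<Sum>c\<in>S. \<Sum>d\<in>S. f a b c d)"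
  by (simp only: sum.cartesian_product split_def fst_conv snd_conv)

lemma sum_Collect_of_bool:
  fixes f :: "'c \<Rightarrow> 'd::semiring_1"
  assumes "finite T"
  shows "(\<Sum>i\<in>{i \<in> T. P i}. f i) = (\<Sum>i\<in>T. of_bool (P i) * f i)"
  using assms by (intro sum.mono_neutral_cong_left) auto

lemma card_Collect_of_bool:
  assumes "finite T"
  shows "real (card {i \<in> T. P i}) = (\<Sum>i\<in>T. of_bool (P i))"
  using sum_Collect_of_bool[OF assms, where P = P and f = "\<lambda>_. 1::real"] by simp

lemma energy_swap:
  "(\<Sum>a<s. \<Sum>b<s. \<Sum>c<s. \<Sum>d<s. of_bool (a + b = c + d) * of_bool (int p dvd int a - int d)) = energy s p 0"
proof -
  have "(\<Sum>a<s. \<Sum>b<s. \<Sum>c<s. \<Sum>d<s. of_bool (a + b = c + d) * of_bool (int p dvd int a - int d) :: real) =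
     (\<Sum>a<s. \<Sum>b<s. \<Sum>d<s. \<Sum>c<s. of_bool (a + b = c + d) * of_bool (int p dvd int a - int d))"
    by (intro sum.cong refl sum.swap)
  then show ?thesis unfolding energy_def by (simp only: add.commute diff_0_right)
qed

context arranged_quadratic
begin

context
  fixes s :: "nat \<Rightarrow> nat" and t :: "nat \<Rightarrow> int"
begin

definition supp :: "(nat \<Rightarrow> nat) set" where "supp = (\<Pi>\<^sub>E k\<in>I. {..<s k})"

lemma finite_supp: "finite supp"
  unfolding supp_def by (intro finite_PiE) auto

definition point :: "(nat \<Rightarrow> nat) \<Rightarrow> 'a" where "point a = \<alpha> (\<lambda>k\<in>I. int (a k) + t k)"

lemma lattice_closed: "(\<lambda>k\<in>I. f k) \<in> vectors"
  by auto

lemma point_closed: "point a \<in> K"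
  unfolding point_def by (rule alpha_closed[OF lattice_closed])

lemma point_add: "point a \<oplus> point b = \<alpha> (\<lambda>k\<in>I. int (a k) + int (b k) + 2 * t k)"
proof -
  have "(\<lambda>k\<in>I. (\<lambda>k\<in>I. int (a k) + t k) k + (\<lambda>k\<in>I. int (b k) + t k) k) =
      (\<lambda>k\<in>I. int (a k) + int (b k) + 2 * t k)"
    by (rule restrict_ext) simp
  then show ?thesis unfolding point_def alpha_add[OF lattice_closed lattice_closed, symmetric] by (simp only:)
qed

lemma point_eq_iff: "point a = point b \<longleftrightarrow> (\<forall>k\<in>I. int p dvd int (a k) - int (b k))"
  unfolding point_def alpha_eq_iff[OF lattice_closed lattice_closed] by (rule ball_cong[OF refl]) simp

lemma point_add_eq_zero_iff:
  "point a \<oplus> point b = \<zero> \<longleftrightarrow> (\<forall>k\<in>I. int p dvd int (a k) + int (b k) + 2 * t k)"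
  unfolding point_add alpha_eq_zero_iff[OF lattice_closed] by (rule ball_cong[OF refl]) simp

lemma point_eq_zero_iff: "point a = \<zero> \<longleftrightarrow> (\<forall>k\<in>I. int p dvd int (a k) + t k)"
  unfolding point_def alpha_eq_zero_iff[OF lattice_closed] by (rule ball_cong[OF refl]) simp

text \<open>A modulus larger than every |a k + b k - c k - d k| on the support, so that roots of
  unity detect balance over the integers.\<close>

definition period :: nat where "period = 1 + (\<Sum>k\<in>I. 2 * s k)"

definition weighted_sum :: "'a \<Rightarrow> (nat \<Rightarrow> nat) \<Rightarrow> complex" where
  "weighted_sum \<kappa> u = (\<Sum>a\<in>supp. add_char (point a \<otimes> \<kappa>) * (\<Prod>k\<in>I. unit_exp (real (a k) * (real (u k) / real period))))"

text \<open>The translation contributes only a factor of modulus 1, and each coordinate a Dirichlet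
  kernel at the sum of the two frequencies.\<close>

lemma norm_weighted_sum:
  assumes "\<kappa> \<in> K"
  shows "cmod (weighted_sum \<kappa> u) = (\<Prod>k\<in>I. cmod (kernel (s k) (real (freq \<kappa> k) / real p + real (u k) / real period)))"
proof -
  let ?t = "\<alpha> (\<lambda>k\<in>I. t k)"
  have split: "add_char (point a \<otimes> \<kappa>) = add_char (?t \<otimes> \<kappa>) * (\<Prod>k\<in>I. unit_exp (real (a k) * (real (freq \<kappa> k) / real p)))" for a
  proof -
    let ?a = "\<lambda>k\<in>I. int (a k)"
    have "(\<lambda>k\<in>I. ?a k + (\<lambda>k\<in>I. t k) k) = (\<lambda>k\<in>I. int (a k) + t k)" by (rule restrict_ext) simp
    then have "point a = \<alpha> ?a \<oplus> ?t"
      unfolding point_def alpha_add[OF lattice_closed lattice_closed, symmetric] by (simp only:)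
    moreover have "(\<alpha> ?a \<oplus> ?t) \<otimes> \<kappa> = \<alpha> ?a \<otimes> \<kappa> \<oplus> ?t \<otimes> \<kappa>"
      by (rule l_distr[OF alpha_closed[OF lattice_closed] alpha_closed[OF lattice_closed] assms])
    ultimately have "add_char (point a \<otimes> \<kappa>) = add_char (\<alpha> ?a \<otimes> \<kappa>) * add_char (?t \<otimes> \<kappa>)"
      by (simp only: add_char_add m_closed alpha_closed[OF lattice_closed] assms)
    then show ?thesis unfolding add_char_lattice[OF assms] by (simp only: mult.commute)
  qed
  have "weighted_sum \<kappa> u = add_char (?t \<otimes> \<kappa>) * (\<Sum>a\<in>supp. \<Prod>k\<in>I. unit_exp (real (a k) * (real (freq \<kappa> k) / real p + real (u k) / real period)))"
    unfolding weighted_sum_def split sum_distrib_left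
    by (intro sum.cong refl) (simp only: prod.distrib distrib_left unit_exp_add mult.assoc)
  also have "(\<Sum>a\<in>supp. \<Prod>k\<in>I. unit_exp (real (a k) * (real (freq \<kappa> k) / real p + real (u k) / real period))) =
      (\<Prod>k\<in>I. kernel (s k) (real (freq \<kappa> k) / real p + real (u k) / real period))"
    unfolding supp_def kernel_def by (rule prod_sum_PiE[symmetric]) auto
  finally have "cmod (weighted_sum \<kappa> u) = cmod (add_char (?t \<otimes> \<kappa>)) *
      cmod (\<Prod>k\<in>I. kernel (s k) (real (freq \<kappa> k) / real p + real (u k) / real period))"
    by (simp only: norm_mult)
  then show ?thesis by (simp add: add_char_def prod_norm)
qed

definition kernel_bound :: real where
  "kernel_bound = (\<Prod>k\<in>I. 2 * real (s k) + 4 * real p * (1 + ln (real p)))"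

lemma sum_weighted_sum: "(\<Sum>\<kappa>\<in>K. cmod (weighted_sum \<kappa> u)) \<le> kernel_bound"
proof -
  define G where "G m = (\<Prod>k\<in>I. cmod (kernel (s k) (real (m k) / real p + real (u k) / real period)))" for m :: "nat \<Rightarrow> nat"
  have G0: "G m \<ge> 0" for m unfolding G_def by (rule prod_nonneg) simp
  have "(\<Sum>\<kappa>\<in>K. cmod (weighted_sum \<kappa> u)) = (\<Sum>\<kappa>\<in>K. G (freq \<kappa>))"
    unfolding G_def by (intro sum.cong refl norm_weighted_sum)
  also have "\<dots> = (\<Sum>m\<in>freq ` K. G m)"
    using sum.reindex[OF freq_inj, of G] by (simp only: o_def)
  also have "\<dots> \<le> (\<Sum>m\<in>(\<Pi>\<^sub>E k\<in>I. {..<p}). G m)"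
    using freq_range by (intro sum_mono2 G0 finite_PiE) auto
  also have "\<dots> = (\<Prod>k\<in>I. \<Sum>m<p. cmod (kernel (s k) (real m / real p + real (u k) / real period)))"
    unfolding G_def by (rule prod_sum_PiE[symmetric]) auto
  also have "\<dots> \<le> kernel_bound"
    unfolding kernel_bound_def using p_pos by (intro prod_mono conjI kernel_sum_bound sum_nonneg) auto
  finally show ?thesis .
qed

abbreviation (input) balanced_quad :: "(nat \<Rightarrow> nat) \<Rightarrow> (nat \<Rightarrow> nat) \<Rightarrow> (nat \<Rightarrow> nat) \<Rightarrow> (nat \<Rightarrow> nat) \<Rightarrow> bool" where
  "balanced_quad a b c d \<equiv> \<forall>k\<in>I. a k + b k = c k + d k"

lemma balanced_quad_fourier:
  assumes "a \<in> supp" "b \<in> supp" "c \<in> supp" "d \<in> supp"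
  shows "(\<Sum>u\<in>(\<Pi>\<^sub>E k\<in>I. {..<period}). (\<Prod>k\<in>I. unit_exp (real (a k) * (real (u k) / real period))) *
      (\<Prod>k\<in>I. unit_exp (real (b k) * (real (u k) / real period))) *
      cnj (\<Prod>k\<in>I. unit_exp (real (c k) * (real (u k) / real period))) *
      cnj (\<Prod>k\<in>I. unit_exp (real (d k) * (real (u k) / real period)))) =
    of_nat period ^ e * of_bool (balanced_quad a b c d)"
proof -
  define n where "n k = int (a k) + int (b k) - int (c k) - int (d k)" for k
  have u: "unit_exp (real x * v) * unit_exp (real y * v) * cnj (unit_exp (real z * v)) * cnj (unit_exp (real w * v)) =
     unit_exp (real_of_int (int x + int y - int z - int w) * v)" for x y z w :: nat and v
    unfolding unit_exp_minus[symmetric] unit_exp_add[symmetric]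
    by (rule arg_cong[where f = unit_exp]) (simp add: algebra_simps)
  have "(\<Sum>u\<in>(\<Pi>\<^sub>E k\<in>I. {..<period}). (\<Prod>k\<in>I. unit_exp (real (a k) * (real (u k) / real period))) *
      (\<Prod>k\<in>I. unit_exp (real (b k) * (real (u k) / real period))) *
      cnj (\<Prod>k\<in>I. unit_exp (real (c k) * (real (u k) / real period))) *
      cnj (\<Prod>k\<in>I. unit_exp (real (d k) * (real (u k) / real period)))) =
    (\<Sum>u\<in>(\<Pi>\<^sub>E k\<in>I. {..<period}). \<Prod>k\<in>I. unit_exp (real_of_int (n k) * (real (u k) / real period)))"
    unfolding cnj_prod prod.distrib[symmetric] u n_def by (rule refl)
  also have "\<dots> = (\<Prod>k\<in>I. \<Sum>x<period. unit_exp (real_of_int (n k) * (real x / real period)))"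
    by (rule prod_sum_PiE[symmetric]) auto
  also have "\<dots> = (\<Prod>k\<in>I. of_nat period * of_bool (n k = 0))"
  proof (rule prod.cong[OF refl])
    fix k assume k: "k \<in> I"
    have "s k \<le> (\<Sum>k\<in>I. s k)" using k by (intro member_le_sum) auto
    then have "2 * s k < period" unfolding period_def sum_distrib_left[symmetric] by simp
    moreover have "a k < s k" "b k < s k" "c k < s k" "d k < s k"
      using assms k unfolding supp_def by (auto dest: PiE_mem)
    ultimately have "\<bar>n k\<bar> < int period" "period > 0" unfolding n_def by linarith+
    then have "(\<Sum>x<period. unit_exp (real x * of_int (n k) / real period)) = of_nat period * of_bool (n k = 0)"
      by (intro sum_unit_exp_roots)
    then show "(\<Sum>x<period. unit_exp (real_of_int (n k) * (real x / real period))) = of_nat period * of_bool (n k = 0)"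
      by (simp only: mult.commute times_divide_eq_right)
  qed
  also have "\<dots> = of_nat period ^ e * of_bool (\<forall>k\<in>I. n k = 0)"
    unfolding prod.distrib of_bool_ball[OF finite_atLeastAtMost] by simp
  also have "(\<forall>k\<in>I. n k = 0) \<longleftrightarrow> balanced_quad a b c d"
    unfolding n_def by (rule ball_cong[OF refl]) linarith
  finally show ?thesis .
qed

definition quads :: "((nat \<Rightarrow> nat) \<times> (nat \<Rightarrow> nat) \<times> (nat \<Rightarrow> nat) \<times> (nat \<Rightarrow> nat)) set" where
  "quads = {i \<in> supp \<times> supp \<times> supp \<times> supp.
    balanced_quad (fst i) (fst (snd i)) (fst (snd (snd i))) (snd (snd (snd i)))}"

abbreviation "phase \<equiv> phase_sum quads (\<lambda>i. point (fst i)) (\<lambda>i. point (fst (snd i)))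
  (\<lambda>i. point (fst (snd (snd i)))) (\<lambda>i. point (snd (snd (snd i))))"

lemma finite_quads: "finite quads"
  unfolding quads_def using finite_supp by simp

lemma sum_quads:
  fixes f :: "_ \<Rightarrow> _ \<Rightarrow> _ \<Rightarrow> _ \<Rightarrow> 'd::semiring_1"
  shows "(\<Sum>i\<in>quads. f (fst i) (fst (snd i)) (fst (snd (snd i))) (snd (snd (snd i)))) =
    (\<Sum>a\<in>supp. \<Sum>b\<in>supp. \<Sum>c\<in>supp. \<Sum>d\<in>supp. of_bool (balanced_quad a b c d) * f a b c d)"
proof -
  have fin: "finite (supp \<times> supp \<times> supp \<times> supp)" using finite_supp by simp
  show ?thesis unfolding quads_def sum_Collect_of_bool[OF fin]
    by (rule sum_quadruples[of "\<lambda>a b c d. of_bool (balanced_quad a b c d) * f a b c d"])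
qed

text \<open>Detecting balance by a sum over u replaces the constraint on four support points by a
  product of four independent sums.\<close>

lemma phase_fourier:
  "of_nat period ^ e * phase k l m n =
    (\<Sum>u\<in>(\<Pi>\<^sub>E k\<in>I. {..<period}). weighted_sum k u * weighted_sum l u * cnj (weighted_sum m u) * cnj (weighted_sum n u))"
proof -
  define E where "E a u = (\<Prod>k\<in>I. unit_exp (real (a k) * (real (u k) / real period)))" for a u :: "nat \<Rightarrow> nat"
  define A where "A a \<kappa> = add_char (point a \<otimes> \<kappa>)" for a \<kappa>
  let ?U = "\<Pi>\<^sub>E k\<in>I. {..<period}"
  have w: "weighted_sum \<kappa> u = (\<Sum>a\<in>supp. A a \<kappa> * E a u)" for \<kappa> u
    unfolding weighted_sum_def A_def E_def ..
  have "(\<Sum>u\<in>?U. weighted_sum k u * weighted_sum l u * cnj (weighted_sum m u) * cnj (weighted_sum n u)) =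
     (\<Sum>u\<in>?U. \<Sum>a\<in>supp. \<Sum>b\<in>supp. \<Sum>c\<in>supp. \<Sum>d\<in>supp.
        (A a k * E a u) * (A b l * E b u) * cnj (A c m * E c u) * cnj (A d n * E d u))"
    unfolding w cnj_sum sum_mult4 by (rule refl)
  also have "\<dots> = (\<Sum>u\<in>?U. \<Sum>a\<in>supp. \<Sum>b\<in>supp. \<Sum>c\<in>supp. \<Sum>d\<in>supp.
        (A a k * A b l * cnj (A c m) * cnj (A d n)) * (E a u * E b u * cnj (E c u) * cnj (E d u)))"
    by (simp only: complex_cnj_mult mult_ac)
  also have "\<dots> = (\<Sum>a\<in>supp. \<Sum>b\<in>supp. \<Sum>c\<in>supp. \<Sum>d\<in>supp. \<Sum>u\<in>?U.
        (A a k * A b l * cnj (A c m) * cnj (A d n)) * (E a u * E b u * cnj (E c u) * cnj (E d u)))"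
    by (subst sum.swap, rule sum.cong[OF refl], subst sum.swap, rule sum.cong[OF refl],
        subst sum.swap, rule sum.cong[OF refl], rule sum.swap)
  also have "\<dots> = (\<Sum>a\<in>supp. \<Sum>b\<in>supp. \<Sum>c\<in>supp. \<Sum>d\<in>supp.
        (A a k * A b l * cnj (A c m) * cnj (A d n)) * (of_nat period ^ e * of_bool (balanced_quad a b c d)))"
  proof (intro sum.cong refl)
    fix a b c d assume abcd: "a \<in> supp" "b \<in> supp" "c \<in> supp" "d \<in> supp"
    show "(\<Sum>u\<in>?U. (A a k * A b l * cnj (A c m) * cnj (A d n)) * (E a u * E b u * cnj (E c u) * cnj (E d u))) =
      (A a k * A b l * cnj (A c m) * cnj (A d n)) * (of_nat period ^ e * of_bool (balanced_quad a b c d))"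
      unfolding sum_distrib_left[symmetric] E_def balanced_quad_fourier[OF abcd] by (rule refl)
  qed
  also have "\<dots> = (\<Sum>a\<in>supp. \<Sum>b\<in>supp. \<Sum>c\<in>supp. \<Sum>d\<in>supp.
        of_nat period ^ e * (of_bool (balanced_quad a b c d) * (A a k * A b l * cnj (A c m) * cnj (A d n))))"
    by (intro sum.cong refl) (simp only: mult_ac)
  also have "\<dots> = of_nat period ^ e * phase k l m n"
    unfolding phase_sum_def sum_quads[of "\<lambda>a b c d. add_char (point a \<otimes> k) * add_char (point b \<otimes> l) *
        cnj (add_char (point c \<otimes> m)) * cnj (add_char (point d \<otimes> n))"] A_def sum_distrib_left by (rule refl)
  finally show ?thesis by (rule sym)
qed

text \<open>For each u the sum over four frequencies is a fourth power, which
  \<open>sum_weighted_sum\<close> bounds uniformly in u; averaging over u therefore costs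
  nothing.\<close>

lemma sum_phase_bound:
  "(\<Sum>k\<in>K. \<Sum>l\<in>K. \<Sum>m\<in>K. \<Sum>n\<in>K. cmod (phase k l m n)) \<le> kernel_bound ^ 4"
proof -
  let ?U = "\<Pi>\<^sub>E k\<in>I. {..<period}"
  have card_U: "real (card ?U) = real period ^ e" by (simp add: card_PiE)
  have "period > 0" by (simp add: period_def)
  then have P: "real period ^ e > 0" by simp
  have "real period ^ e * (\<Sum>k\<in>K. \<Sum>l\<in>K. \<Sum>m\<in>K. \<Sum>n\<in>K. cmod (phase k l m n)) =
     (\<Sum>k\<in>K. \<Sum>l\<in>K. \<Sum>m\<in>K. \<Sum>n\<in>K. cmod (of_nat period ^ e * phase k l m n))"
    by (simp only: sum_distrib_left norm_mult norm_power norm_of_nat)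
  also have "\<dots> \<le> (\<Sum>k\<in>K. \<Sum>l\<in>K. \<Sum>m\<in>K. \<Sum>n\<in>K. \<Sum>u\<in>?U.
      cmod (weighted_sum k u) * cmod (weighted_sum l u) * cmod (weighted_sum m u) * cmod (weighted_sum n u))"
    unfolding phase_fourier by (intro sum_mono order.trans[OF norm_sum]) (simp add: norm_mult)
  also have "\<dots> = (\<Sum>u\<in>?U. \<Sum>k\<in>K. \<Sum>l\<in>K. \<Sum>m\<in>K. \<Sum>n\<in>K.
      cmod (weighted_sum k u) * cmod (weighted_sum l u) * cmod (weighted_sum m u) * cmod (weighted_sum n u))"
    by (simp only: sum.swap[of _ K ?U])
  also have "\<dots> = (\<Sum>u\<in>?U. (\<Sum>k\<in>K. cmod (weighted_sum k u)) ^ 4)"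
    unfolding sum_power4 by (rule refl)
  also have "\<dots> \<le> (\<Sum>u\<in>?U. kernel_bound ^ 4)"
    by (intro sum_mono power_mono sum_weighted_sum sum_nonneg) simp
  also have "\<dots> = real period ^ e * kernel_bound ^ 4" by (simp only: sum_constant card_U)
  finally show ?thesis using P by (rule mult_left_le_imp_le)
qed

lemma sum_supp_4:
  fixes f :: "nat \<Rightarrow> nat \<Rightarrow> nat \<Rightarrow> nat \<Rightarrow> nat \<Rightarrow> bool"
  shows "(\<Sum>a\<in>supp. \<Sum>b\<in>supp. \<Sum>c\<in>supp. \<Sum>d\<in>supp. of_bool (balanced_quad a b c d) * of_bool (\<forall>k\<in>I. f k (a k) (b k) (c k) (d k))) =
    (\<Prod>k\<in>I. \<Sum>x<s k. \<Sum>y<s k. \<Sum>z<s k. \<Sum>w<s k. of_bool (x + y = z + w) * (of_bool (f k x y z w) :: real))"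
  unfolding of_bool_ball[OF finite_atLeastAtMost] prod.distrib[symmetric] supp_def
  by (rule sum_PiE_4) auto

lemma card_quads_Collect:
  "real (card {i \<in> quads. f (fst i) (fst (snd i)) (fst (snd (snd i))) (snd (snd (snd i)))}) =
   (\<Sum>a\<in>supp. \<Sum>b\<in>supp. \<Sum>c\<in>supp. \<Sum>d\<in>supp. of_bool (balanced_quad a b c d) * of_bool (f a b c d))"
  unfolding card_Collect_of_bool[OF finite_quads] by (rule sum_quads[of "\<lambda>a b c d. of_bool (f a b c d)"])

text \<open>The pairings X = Z and X = V give the same energy, hence the factor 2; the third, X + Y
  = 0, sees the translation. The number of all quadruples is the energy for modulus 1.\<close>

theorem fourth_moment_approx:
  "real q ^ 3 * \<bar>(\<Sum>a\<in>supp. \<Sum>b\<in>supp. \<Sum>c\<in>supp. \<Sum>d\<in>supp. of_bool (balanced_quad a b c d) *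
        (\<eta> (point a) * \<eta> (point b) * \<eta> (point c) * \<eta> (point d)))
      - (2 * (\<Prod>k\<in>I. energy (s k) p 0) + (\<Prod>k\<in>I. energy (s k) p (- (int (s k) - 1 + 2 * t k)))
         - 2 * (\<Prod>k\<in>I. energy (s k) 1 0) / real q)\<bar>
    \<le> 5 * beta * kernel_bound ^ 4"
proof -
  have c1: "real (card {i \<in> quads. point (fst i) = point (fst (snd (snd i)))}) = (\<Prod>k\<in>I. energy (s k) p 0)"
    unfolding card_quads_Collect[of "\<lambda>a b c d. point a = point c"]
    unfolding point_eq_iff
      sum_supp_4[of "\<lambda>k x y z w. int p dvd int x - int z"] energy_def by (simp only: diff_0_right)
  have c2: "real (card {i \<in> quads. point (fst i) = point (snd (snd (snd i)))}) = (\<Prod>k\<in>I. energy (s k) p 0)"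
    unfolding card_quads_Collect[of "\<lambda>a b c d. point a = point d"]
    unfolding point_eq_iff
      sum_supp_4[of "\<lambda>k x y z w. int p dvd int x - int w"] energy_swap by (rule refl)
  have c3: "real (card {i \<in> quads. point (fst i) \<oplus> point (fst (snd i)) = \<zero>}) =
      (\<Prod>k\<in>I. energy (s k) p (- (int (s k) - 1 + 2 * t k)))"
    unfolding card_quads_Collect[of "\<lambda>a b c d. point a \<oplus> point b = \<zero>"]
    unfolding point_add_eq_zero_iff
      sum_supp_4[of "\<lambda>k x y z w. int p dvd int x + int y + 2 * t k"] energy_sum_congruence by (rule refl)
  have c0: "real (card quads) = (\<Prod>k\<in>I. energy (s k) 1 0)"
  proof -
    have "real (card {i \<in> quads. True}) = (\<Prod>k\<in>I. \<Sum>x<s k. \<Sum>y<s k. \<Sum>z<s k. \<Sum>w<s k. of_bool (x + y = z + w) * (of_bool True :: real))"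
      using card_quads_Collect[of "\<lambda>a b c d. True"] sum_supp_4[of "\<lambda>k x y z w. True"] by simp
    then show ?thesis by (simp add: energy_def)
  qed
  have main: "real q ^ 3 * \<bar>(\<Sum>i\<in>quads. \<eta> (point (fst i)) * \<eta> (point (fst (snd i))) *
        \<eta> (point (fst (snd (snd i)))) * \<eta> (point (snd (snd (snd i))))) -
      (real (card {i \<in> quads. point (fst i) = point (fst (snd (snd i)))}) +
       real (card {i \<in> quads. point (fst i) = point (snd (snd (snd i)))}) +
       real (card {i \<in> quads. point (fst i) \<oplus> point (fst (snd i)) = \<zero>}) - 2 * real (card quads) / real q)\<bar>
     \<le> 5 * beta * (\<Sum>k\<in>K. \<Sum>l\<in>K. \<Sum>m\<in>K. \<Sum>n\<in>K. cmod (phase k l m n))"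
  proof (rule char_sum_approx[OF finite_quads point_closed point_closed point_closed point_closed])
    fix i assume "i \<in> quads"
    then have b: "balanced_quad (fst i) (fst (snd i)) (fst (snd (snd i))) (snd (snd (snd i)))"
      unfolding quads_def by blast
    show "point (fst i) \<oplus> point (fst (snd i)) = point (fst (snd (snd i))) \<oplus> point (snd (snd (snd i)))"
      unfolding point_add
    proof (intro arg_cong[where f = \<alpha>] restrict_ext)
      fix k assume "k \<in> I"
      then have "fst i k + fst (snd i) k = fst (snd (snd i)) k + snd (snd (snd i)) k" using b by blast
      then show "int (fst i k) + int (fst (snd i) k) + 2 * t k =
        int (fst (snd (snd i)) k) + int (snd (snd (snd i)) k) + 2 * t k" by linarith
    qed
  qed
  have "5 * beta * (\<Sum>k\<in>K. \<Sum>l\<in>K. \<Sum>m\<in>K. \<Sum>n\<in>K. cmod (phase k l m n)) \<le> 5 * beta * kernel_bound ^ 4"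
    using beta_ge_1 by (intro mult_left_mono sum_phase_bound) simp
  from order.trans[OF main this] show ?thesis
    unfolding c0 c1 c2 c3 sum_quads[of "\<lambda>a b c d. \<eta> (point a) * \<eta> (point b) * \<eta> (point c) * \<eta> (point d)"]
    by (simp only: mult_2)
qed

text \<open>The square of \<eta> is 1 away from 0, so the sum counts the support points that are not
  mapped to 0.\<close>

lemma second_moment:
  "(\<Sum>a\<in>supp. \<Sum>b\<in>supp. \<eta> (point a) * \<eta> (point b) * of_bool (\<forall>k\<in>I. a k = b k)) =
    (\<Prod>k\<in>I. real (s k)) - (\<Prod>k\<in>I. \<Sum>x<s k. of_bool (int p dvd int x + t k))"
proof -
  have "(\<Sum>a\<in>supp. \<Sum>b\<in>supp. \<eta> (point a) * \<eta> (point b) * of_bool (\<forall>k\<in>I. a k = b k)) =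
     (\<Sum>a\<in>supp. 1 - of_bool (point a = \<zero>))"
  proof (rule sum.cong[OF refl])
    fix a assume a: "a \<in> supp"
    have "(\<Sum>b\<in>supp. \<eta> (point a) * \<eta> (point b) * of_bool (\<forall>k\<in>I. a k = b k)) =
       (\<Sum>b\<in>supp. if a = b then \<eta> (point a) * \<eta> (point b) else 0)"
    proof (rule sum.cong[OF refl])
      fix b assume b: "b \<in> supp"
      have iff: "(\<forall>k\<in>I. a k = b k) \<longleftrightarrow> a = b"
        using PiE_ext[of a I "\<lambda>k. {..<s k}" b] a b unfolding supp_def by blast
      show "\<eta> (point a) * \<eta> (point b) * of_bool (\<forall>k\<in>I. a k = b k) =
          (if a = b then \<eta> (point a) * \<eta> (point b) else 0)"
        unfolding iff by (cases "a = b") simp_all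
    qed
    also have "\<dots> = \<eta> (point a) * \<eta> (point a)" using a finite_supp by (simp add: sum.delta)
    also have "\<dots> = 1 - of_bool (point a = \<zero>)"
      using eta_sq[OF point_closed, of a] by (cases "point a = \<zero>") (auto simp: power2_eq_square)
    finally show "(\<Sum>b\<in>supp. \<eta> (point a) * \<eta> (point b) * of_bool (\<forall>k\<in>I. a k = b k)) = 1 - of_bool (point a = \<zero>)" .
  qed
  also have "\<dots> = real (card supp) - (\<Sum>a\<in>supp. of_bool (point a = \<zero>))" by (simp add: sum_subtractf)
  also have "real (card supp) = (\<Prod>k\<in>I. real (s k))" unfolding supp_def by (simp add: card_PiE)
  also have "(\<Sum>a\<in>supp. of_bool (point a = \<zero>)) = (\<Prod>k\<in>I. \<Sum>x<s k. of_bool (int p dvd int x + t k) :: real)"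
    unfolding point_eq_zero_iff of_bool_ball[OF finite_atLeastAtMost] supp_def
    by (rule prod_sum_PiE[symmetric]) auto
  finally show ?thesis .
qed

end

end

section \<open>The limit of the norm ratio\<close>

lemma quadratic_character_real:
  assumes "quadratic_character F \<psi>" "Ring.field F" "x \<in> carrier F"
  shows "\<psi> x = of_real (Re (\<psi> x))" and "x \<noteq> \<zero>\<^bsub>F\<^esub> \<Longrightarrow> \<psi> x = 1 \<or> \<psi> x = - 1"
proof -
  have nt: "nontrivial_mult_character F \<psi>" and sq: "\<forall>x\<in>carrier (mult_of F). \<psi> x ^ 2 = 1"
    using assms(1) by (auto simp: quadratic_character_def)
  show pm: "\<psi> x = 1 \<or> \<psi> x = - 1" if "x \<noteq> \<zero>\<^bsub>F\<^esub>"
    using sq that assms(3) by (auto simp: power2_eq_1_iff)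
  have "\<psi> \<zero>\<^bsub>F\<^esub> = 0" using nt by (simp add: nontrivial_mult_character_def)
  then show "\<psi> x = of_real (Re (\<psi> x))" using pm by (cases "x = \<zero>\<^bsub>F\<^esub>") auto
qed

lemma quadratic_char_poly_arranged:
  assumes "quadratic_char_poly e f" "e \<ge> 1"
  shows "arranged_quadratic (base_field f) (base_prime f) e (arrangement f) (\<lambda>x. Re (mult_char f x))"
proof -
  let ?F = "base_field f" and ?\<psi> = "mult_char f"
  have mp: "mult_char_poly e f" and qc: "quadratic_character ?F ?\<psi>"
    using assms(1) by (auto simp: quadratic_char_poly_def)
  have pr: "prime (base_prime f)" and fd: "Ring.field ?F" and cd: "card (carrier ?F) = base_prime f ^ e"
    and nt: "nontrivial_mult_character ?F ?\<psi>" and ep: "arrangement f \<in> epi (int_vectors e) (add_monoid ?F)"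
    using mp unfolding mult_char_poly_def by blast+
  have z: "?\<psi> \<zero>\<^bsub>?F\<^esub> = 0" and h: "?\<psi> \<in> hom (mult_of ?F) complex_units"
    and ex: "\<exists>x\<in>carrier (mult_of ?F). ?\<psi> x \<noteq> 1"
    using nt by (auto simp: nontrivial_mult_character_def)
  interpret Ring.field ?F by (rule fd)
  note real = quadratic_character_real(1)[OF qc fd] and pm = quadratic_character_real(2)[OF qc fd]
  interpret A: arranged_field ?F "base_prime f" e "arrangement f"
    by standard (use pr cd ep assms(2) in auto)
  have mult: "?\<psi> (x \<otimes>\<^bsub>?F\<^esub> y) = ?\<psi> x * ?\<psi> y" if "x \<in> carrier ?F" "y \<in> carrier ?F" for x y
  proof (cases "x = \<zero>\<^bsub>?F\<^esub> \<or> y = \<zero>\<^bsub>?F\<^esub>")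
    case True
    then show ?thesis using that z by auto
  next
    case False
    then have "x \<in> carrier (mult_of ?F)" "y \<in> carrier (mult_of ?F)" using that by auto
    then have "?\<psi> (x \<otimes>\<^bsub>mult_of ?F\<^esub> y) = ?\<psi> x \<otimes>\<^bsub>complex_units\<^esub> ?\<psi> y" using h by (simp add: hom_def)
    then show ?thesis by (simp add: complex_units_def)
  qed
  show ?thesis
  proof
    show "finite (carrier ?F)" by (rule A.finite_K)
    show "Re (?\<psi> \<zero>\<^bsub>?F\<^esub>) = 0" by (simp add: z)
    show "Re (?\<psi> (x \<otimes>\<^bsub>?F\<^esub> y)) = Re (?\<psi> x) * Re (?\<psi> y)" if "x \<in> carrier ?F" "y \<in> carrier ?F" for x y
      unfolding mult[OF that] by (subst real[OF that(1)], subst real[OF that(2)]) simp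
    show "(Re (?\<psi> x))\<^sup>2 = 1" if "x \<in> carrier ?F" "x \<noteq> \<zero>\<^bsub>?F\<^esub>" for x
      using pm[OF that] by auto
    obtain g where g: "g \<in> carrier (mult_of ?F)" "?\<psi> g \<noteq> 1" using ex by blast
    then have "?\<psi> g = - 1" using pm[of g] by auto
    then show "\<exists>g\<in>carrier ?F. Re (?\<psi> g) = - 1" using g by (intro bexI[of _ g]) auto
  qed
qed

text \<open>Within one residue class x is determined by x div p.\<close>

lemma congruence_count_le:
  assumes "p > 0"
  shows "(\<Sum>x<s. of_bool (int p dvd int x + t)) \<le> real s / real p + 1"
proof -
  let ?A = "{x \<in> {..<s}. int p dvd int x + t}"
  have "(\<Sum>x<s. of_bool (int p dvd int x + t)) = real (card ?A)"
    using card_Collect_of_bool[of "{..<s}" "\<lambda>x. int p dvd int x + t"] by simp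
  also have "card ?A \<le> card {..s div p}"
  proof (rule card_inj_on_le)
    show "inj_on (\<lambda>x. x div p) ?A"
    proof (rule inj_onI)
      fix x y assume xy: "x \<in> ?A" "y \<in> ?A" "x div p = y div p"
      then have "int p dvd (int x + t) - (int y + t)" by (intro dvd_diff) auto
      then have "int x mod int p = int y mod int p" by (simp add: mod_eq_dvd_iff)
      then have "x mod p = y mod p" by (simp add: zmod_int[symmetric])
      then show "x = y" using xy(3) by (metis div_mult_mod_eq)
    qed
    show "(\<lambda>x. x div p) ` ?A \<subseteq> {..s div p}" by (auto intro: div_le_mono)
  qed simp
  also have "real (card {..s div p}) \<le> real s / real p + 1"
    using of_nat_div_le_of_nat[of s p] by (simp add: add.commute)
  finally show ?thesis by simp
qed

lemma poly_value_trig_poly: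
  assumes "quadratic_char_poly e f" "e \<ge> 1"
  shows "poly_value e f = trig_poly e (\<Pi>\<^sub>E k\<in>{1..e}. {..<support_size f k})
    (\<lambda>j. Re (mult_char f (arrangement f (\<lambda>k\<in>{1..e}. int (j k) + translation f k))))"
proof
  fix z :: "nat \<Rightarrow> complex"
  interpret arranged_quadratic "base_field f" "base_prime f" e "arrangement f" "\<lambda>x. Re (mult_char f x)"
    by (rule quadratic_char_poly_arranged[OF assms])
  have qc: "quadratic_character (base_field f) (mult_char f)"
    using assms(1) by (auto simp: quadratic_char_poly_def)
  have r: "mult_char f (arrangement f (\<lambda>k\<in>{1..e}. int (j k) + translation f k)) =
     of_real (Re (mult_char f (arrangement f (\<lambda>k\<in>{1..e}. int (j k) + translation f k))))" for j
    by (rule quadratic_character_real(1)[OF qc field_axioms alpha_closed[OF lattice_closed]])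
  show "poly_value e f z = trig_poly e (\<Pi>\<^sub>E k\<in>{1..e}. {..<support_size f k})
    (\<lambda>j. Re (mult_char f (arrangement f (\<lambda>k\<in>{1..e}. int (j k) + translation f k)))) z"
    unfolding poly_value_def trig_poly_def support_def atLeast0LessThan
    by (rule sum.cong[OF refl], subst r, rule refl)
qed

lemma norms_approx:
  assumes "quadratic_char_poly e f" "e \<ge> 1"
  defines "p \<equiv> base_prime f" and "s \<equiv> support_size f" and "t \<equiv> translation f"
  shows "p > 1" and "\<And>k. k \<in> {1..e} \<Longrightarrow> s k \<ge> 1"
    and "real (p ^ e) ^ 3 * \<bar>torus_norm e 4 (poly_value e f) ^ 4 -
      (2 * (\<Prod>k\<in>{1..e}. energy (s k) p 0) + (\<Prod>k\<in>{1..e}. energy (s k) p (- (int (s k) - 1 + 2 * t k)))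
         - 2 * (\<Prod>k\<in>{1..e}. energy (s k) 1 0) / real (p ^ e))\<bar>
      \<le> 5 * real (p ^ e) powr (3 / 4) * (\<Prod>k\<in>{1..e}. 2 * real (s k) + 4 * real p * (1 + ln (real p))) ^ 4"
    and "torus_norm e 2 (poly_value e f) ^ 2 =
      (\<Prod>k\<in>{1..e}. real (s k)) - (\<Prod>k\<in>{1..e}. \<Sum>x<s k. of_bool (int p dvd int x + t k))"
proof -
  interpret arranged_quadratic "base_field f" p e "arrangement f" "\<lambda>x. Re (mult_char f x)"
    unfolding p_def by (rule quadratic_char_poly_arranged[OF assms(1,2)])
  show "p > 1" by (rule p_gt_1)
  have "mult_char_poly e f" using assms(1) by (simp add: quadratic_char_poly_def)
  then show s_pos: "\<And>k. k \<in> {1..e} \<Longrightarrow> s k \<ge> 1"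
    unfolding mult_char_poly_def s_def by blast
  have S: "supp s = (\<Pi>\<^sub>E k\<in>{1..e}. {..<support_size f k})" by (simp only: supp_def s_def)
  have pt: "arrangement f (\<lambda>k\<in>{1..e}. int (j k) + translation f k) = point t j" for j
    by (simp only: point_def t_def)
  have pv: "poly_value e f = trig_poly e (supp s) (\<lambda>j. Re (mult_char f (point t j)))"
    unfolding poly_value_trig_poly[OF assms(1,2)] pt S by (rule refl)
  have fin: "finite (supp s)" by (rule finite_supp)
  have "torus_norm e 4 (poly_value e f) ^ 4 = (\<Sum>a\<in>supp s. \<Sum>b\<in>supp s. \<Sum>c\<in>supp s. \<Sum>d\<in>supp s.
      of_bool (\<forall>k\<in>{1..e}. a k + b k = c k + d k) *
        (Re (mult_char f (point t a)) * Re (mult_char f (point t b)) * Re (mult_char f (point t c)) * Re (mult_char f (point t d))))"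
    unfolding pv torus_norm_4[OF fin] by (simp only: mult.commute)
  then show "real (p ^ e) ^ 3 * \<bar>torus_norm e 4 (poly_value e f) ^ 4 -
      (2 * (\<Prod>k\<in>{1..e}. energy (s k) p 0) + (\<Prod>k\<in>{1..e}. energy (s k) p (- (int (s k) - 1 + 2 * t k)))
         - 2 * (\<Prod>k\<in>{1..e}. energy (s k) 1 0) / real (p ^ e))\<bar>
      \<le> 5 * real (p ^ e) powr (3 / 4) * (\<Prod>k\<in>{1..e}. 2 * real (s k) + 4 * real p * (1 + ln (real p))) ^ 4"
    using fourth_moment_approx[where s = s and t = t] unfolding beta_def kernel_bound_def card_carrier by (simp only:)
  show "torus_norm e 2 (poly_value e f) ^ 2 =
      (\<Prod>k\<in>{1..e}. real (s k)) - (\<Prod>k\<in>{1..e}. \<Sum>x<s k. of_bool (int p dvd int x + t k))"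
    unfolding pv torus_norm_2[OF fin] by (rule second_moment)
qed

text \<open>The exponent 1/16 is a quarter of 1/4 = 1 - 3/4: in each coordinate the saving p^(-1/4)
  must absorb the fourth power of a logarithm.\<close>

lemma powr_ln_decay: "((\<lambda>x::real. (4 + 4 * ln x) * x powr (- 1 / 16)) \<longlongrightarrow> 0) at_top"
  by real_asymp

text \<open>The main term of the fourth moment divided by the square of the product of the sizes,
  with 1 / q distributed as 1 / p over the coordinates.\<close>

definition main_term :: "nat \<Rightarrow> nat \<Rightarrow> (nat \<Rightarrow> nat) \<Rightarrow> (nat \<Rightarrow> int) \<Rightarrow> real" where
  "main_term e p s t = 2 * (\<Prod>k\<in>{1..e}. \<Omega> (real p / real (s k)) 0)
    + (\<Prod>k\<in>{1..e}. \<Omega> (real p / real (s k)) ((real (s k) - 1 + 2 * of_int (t k)) / real (s k)))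
    - 2 * (\<Prod>k\<in>{1..e}. \<Omega> (1 / real (s k)) 0 / real p)"

definition error_term :: "nat \<Rightarrow> nat \<Rightarrow> (nat \<Rightarrow> nat) \<Rightarrow> real" where
  "error_term e p s = 5 * (\<Prod>k\<in>{1..e}. ((2 * (real (s k) / real p) + 4 + 4 * ln (real p)) * real p powr (- 1 / 16)) ^ 4
     * (real p / real (s k))\<^sup>2)"

text \<open>Exponents of p in one coordinate: 3/4 + 4 on the left and 3 + 2 - 1/4 on the right,
  where p^2 arises as s^2 (p / s)^2.\<close>

lemma normalized_error:
  assumes "p > (1::nat)" "\<And>k. k \<in> {1..e} \<Longrightarrow> s k \<ge> 1"
  shows "5 * real (p ^ e) powr (3 / 4) * (\<Prod>k\<in>{1..e}. 2 * real (s k) + 4 * real (p) * (1 + ln (real (p)))) ^ 4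
     = real (p ^ e) ^ 3 * (\<Prod>k\<in>{1..e}. real (s k))\<^sup>2 * error_term e p s"
proof -
  define x where "x = real (p)"
  have x: "x > 1" using assms(1) by (simp add: x_def)
  have q: "real (p ^ e) powr (3 / 4) = (\<Prod>k\<in>{1..e}. x powr (3 / 4))"
    using x by (simp add: x_def powr_power powr_realpow[symmetric] powr_powr mult.commute)
  have q3: "real (p ^ e) ^ 3 = (\<Prod>k\<in>{1..e}. x ^ 3)"
    by (simp add: x_def power_mult[symmetric] mult.commute)
  have factor: "x powr (3 / 4) * (2 * y + 4 * x * (1 + ln x)) ^ 4 =
      x ^ 3 * (y\<^sup>2 * (((2 * (y / x) + 4 + 4 * ln x) * x powr (- 1 / 16)) ^ 4 * (x / y)\<^sup>2))" if "y > 0" for y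
  proof -
    have "2 * y + 4 * x * (1 + ln x) = x * (2 * (y / x) + 4 + 4 * ln x)"
      using x by (simp add: algebra_simps)
    then have f1: "(2 * y + 4 * x * (1 + ln x)) ^ 4 = x ^ 4 * (2 * (y / x) + 4 + 4 * ln x) ^ 4"
      by (simp only: power_mult_distrib)
    have f2: "(x powr (- 1 / 16)) ^ 4 = x powr (- 1 / 4)" using x by (simp add: powr_power)
    have f3: "x powr (3 / 4) * x ^ 4 = x ^ 3 * (x powr (- 1 / 4) * x\<^sup>2)"
    proof -
      have "x ^ 4 = x powr 4" "x ^ 3 = x powr 3" "x\<^sup>2 = x powr 2" using x by simp_all
      then show ?thesis by (simp only: powr_add[symmetric]) simp
    qed
    have f4: "y\<^sup>2 * (x / y)\<^sup>2 = x\<^sup>2" using that by (simp add: power_divide)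
    have "x powr (3 / 4) * (2 * y + 4 * x * (1 + ln x)) ^ 4 =
        (x powr (3 / 4) * x ^ 4) * (2 * (y / x) + 4 + 4 * ln x) ^ 4"
      unfolding f1 by (rule mult.assoc[symmetric])
    also have "\<dots> = x ^ 3 * ((y\<^sup>2 * (x / y)\<^sup>2) * ((2 * (y / x) + 4 + 4 * ln x) ^ 4 * (x powr (- 1 / 16)) ^ 4))"
      unfolding f2 f3 f4 by (simp only: mult_ac)
    also have "\<dots> = x ^ 3 * (y\<^sup>2 * (((2 * (y / x) + 4 + 4 * ln x) * x powr (- 1 / 16)) ^ 4 * (x / y)\<^sup>2))"
      by (simp only: power_mult_distrib mult_ac)
    finally show ?thesis .
  qed
  have "real (p ^ e) powr (3 / 4) * (\<Prod>k\<in>{1..e}. 2 * real (s k) + 4 * real (p) * (1 + ln (real (p)))) ^ 4 =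
     (\<Prod>k\<in>{1..e}. x powr (3 / 4) * (2 * real (s k) + 4 * x * (1 + ln x)) ^ 4)"
    unfolding q prod_power_distrib prod.distrib x_def by (rule refl)
  also have "\<dots> = (\<Prod>k\<in>{1..e}. x ^ 3 * ((real (s k))\<^sup>2 *
      (((2 * (real (s k) / x) + 4 + 4 * ln x) * x powr (- 1 / 16)) ^ 4 * (x / real (s k))\<^sup>2)))"
    using assms(2) by (intro prod.cong refl factor) force
  finally have "real (p ^ e) powr (3 / 4) * (\<Prod>k\<in>{1..e}. 2 * real (s k) + 4 * real (p) * (1 + ln (real (p)))) ^ 4 =
     real (p ^ e) ^ 3 * ((\<Prod>k\<in>{1..e}. real (s k))\<^sup>2 *
       (\<Prod>k\<in>{1..e}. ((2 * (real (s k) / x) + 4 + 4 * ln x) * x powr (- 1 / 16)) ^ 4 * (x / real (s k))\<^sup>2))"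
    by (simp only: prod.distrib prod_power_distrib q3)
  then show ?thesis unfolding error_term_def x_def by (simp add: algebra_simps)
qed

text \<open>Separates the asymptotics from the algebra: only the numbers p, s, t enter, along an
  arbitrary filter.\<close>

locale growing_family =
  fixes e :: nat and p :: "'i \<Rightarrow> nat" and s :: "'i \<Rightarrow> nat \<Rightarrow> nat" and t :: "'i \<Rightarrow> nat \<Rightarrow> int"
    and F :: "'i filter" and \<sigma> \<tau> :: "nat \<Rightarrow> real"
  assumes e_pos: "e \<ge> 1"
    and p_lim: "filterlim (\<lambda>i. real (p i)) at_top F"
    and \<sigma>_pos: "\<And>k. k \<in> {1..e} \<Longrightarrow> \<sigma> k > 0"
    and \<sigma>_lim: "\<And>k. k \<in> {1..e} \<Longrightarrow> ((\<lambda>i. real (s i k) / real (p i)) \<longlongrightarrow> \<sigma> k) F"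
    and \<tau>_lim: "\<And>k. k \<in> {1..e} \<Longrightarrow> ((\<lambda>i. real_of_int (t i k) / real (p i)) \<longlongrightarrow> \<tau> k) F"
    and ev: "\<forall>\<^sub>F i in F. p i > 1 \<and> (\<forall>k\<in>{1..e}. s i k \<ge> 1)"
begin

lemma inverse_p_lim: "((\<lambda>i. 1 / real (p i)) \<longlongrightarrow> 0) F"
  using tendsto_inverse_0_at_top[OF p_lim] by (simp add: inverse_eq_divide)

lemma ratio_inverse_lim:
  assumes "k \<in> {1..e}" shows "((\<lambda>i. real (p i) / real (s i k)) \<longlongrightarrow> 1 / \<sigma> k) F"
  using tendsto_inverse[OF \<sigma>_lim[OF assms]] \<sigma>_pos[OF assms] by (simp add: inverse_eq_divide)

lemma inverse_s_lim:
  assumes "k \<in> {1..e}" shows "((\<lambda>i. 1 / real (s i k)) \<longlongrightarrow> 0) F"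
proof -
  have "((\<lambda>i. 1 / real (p i) * (real (p i) / real (s i k))) \<longlongrightarrow> 0 * (1 / \<sigma> k)) F"
    by (intro tendsto_mult inverse_p_lim ratio_inverse_lim assms)
  moreover have "\<forall>\<^sub>F i in F. 1 / real (p i) * (real (p i) / real (s i k)) = 1 / real (s i k)"
    using ev by eventually_elim simp
  ultimately show ?thesis using Lim_transform_eventually by fastforce
qed

lemma main_term_lim: "((\<lambda>i. main_term e (p i) (s i) (t i)) \<longlongrightarrow> limit_ratio e \<sigma> \<tau>) F"
proof -
  have a: "((\<lambda>i. \<Omega> (real (p i) / real (s i k)) 0) \<longlongrightarrow> \<Omega> (1 / \<sigma> k) 0) F" if k: "k \<in> {1..e}" for k
    by (rule tendsto_\<Omega>[OF ratio_inverse_lim[OF k] tendsto_const]) (use \<sigma>_pos[OF k] in simp)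
  have b: "((\<lambda>i. \<Omega> (real (p i) / real (s i k)) ((real (s i k) - 1 + 2 * of_int (t i k)) / real (s i k)))
     \<longlongrightarrow> \<Omega> (1 / \<sigma> k) (1 + 2 * \<tau> k / \<sigma> k)) F" if k: "k \<in> {1..e}" for k
  proof (rule tendsto_\<Omega>[OF ratio_inverse_lim[OF k]])
    have "((\<lambda>i. 1 - 1 / real (s i k) + 2 * (real_of_int (t i k) / real (p i)) * (real (p i) / real (s i k)))
      \<longlongrightarrow> 1 - 0 + 2 * \<tau> k * (1 / \<sigma> k)) F"
      by (intro tendsto_intros inverse_s_lim ratio_inverse_lim \<tau>_lim k)
    moreover have "\<forall>\<^sub>F i in F. 1 - 1 / real (s i k) + 2 * (real_of_int (t i k) / real (p i)) * (real (p i) / real (s i k)) =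
        (real (s i k) - 1 + 2 * of_int (t i k)) / real (s i k)"
      using ev
    proof eventually_elim
      case (elim i)
      then have "s i k \<ge> 1" "p i > 1" using k by auto
      then show ?case by (simp add: field_simps)
    qed
    ultimately show "((\<lambda>i. (real (s i k) - 1 + 2 * of_int (t i k)) / real (s i k)) \<longlongrightarrow> 1 + 2 * \<tau> k / \<sigma> k) F"
      using Lim_transform_eventually by fastforce
  qed (use \<sigma>_pos[OF k] in simp)
  \<comment> \<open>The step 1 / s tends to 0 here, outside the scope of
    \<open>tendsto_\<Omega>\<close>; the quadrature bounds squeeze the term instead.\<close>
  have c: "((\<lambda>i. \<Omega> (1 / real (s i k)) 0 / real (p i)) \<longlongrightarrow> 2 / 3 * \<sigma> k) F" if k: "k \<in> {1..e}" for k
  proof (rule tendsto_sandwich)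
    show "((\<lambda>i. 2 / 3 * (real (s i k) / real (p i))) \<longlongrightarrow> 2 / 3 * \<sigma> k) F"
      by (intro tendsto_intros \<sigma>_lim k)
    have "((\<lambda>i. 1 / real (p i) + 2 / 3 * (real (s i k) / real (p i))) \<longlongrightarrow> 0 + 2 / 3 * \<sigma> k) F"
      by (intro tendsto_intros inverse_p_lim \<sigma>_lim k)
    then show "((\<lambda>i. 1 / real (p i) + 2 / 3 * (real (s i k) / real (p i))) \<longlongrightarrow> 2 / 3 * \<sigma> k) F" by simp
    show "\<forall>\<^sub>F i in F. 2 / 3 * (real (s i k) / real (p i)) \<le> \<Omega> (1 / real (s i k)) 0 / real (p i)"
      using ev
    proof eventually_elim
      case (elim i)
      then have "real (s i k) > 0" using k by force
      then have "2 / 3 * real (s i k) \<le> \<Omega> (1 / real (s i k)) 0" using \<Omega>_0_ge[of "1 / real (s i k)"] by simp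
      then have "2 / 3 * real (s i k) / real (p i) \<le> \<Omega> (1 / real (s i k)) 0 / real (p i)"
        by (rule divide_right_mono) simp
      then show ?case by simp
    qed
    show "\<forall>\<^sub>F i in F. \<Omega> (1 / real (s i k)) 0 / real (p i) \<le> 1 / real (p i) + 2 / 3 * (real (s i k) / real (p i))"
      using ev
    proof eventually_elim
      case (elim i)
      then have "real (s i k) > 0" using k by force
      then have "\<Omega> (1 / real (s i k)) 0 \<le> 1 + 2 / 3 * real (s i k)" using \<Omega>_0_upper[of "1 / real (s i k)"] by simp
      then have "\<Omega> (1 / real (s i k)) 0 / real (p i) \<le> (1 + 2 / 3 * real (s i k)) / real (p i)"
        by (rule divide_right_mono) simp
      then show ?case by (simp add: add_divide_distrib)
    qed
  qed
  have "((\<lambda>i. main_term e (p i) (s i) (t i)) \<longlongrightarrow> 2 * (\<Prod>k\<in>{1..e}. \<Omega> (1 / \<sigma> k) 0) + (\<Prod>k\<in>{1..e}. \<Omega> (1 / \<sigma> k) (1 + 2 * \<tau> k / \<sigma> k))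
     - 2 * (\<Prod>k\<in>{1..e}. 2 / 3 * \<sigma> k)) F"
    unfolding main_term_def by (intro tendsto_intros a b c)
  moreover have "(\<Prod>k\<in>{1..e}. 2 / 3 * \<sigma> k) = (2 / 3) ^ e * (\<Prod>k\<in>{1..e}. \<sigma> k)"
    unfolding prod.distrib by simp
  ultimately show ?thesis by (simp add: limit_ratio_def power_divide algebra_simps)
qed

lemma error_term_lim: "((\<lambda>i. error_term e (p i) (s i)) \<longlongrightarrow> 0) F"
proof -
  have d: "((\<lambda>i. real (p i) powr (- 1 / 16)) \<longlongrightarrow> 0) F"
    by (rule tendsto_neg_powr[OF _ p_lim]) simp
  have l: "((\<lambda>i. (4 + 4 * ln (real (p i))) * real (p i) powr (- 1 / 16)) \<longlongrightarrow> 0) F"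
    by (rule filterlim_compose[OF powr_ln_decay p_lim])
  have k: "((\<lambda>i. ((2 * (real (s i k) / real (p i)) + 4 + 4 * ln (real (p i))) * real (p i) powr (- 1 / 16)) ^ 4
     * (real (p i) / real (s i k))\<^sup>2) \<longlongrightarrow> 0) F" if k: "k \<in> {1..e}" for k
  proof -
    have "((\<lambda>i. (2 * (real (s i k) / real (p i)) * real (p i) powr (- 1 / 16) + (4 + 4 * ln (real (p i))) * real (p i) powr (- 1 / 16)) ^ 4
     * (real (p i) / real (s i k))\<^sup>2) \<longlongrightarrow> (2 * \<sigma> k * 0 + 0) ^ 4 * (1 / \<sigma> k)\<^sup>2) F"
      by (intro tendsto_intros \<sigma>_lim d l ratio_inverse_lim k)
    then show ?thesis by (simp add: algebra_simps)
  qed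
  have "((\<lambda>i. error_term e (p i) (s i)) \<longlongrightarrow> 5 * (\<Prod>k\<in>{1..e}. 0)) F"
    unfolding error_term_def by (intro tendsto_intros k)
  then show ?thesis using e_pos by (simp add: power_0_left)
qed

text \<open>The proportion of zeros is at most 1/p + 1/s in each coordinate. It measures the
  deviation of the squared 2-norm from the size of the support.\<close>

lemma zero_count_lim:
  "((\<lambda>i. (\<Prod>k\<in>{1..e}. \<Sum>x<s i k. of_bool (int (p i) dvd int x + t i k)) / (\<Prod>k\<in>{1..e}. real (s i k))) \<longlongrightarrow> 0) F"
proof (rule tendsto_sandwich)
  show "\<forall>\<^sub>F i in F. 0 \<le> (\<Prod>k\<in>{1..e}. \<Sum>x<s i k. of_bool (int (p i) dvd int x + t i k)) / (\<Prod>k\<in>{1..e}. real (s i k))"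
    by (intro always_eventually allI divide_nonneg_nonneg prod_nonneg sum_nonneg) auto
  show "\<forall>\<^sub>F i in F. (\<Prod>k\<in>{1..e}. \<Sum>x<s i k. of_bool (int (p i) dvd int x + t i k)) / (\<Prod>k\<in>{1..e}. real (s i k))
      \<le> (\<Prod>k\<in>{1..e}. 1 / real (p i) + 1 / real (s i k))"
    using ev
  proof eventually_elim
    case (elim i)
    have "(\<Sum>x<s i k. of_bool (int (p i) dvd int x + t i k)) / real (s i k) \<le> 1 / real (p i) + 1 / real (s i k)"
      if k: "k \<in> {1..e}" for k
    proof -
      have s: "real (s i k) > 0" using elim k by force
      have "(\<Sum>x<s i k. of_bool (int (p i) dvd int x + t i k)) / real (s i k) \<le> (real (s i k) / real (p i) + 1) / real (s i k)"
        using elim by (intro divide_right_mono congruence_count_le) auto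
      also have "\<dots> = 1 / real (p i) + 1 / real (s i k)" using s by (simp add: add_divide_distrib)
      finally show ?thesis .
    qed
    then show ?case unfolding prod_dividef[symmetric]
      by (intro prod_mono conjI divide_nonneg_nonneg sum_nonneg) auto
  qed
  have "((\<lambda>i. \<Prod>k\<in>{1..e}. 1 / real (p i) + 1 / real (s i k)) \<longlongrightarrow> (\<Prod>k\<in>{1..e}. 0 + 0)) F"
    by (intro tendsto_intros inverse_p_lim inverse_s_lim)
  then show "((\<lambda>i. \<Prod>k\<in>{1..e}. 1 / real (p i) + 1 / real (s i k)) \<longlongrightarrow> 0) F"
    using e_pos by (simp add: power_0_left)
qed (rule tendsto_const)

end

lemma field_order_at_top_limits:
  assumes "e \<ge> 1"
  shows "filterlim (\<lambda>\<iota>. real (base_prime (f \<iota>))) at_top (field_order_at_top e I f)"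
    and "\<forall>\<^sub>F \<iota> in field_order_at_top e I f. \<iota> \<in> I"
proof -
  show "filterlim (\<lambda>\<iota>. real (base_prime (f \<iota>))) at_top (field_order_at_top e I f)"
  proof (rule filterlim_compose[OF filterlim_real_sequentially], unfold filterlim_at_top, rule allI)
    fix N :: nat
    have "\<forall>\<^sub>F n in at_top. N ^ e \<le> n" by (rule eventually_ge_at_top)
    then have "\<forall>\<^sub>F \<iota> in filtercomap (\<lambda>\<iota>. base_prime (f \<iota>) ^ e) at_top. N ^ e \<le> base_prime (f \<iota>) ^ e"
      by (rule eventually_filtercomapI)
    then have "\<forall>\<^sub>F \<iota> in field_order_at_top e I f. N ^ e \<le> base_prime (f \<iota>) ^ e"
      unfolding field_order_at_top_def by (rule filter_leD[OF inf_le1])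
    then show "\<forall>\<^sub>F \<iota> in field_order_at_top e I f. N \<le> base_prime (f \<iota>)"
      by eventually_elim (use assms in \<open>simp add: power_mono_iff\<close>)
  qed
  show "\<forall>\<^sub>F \<iota> in field_order_at_top e I f. \<iota> \<in> I"
    unfolding field_order_at_top_def by (rule filter_leD[OF inf_le2]) (simp add: eventually_principal)
qed

theorem norm_ratio_limit:
  assumes e: "e \<ge> 1" and qf: "\<forall>\<iota>\<in>I. quadratic_char_poly e (f \<iota>)"
    and ss: "size_stable e I f \<sigma>" and ts: "translation_stable e I f \<tau>"
  shows "((\<lambda>\<iota>. torus_norm e 4 (poly_value e (f \<iota>)) ^ 4 / torus_norm e 2 (poly_value e (f \<iota>)) ^ 4)
           \<longlongrightarrow> limit_ratio e \<sigma> \<tau>) (field_order_at_top e I f)"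
proof -
  let ?F = "field_order_at_top e I f"
  define p where "p \<iota> = base_prime (f \<iota>)" for \<iota>
  define s where "s \<iota> = support_size (f \<iota>)" for \<iota>
  define t where "t \<iota> = translation (f \<iota>)" for \<iota>
  have in_I: "\<forall>\<^sub>F \<iota> in ?F. \<iota> \<in> I" by (rule field_order_at_top_limits(2)[OF e])
  have p_lim: "filterlim (\<lambda>\<iota>. real (p \<iota>)) at_top ?F"
    unfolding p_def by (rule field_order_at_top_limits(1)[OF e])
  have sp: "\<sigma> k > 0" and sl: "((\<lambda>\<iota>. real (s \<iota> k) / real (p \<iota>)) \<longlongrightarrow> \<sigma> k) ?F"
    and tl: "((\<lambda>\<iota>. real_of_int (t \<iota> k) / real (p \<iota>)) \<longlongrightarrow> \<tau> k) ?F" if "k \<in> {1..e}" for k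
    using ss ts that unfolding size_stable_def translation_stable_def s_def t_def p_def by blast+
  have ok: "p \<iota> > 1" "\<And>k. k \<in> {1..e} \<Longrightarrow> s \<iota> k \<ge> 1" if "\<iota> \<in> I" for \<iota>
    using norms_approx(1,2)[OF bspec[OF qf that] e] unfolding p_def s_def by blast+
  have ev: "\<forall>\<^sub>F \<iota> in ?F. p \<iota> > 1 \<and> (\<forall>k\<in>{1..e}. s \<iota> k \<ge> 1)"
    using in_I by eventually_elim (use ok in blast)
  interpret growing_family e p s t ?F \<sigma> \<tau>
    by standard (fact e p_lim sp sl tl ev)+
  let ?A = "\<lambda>\<iota>. torus_norm e 4 (poly_value e (f \<iota>)) ^ 4"
  let ?P = "\<lambda>\<iota>. \<Prod>k\<in>{1..e}. real (s \<iota> k)"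
  let ?Z = "\<lambda>\<iota>. \<Prod>k\<in>{1..e}. \<Sum>x<s \<iota> k. of_bool (int (p \<iota>) dvd int x + t \<iota> k)"
  let ?M = "\<lambda>\<iota>. main_term e (p \<iota>) (s \<iota>) (t \<iota>)" and ?R = "\<lambda>\<iota>. error_term e (p \<iota>) (s \<iota>)"
  have M: "(?M \<longlongrightarrow> limit_ratio e \<sigma> \<tau>) ?F" by (rule main_term_lim)
  have R: "(?R \<longlongrightarrow> 0) ?F" by (rule error_term_lim)
  have Z: "((\<lambda>\<iota>. ?Z \<iota> / ?P \<iota>) \<longlongrightarrow> 0) ?F" by (rule zero_count_lim)
  have close: "\<bar>?A \<iota> / (?P \<iota>)\<^sup>2 - ?M \<iota>\<bar> \<le> ?R \<iota>" if i: "\<iota> \<in> I" for \<iota>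
  proof -
    have P: "?P \<iota> > 0" using ok(2)[OF i] by (intro prod_pos) force
    have q: "real (p \<iota> ^ e) ^ 3 > 0" using ok(1)[OF i] by simp
    have en: "energy (s \<iota> k) n h = (real (s \<iota> k))\<^sup>2 * \<Omega> (real n / real (s \<iota> k)) (- of_int h / real (s \<iota> k))"
      if "k \<in> {1..e}" "n \<ge> 1" for k n h
      using energy_eq_\<Omega> ok(2)[OF i that(1)] that(2) by blast
    have e1: "(\<Prod>k\<in>{1..e}. energy (s \<iota> k) (p \<iota>) 0) = (?P \<iota>)\<^sup>2 * (\<Prod>k\<in>{1..e}. \<Omega> (real (p \<iota>) / real (s \<iota> k)) 0)"
      unfolding prod_power_distrib prod.distrib[symmetric] using ok(1)[OF i] by (intro prod.cong refl) (simp add: en)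
    have e2: "(\<Prod>k\<in>{1..e}. energy (s \<iota> k) (p \<iota>) (- (int (s \<iota> k) - 1 + 2 * t \<iota> k))) =
      (?P \<iota>)\<^sup>2 * (\<Prod>k\<in>{1..e}. \<Omega> (real (p \<iota>) / real (s \<iota> k)) ((real (s \<iota> k) - 1 + 2 * of_int (t \<iota> k)) / real (s \<iota> k)))"
      unfolding prod_power_distrib prod.distrib[symmetric] using ok(1)[OF i]
    proof (intro prod.cong refl)
      fix k assume k: "k \<in> {1..e}"
      have "- real_of_int (- (int (s \<iota> k) - 1 + 2 * t \<iota> k)) = real (s \<iota> k) - 1 + 2 * of_int (t \<iota> k)" by simp
      then show "energy (s \<iota> k) (p \<iota>) (- (int (s \<iota> k) - 1 + 2 * t \<iota> k)) =
          (real (s \<iota> k))\<^sup>2 * \<Omega> (real (p \<iota>) / real (s \<iota> k)) ((real (s \<iota> k) - 1 + 2 * of_int (t \<iota> k)) / real (s \<iota> k))"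
        using en[OF k, of "p \<iota>"] ok(1)[OF i] by (simp only: less_imp_le)
    qed
    have e3: "(\<Prod>k\<in>{1..e}. energy (s \<iota> k) 1 0) / real (p \<iota> ^ e) = (?P \<iota>)\<^sup>2 * (\<Prod>k\<in>{1..e}. \<Omega> (1 / real (s \<iota> k)) 0 / real (p \<iota>))"
    proof -
      have "(\<Prod>k\<in>{1..e}. energy (s \<iota> k) 1 0) = (?P \<iota>)\<^sup>2 * (\<Prod>k\<in>{1..e}. \<Omega> (1 / real (s \<iota> k)) 0)"
        unfolding prod_power_distrib prod.distrib[symmetric] by (intro prod.cong refl) (simp add: en)
      moreover have "(\<Prod>k\<in>{1..e}. \<Omega> (1 / real (s \<iota> k)) 0 / real (p \<iota>)) = (\<Prod>k\<in>{1..e}. \<Omega> (1 / real (s \<iota> k)) 0) / real (p \<iota> ^ e)"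
        unfolding prod_dividef by simp
      ultimately show ?thesis by simp
    qed
    have "2 * (\<Prod>k\<in>{1..e}. energy (s \<iota> k) (p \<iota>) 0) + (\<Prod>k\<in>{1..e}. energy (s \<iota> k) (p \<iota>) (- (int (s \<iota> k) - 1 + 2 * t \<iota> k)))
         - 2 * (\<Prod>k\<in>{1..e}. energy (s \<iota> k) 1 0) / real (p \<iota> ^ e) = (?P \<iota>)\<^sup>2 * ?M \<iota>"
      unfolding main_term_def times_divide_eq_right[symmetric] e1 e2 e3 by (simp only: algebra_simps)
    then have "real (p \<iota> ^ e) ^ 3 * \<bar>?A \<iota> - (?P \<iota>)\<^sup>2 * ?M \<iota>\<bar> \<le> real (p \<iota> ^ e) ^ 3 * (?P \<iota>)\<^sup>2 * ?R \<iota>"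
      using norms_approx(3)[OF bspec[OF qf i] e, folded p_def s_def t_def]
        normalized_error[OF ok(1)[OF i] ok(2)[OF i]] by (simp only:)
    then have "\<bar>?A \<iota> - (?P \<iota>)\<^sup>2 * ?M \<iota>\<bar> \<le> (?P \<iota>)\<^sup>2 * ?R \<iota>"
      unfolding mult.assoc using q by (rule mult_left_le_imp_le)
    moreover have "\<bar>?A \<iota> / (?P \<iota>)\<^sup>2 - ?M \<iota>\<bar> = \<bar>?A \<iota> - (?P \<iota>)\<^sup>2 * ?M \<iota>\<bar> / (?P \<iota>)\<^sup>2"
    proof -
      have "?A \<iota> / (?P \<iota>)\<^sup>2 - ?M \<iota> = (?A \<iota> - (?P \<iota>)\<^sup>2 * ?M \<iota>) / (?P \<iota>)\<^sup>2"
        using P by (simp only: diff_divide_distrib nonzero_mult_div_cancel_left power_not_zero less_imp_neq[symmetric] not_False_eq_True)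
      then show ?thesis by (simp only: abs_divide abs_power2)
    qed
    ultimately show ?thesis using P by (simp only: pos_divide_le_eq zero_less_power mult.commute)
  qed
  have lim4: "((\<lambda>\<iota>. ?A \<iota> / (?P \<iota>)\<^sup>2) \<longlongrightarrow> limit_ratio e \<sigma> \<tau>) ?F"
  proof -
    have "((\<lambda>\<iota>. ?A \<iota> / (?P \<iota>)\<^sup>2 - ?M \<iota>) \<longlongrightarrow> 0) ?F"
      by (rule Lim_null_comparison[OF _ R]) (use in_I close in \<open>auto elim: eventually_mono\<close>)
    from tendsto_add[OF this M] show ?thesis by simp
  qed
  \<comment> \<open>The fourth power of the 2-norm is (P - Z)^2; relative to P^2 this is a factor
    that tends to 1.\<close>
  have "((\<lambda>\<iota>. ?A \<iota> / (?P \<iota>)\<^sup>2 / (1 - ?Z \<iota> / ?P \<iota>)\<^sup>2) \<longlongrightarrow> limit_ratio e \<sigma> \<tau> / (1 - 0)\<^sup>2) ?F"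
    by (intro tendsto_intros lim4 Z) simp
  moreover have "\<forall>\<^sub>F \<iota> in ?F. ?A \<iota> / (?P \<iota>)\<^sup>2 / (1 - ?Z \<iota> / ?P \<iota>)\<^sup>2 =
      torus_norm e 4 (poly_value e (f \<iota>)) ^ 4 / torus_norm e 2 (poly_value e (f \<iota>)) ^ 4"
    using in_I
  proof eventually_elim
    case (elim \<iota>)
    have P: "?P \<iota> > 0" using ok(2)[OF elim] by (intro prod_pos) force
    have "torus_norm e 2 (poly_value e (f \<iota>)) ^ 4 = (torus_norm e 2 (poly_value e (f \<iota>)) ^ 2)\<^sup>2" by simp
    also have "\<dots> = (?P \<iota> - ?Z \<iota>)\<^sup>2"
      by (simp only: norms_approx(4)[OF bspec[OF qf elim] e] p_def s_def t_def)
    also have "?P \<iota> - ?Z \<iota> = ?P \<iota> * (1 - ?Z \<iota> / ?P \<iota>)" using P by (simp only: right_diff_distrib nonzero_mult_div_cancel_left times_divide_eq_right less_imp_neq[symmetric] not_False_eq_True)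
    finally show ?case by (simp only: power_mult_distrib divide_divide_eq_left)
  qed
  ultimately show ?thesis using Lim_transform_eventually by fastforce
qed

text \<open>The middle conjunct supplies the existence and uniqueness of the root that part (ii)
  presupposes.\<close>

theorem theorem5:
  fixes e :: nat
  assumes "e \<ge> 1"
  shows
    "(\<forall>(I :: 'i set) (f :: 'i \<Rightarrow> 'a char_poly) (\<sigma> :: nat \<Rightarrow> real) (\<tau> :: nat \<Rightarrow> real).
        (\<forall>\<iota>\<in>I. quadratic_char_poly e (f \<iota>)) \<and>
        size_stable e I f \<sigma> \<and> translation_stable e I f \<tau> \<longrightarrow>
        ((\<lambda>\<iota>. torus_norm e 4 (poly_value e (f \<iota>)) ^ 4 / torus_norm e 2 (poly_value e (f \<iota>)) ^ 4)
           \<longlongrightarrow> limit_ratio e \<sigma> \<tau>) (field_order_at_top e I f))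
     \<and>
     (\<exists>!x. optimal_size e x) \<and>
     (\<forall>(\<sigma> :: nat \<Rightarrow> real) (\<tau> :: nat \<Rightarrow> real). (\<forall>j\<in>{1..e}. \<sigma> j > 0) \<longrightarrow>
        ((\<forall>\<sigma>' \<tau>'. (\<forall>j\<in>{1..e}. \<sigma>' j > 0) \<longrightarrow> limit_ratio e \<sigma> \<tau> \<le> limit_ratio e \<sigma>' \<tau>') \<longleftrightarrow>
         (\<forall>j\<in>{1..e}. optimal_size e (\<sigma> j) \<and>
            \<tau> j \<in> {(1 - 2 * \<sigma> j) / 4 + real_of_int n / 2 | n. n \<in> (UNIV :: int set)})))"
proof (intro conjI allI impI)
  fix I :: "'i set" and f :: "'i \<Rightarrow> 'a char_poly" and \<sigma> \<tau> :: "nat \<Rightarrow> real"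
  assume "(\<forall>\<iota>\<in>I. quadratic_char_poly e (f \<iota>)) \<and> size_stable e I f \<sigma> \<and> translation_stable e I f \<tau>"
  then show "((\<lambda>\<iota>. torus_norm e 4 (poly_value e (f \<iota>)) ^ 4 / torus_norm e 2 (poly_value e (f \<iota>)) ^ 4)
      \<longlongrightarrow> limit_ratio e \<sigma> \<tau>) (field_order_at_top e I f)"
    using norm_ratio_limit[OF assms] by blast
next
  show "\<exists>!x. optimal_size e x" by (rule optimal_size_unique[OF assms])
next
  fix \<sigma> \<tau> :: "nat \<Rightarrow> real"
  assume "\<forall>j\<in>{1..e}. \<sigma> j > 0"
  then show "(\<forall>\<sigma>' \<tau>'. (\<forall>j\<in>{1..e}. \<sigma>' j > 0) \<longrightarrow> limit_ratio e \<sigma> \<tau> \<le> limit_ratio e \<sigma>' \<tau>') \<longleftrightarrow>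
      (\<forall>j\<in>{1..e}. optimal_size e (\<sigma> j) \<and>
        \<tau> j \<in> {(1 - 2 * \<sigma> j) / 4 + real_of_int n / 2 | n. n \<in> (UNIV :: int set)})"
    by (rule limit_ratio_minimizers[OF assms])
qed

end
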